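(* Let $p\in(1,\infty)$, $s\in(0,1)$, let $\Omega\subset\mathbb{R}^N$ be a smooth bounded domain with $N>sp$, let $\gamma>0$ and let $f\in L^1(\Omega)$ be non-negative. Consider the problem $$(-\Delta)_p^s u=\frac{f(x)}{u^\gamma}\ \text{ in }\Omega,\qquad u>0\ \text{ in }\Omega,\qquad u=0\ \text{ in }\mathbb{R}^N\setminus\Omega. \qquad (P)$$ Under zero Dirichlet boundary conditions, understood as "$u=0$ on $\partial\Omega$" in the sense defined in the context, the solution to $(P)$ is unique: if $u$ and $v$ are weak solutions of $(P)$ with $u=0$ and $v=0$ on $\partial\Omega$ in this sense, then $u=v$ a.e. in $\Omega$.
   Context: For measurable $u:\mathbb{R}^N\to\mathbb{R}$ let $[u]_{D^{s,p}(\mathbb{R}^N)}:=\left(\int_{\mathbb{R}^{2N}}\frac{|u(x)-u(y)|^p}{|x-y|^{N+sp}}\,dx\,dy\right)^{1/p}$, $W^{s,p}(\mathbb{R}^N):=\{u\in L^p(\mathbb{R}^N):[u]_{D^{s,p}(\mathbb{R}^N)}<\infty\}$, and $W^{s,p}_0(\Omega):=\{u\in W^{s,p}(\mathbb{R}^N): u=0 \text{ in }\mathbb{R}^N\setminus\Omega\}$. $W^{s,p}_{\rm loc}(\Omega)$ is the set of functions $u$ with $u\in L^p(K)$ and $\int_{K\times K}\frac{|u(x)-u(y)|^p}{|x-y|^{N+sp}}\,dx\,dy<\infty$ for all $K\Subset\Omega$. $(-\Delta)^s_p$ denotes the fractional $p$-Laplacian. Weak solution of $(P)$: a function $u\in W^{s,p}_{\rm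 loc}(\Omega)\cap L^{p-1}(\Omega)$, with $u>0$ in $\Omega$ and $u=0$ in $\mathbb{R}^N\setminus\Omega$, such that $u^{\max\{\frac{\gamma+p-1}{p},1\}}\in W^{s,p}_0(\Omega)$, $\frac{f}{u^\gamma}\in L^1_{\rm loc}(\Omega)$, and $$\int_{\mathbb{R}^{2N}}\frac{|u(x)-u(y)|^{p-2}(u(x)-u(y))(\varphi(x)-\varphi(y))}{|x-y|^{N+sp}}\,dx\,dy=\int_\Omega\frac{f(x)}{u^\gamma}\varphi\,dx\qquad\text{for every }\varphi\in C^\infty_c(\Omega).$$ Boundary condition: let $u=0$ in $\mathbb{R}^N\setminus\Omega$. One says $u\le0$ on $\partial\Omega$ if $(u-\varepsilon)^+\in W^{s,p}_0(\Omega)$ for every $\varepsilon>0$, and $u=0$ on $\partial\Omega$ if $u$ is nonnegative and $u\le0$ on $\partial\Omega$. *)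

theory Defs
  imports "HOL-Analysis.Analysis"
begin

text \<open>Throughout, \<open>\<real>\<^sup>N\<close> is a type \<open>'a :: euclidean_space\<close> with \<open>N = DIM('a)\<close>, and functions defined
  almost everywhere are represented by total functions whose pointwise properties are only
  required almost everywhere.\<close>

primrec Ck :: "nat \<Rightarrow> ('a::euclidean_space \<Rightarrow> real) \<Rightarrow> bool" where
  "Ck 0 g \<longleftrightarrow> continuous_on UNIV g"
| "Ck (Suc k) g \<longleftrightarrow> (\<forall>x. g differentiable at x) \<and>
     (\<forall>b\<in>Basis. Ck k (\<lambda>x. frechet_derivative g (at x) b))"

definition smooth :: "('a::euclidean_space \<Rightarrow> real) \<Rightarrow> bool" where
  "smooth g \<longleftrightarrow> (\<forall>k. Ck k g)"

text \<open>The boundary is locally a smooth graph: near each boundary point, after choosing a unit vector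
  \<open>e\<close> as the last coordinate direction, the set is the strict epigraph of a smooth function of the
  remaining coordinates. Those coordinates of \<open>x\<close> are its projection \<open>x - (x \<bullet> e) *\<^sub>R e\<close> to the
  hyperplane orthogonal to \<open>e\<close>, so the values of \<open>g\<close> off that hyperplane are irrelevant.\<close>

definition smooth_boundary :: "'a::euclidean_space set \<Rightarrow> bool" where
  "smooth_boundary \<Omega> \<longleftrightarrow>
     (\<forall>x0\<in>frontier \<Omega>. \<exists>r>0. \<exists>e g. norm e = 1 \<and> smooth g \<and>
        \<Omega> \<inter> ball x0 r = {x \<in> ball x0 r. g (x - (x \<bullet> e) *\<^sub>R e) < x \<bullet> e})"

definition smooth_bounded_domain :: "'a::euclidean_space set \<Rightarrow> bool" where
  "smooth_bounded_domain \<Omega> \<longleftrightarrow>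
     open \<Omega> \<and> connected \<Omega> \<and> \<Omega> \<noteq> {} \<and> bounded \<Omega> \<and> smooth_boundary \<Omega>"

definition test_function :: "'a::euclidean_space set \<Rightarrow> ('a \<Rightarrow> real) \<Rightarrow> bool" where
  "test_function \<Omega> \<phi> \<longleftrightarrow> smooth \<phi> \<and> compact (closure {x. \<phi> x \<noteq> 0}) \<and> closure {x. \<phi> x \<noteq> 0} \<subseteq> \<Omega>"

definition compactly_inside :: "'a::euclidean_space set \<Rightarrow> 'a set \<Rightarrow> bool" where
  "compactly_inside K \<Omega> \<longleftrightarrow> K \<in> sets lebesgue \<and> compact (closure K) \<and> closure K \<subseteq> \<Omega>"

definition in_Lp :: "real \<Rightarrow> 'a::euclidean_space set \<Rightarrow> ('a \<Rightarrow> real) \<Rightarrow> bool" where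
  "in_Lp q A u \<longleftrightarrow> set_borel_measurable lebesgue A u \<and>
     (\<integral>\<^sup>+x\<in>A. ennreal (\<bar>u x\<bar> powr q) \<partial>lebesgue) < \<infinity>"

text \<open>The \<open>p\<close>-th power of the Gagliardo seminorm over \<open>A\<close>; the seminorm is finite if and only if
  its \<open>p\<close>-th power is. On the diagonal the integrand is \<open>0\<close>, as \<open>0 powr a = 0\<close>.\<close>

definition gagliardo_pow :: "real \<Rightarrow> real \<Rightarrow> 'a::euclidean_space set \<Rightarrow> ('a \<Rightarrow> real) \<Rightarrow> ennreal" where
  "gagliardo_pow s p A u =
     (\<integral>\<^sup>+z\<in>A \<times> A. ennreal (\<bar>u (fst z) - u (snd z)\<bar> powr p
        / norm (fst z - snd z) powr (real DIM('a) + s * p)) \<partial>(lebesgue \<Otimes>\<^sub>M lebesgue))"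

definition in_Wsp :: "real \<Rightarrow> real \<Rightarrow> ('a::euclidean_space \<Rightarrow> real) \<Rightarrow> bool" where
  "in_Wsp s p u \<longleftrightarrow> in_Lp p UNIV u \<and> gagliardo_pow s p UNIV u < \<infinity>"

definition zero_outside :: "'a::euclidean_space set \<Rightarrow> ('a \<Rightarrow> real) \<Rightarrow> bool" where
  "zero_outside \<Omega> u \<longleftrightarrow> (AE x in lebesgue. x \<notin> \<Omega> \<longrightarrow> u x = 0)"

definition in_Wsp0 :: "real \<Rightarrow> real \<Rightarrow> 'a::euclidean_space set \<Rightarrow> ('a \<Rightarrow> real) \<Rightarrow> bool" where
  "in_Wsp0 s p \<Omega> u \<longleftrightarrow> in_Wsp s p u \<and> zero_outside \<Omega> u"

definition in_Wsp_loc :: "real \<Rightarrow> real \<Rightarrow> 'a::euclidean_space set \<Rightarrow> ('a \<Rightarrow> real) \<Rightarrow> bool" where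
  "in_Wsp_loc s p \<Omega> u \<longleftrightarrow>
     (\<forall>K. compactly_inside K \<Omega> \<longrightarrow> in_Lp p K u \<and> gagliardo_pow s p K u < \<infinity>)"

text \<open>The weak formulation includes that the left-hand integral exists; this is automatic for
  \<open>u\<close> in the function spaces required by the definition.\<close>

definition weak_solution ::
  "real \<Rightarrow> real \<Rightarrow> real \<Rightarrow> ('a::euclidean_space \<Rightarrow> real) \<Rightarrow> 'a set \<Rightarrow> ('a \<Rightarrow> real) \<Rightarrow> bool" where
  "weak_solution s p \<gamma> f \<Omega> u \<longleftrightarrow>
     in_Wsp_loc s p \<Omega> u \<and> in_Lp (p - 1) \<Omega> u \<and>
     (AE x in lebesgue. x \<in> \<Omega> \<longrightarrow> 0 < u x) \<and> zero_outside \<Omega> u \<and>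
     in_Wsp0 s p \<Omega> (\<lambda>x. u x powr max ((\<gamma> + p - 1) / p) 1) \<and>
     (\<forall>K. compactly_inside K \<Omega> \<longrightarrow> set_integrable lebesgue K (\<lambda>x. f x / u x powr \<gamma>)) \<and>
     (\<forall>\<phi>. test_function \<Omega> \<phi> \<longrightarrow>
        has_bochner_integral (lebesgue \<Otimes>\<^sub>M lebesgue)
          (\<lambda>(x, y). \<bar>u x - u y\<bar> powr (p - 2) * (u x - u y) * (\<phi> x - \<phi> y)
             / norm (x - y) powr (real DIM('a) + s * p))
          (LINT x:\<Omega>|lebesgue. f x / u x powr \<gamma> * \<phi> x))"

definition le_zero_on_boundary ::
  "real \<Rightarrow> real \<Rightarrow> 'a::euclidean_space set \<Rightarrow> ('a \<Rightarrow> real) \<Rightarrow> bool" where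
  "le_zero_on_boundary s p \<Omega> u \<longleftrightarrow> (\<forall>\<epsilon>>0. in_Wsp0 s p \<Omega> (\<lambda>x. max (u x - \<epsilon>) 0))"

text \<open>Only meant for functions \<open>u\<close> that vanish outside \<open>\<Omega>\<close>.\<close>

definition zero_on_boundary ::
  "real \<Rightarrow> real \<Rightarrow> 'a::euclidean_space set \<Rightarrow> ('a \<Rightarrow> real) \<Rightarrow> bool" where
  "zero_on_boundary s p \<Omega> u \<longleftrightarrow> (AE x in lebesgue. 0 \<le> u x) \<and> le_zero_on_boundary s p \<Omega> u"

end

theory Submission
  imports Defs
begin

text \<open>Fix \<open>\<epsilon> > 0\<close> and let \<open>\<Phi>(t) = |t|\<^sup>p\<^sup>-\<^sup>2 t\<close>, \<open>U = (u - \<epsilon>)\<^sup>+\<close>. Formally one tests the difference of the two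
  equations with a bounded truncation of \<open>(u - v - \<epsilon>)\<^sup>+ = (U - v)\<^sup>+\<close>: the right-hand side is \<open>\<le> 0\<close> because
  \<open>u > v\<close> where the test function is positive, and by monotonicity of \<open>\<Phi>\<close> the left-hand integrand is \<open>\<ge> 0\<close>,
  hence zero. A pair with one point where \<open>u > v + \<epsilon>\<close> and the other outside \<open>\<Omega>\<close> makes it positive,
  so \<open>u \<le> v + \<epsilon>\<close> almost everywhere.

  When \<open>\<gamma> > 1\<close> this test function need not have finite energy, as \<open>v\<close> is only locally in \<open>W\<^sup>s\<^sup>,\<^sup>p\<close>. One therefore
  uses \<open>\<psi>\<^sub>n = S(U \<eta>\<^sub>n - v)\<close>, where \<open>S\<close> clamps to \<open>[0,1]\<close> and \<open>\<eta>\<^sub>n\<close> cuts off at distance about \<open>1/n\<close> from the complement of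
  \<open>\<Omega>\<close>, and passes to the limit by Fatou's lemma. The lower bound comes from
  \<open>(\<Phi>(A) - \<Phi>(B)) (C - B) \<ge> - 4 (|A|\<^sup>p + |C|\<^sup>p)\<close>, in which \<open>B\<close>, the difference of \<open>v\<close>, has disappeared. On the pairs
  that matter \<open>max(u(x), u(y)) \<ge> \<epsilon>\<close>, so \<open>A\<close> is controlled by the finite energy of the power of \<open>u\<close> in the
  definition of a weak solution; \<open>C\<close>, the difference of \<open>U \<eta>\<^sub>n\<close>, is dominated uniformly in \<open>n\<close> by the fractional Hardy
  inequality, which for functions vanishing outside \<open>\<Omega>\<close> only needs exterior balls at the boundary.

  The functions \<open>\<psi>\<^sub>n\<close> are admissible because a bounded function of finite energy with compact support in \<open>\<Omega>\<close> is
  an almost everywhere limit of mollifications, whose energy does not increase by Jensen's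
  inequality; Fatou's lemma for the form and for its negative then transfers the weak formulation.\<close>

section \<open>The monotone flux and the truncated kernel\<close>

text \<open>The parameter \<epsilon> is what makes u usable: where u >= \<epsilon>, differences of u
  are at most \<epsilon>^(1-\<beta>) times differences of u^\<beta>, with \<beta> =
  max((\<gamma>+p-1)/p, 1). This constant may blow up as \<epsilon> tends to 0, so \<epsilon> stays
  fixed during the limit in n. Hardy's inequality enters through the product rule for the cut-off U:
  the error U(y) |eta_n(x) - eta_n(y)| is at most U(y) min(1, 4 |x-y| / d(y)), with d the distance
  to the complement, for every n; integrating its p-th power against the kernel in x leaves a
  multiple of U(y)^p d(y)^(-sp). Admissibility rests on splitting pairs: near ones lie in a compact
  subset, where local energies suffice, and distant ones see a kernel away from its singularity,
  where boundedness suffices; hence the clamp to [0,1]. Borel representatives are used because the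
  product of two completed Lebesgue measures is not Borel Lebesgue measure on the product, and
  because positivity everywhere in \<Omega> removes exceptional sets from pointwise
  arguments.\<close>

definition pflux :: "real \<Rightarrow> real \<Rightarrow> real" where
  "pflux p t = \<bar>t\<bar> powr (p - 2) * t"

lemma abs_pflux: "\<bar>pflux p t\<bar> = \<bar>t\<bar> powr (p - 1)"
proof (cases "t = 0")
  case False
  then have "\<bar>t\<bar> powr (p - 2) * \<bar>t\<bar> = \<bar>t\<bar> powr (p - 2 + 1)"
    by (subst powr_add) auto
  then show ?thesis by (simp add: pflux_def abs_mult)
qed (simp add: pflux_def)

lemma pflux_minus [simp]: "pflux p (- t) = - pflux p t"
  by (simp add: pflux_def)

lemma pflux_nonneg: "0 \<le> t \<Longrightarrow> pflux p t = t powr (p - 1)"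
  using abs_pflux[of p t] by (simp add: pflux_def)

lemma pflux_strict_mono:
  assumes "1 < p" "a < b"
  shows "pflux p a < pflux p b"
proof -
  have pos: "pflux p x < pflux p y" if "0 \<le> x" "x < y" for x y
    using that assms(1) by (auto simp: pflux_nonneg intro!: powr_less_mono2)
  consider "0 \<le> a" | "a < 0" "0 < b" | "b \<le> 0" using assms(2) by linarith
  then show ?thesis
  proof cases
    case 1 then show ?thesis using pos assms(2) by auto
  next
    case 2
    then have "pflux p 0 < pflux p b" "pflux p 0 < - pflux p a"
      using pos[of 0 b] pos[of 0 "- a"] by auto
    moreover have "pflux p 0 = 0" by (simp add: pflux_def)
    ultimately show ?thesis by simp
  next
    case 3 then show ?thesis using pos[of "-b" "-a"] assms(2) by auto
  qed
qed

lemma pflux_mono: "1 < p \<Longrightarrow> a \<le> b \<Longrightarrow> pflux p a \<le> pflux p b"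
  using pflux_strict_mono[of p a b] by (cases "a = b") auto

lemma powr_max_le_sum: "max (a::real) b powr q \<le> a powr q + b powr q"
  by (auto simp: max_def)

lemma powr_pred_mult_le:
  fixes a b :: real
  assumes "0 \<le> a" "0 \<le> b" "1 < p"
  shows "a powr (p - 1) * b \<le> a powr p + b powr p"
proof -
  have "a powr (p - 1) * b \<le> max a b powr (p - 1) * max a b"
    using assms by (intro mult_mono powr_mono2) auto
  also have "\<dots> = max a b powr p"
    using assms by (cases "max a b = 0") (auto simp: powr_diff)
  also note powr_max_le_sum
  finally show ?thesis .
qed

text \<open>If \<open>\<bar>B\<bar>\<close> exceeds both \<open>\<bar>A\<bar>\<close> and \<open>\<bar>C\<bar>\<close>, then both factors have the sign opposite to \<open>B\<close>.\<close>

lemma pflux_product_lower_bound: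
  assumes p: "1 < p"
  shows "- (4 * (\<bar>A\<bar> powr p + \<bar>C\<bar> powr p)) \<le> (pflux p A - pflux p B) * (C - B)"
proof -
  define m where "m = max \<bar>A\<bar> \<bar>C\<bar>"
  have m0: "0 \<le> m" and AC: "\<bar>A\<bar> \<le> m" "\<bar>C\<bar> \<le> m" by (auto simp: m_def)
  have mp: "m powr p \<le> \<bar>A\<bar> powr p + \<bar>C\<bar> powr p"
    unfolding m_def by (rule powr_max_le_sum)
  consider "\<bar>B\<bar> \<le> m" | "m < B" | "B < - m" by linarith
  then show ?thesis
  proof cases
    case 1
    have "\<bar>(pflux p A - pflux p B) * (C - B)\<bar> \<le> (m powr (p - 1) + m powr (p - 1)) * (m + m)"
    proof -
      have "\<bar>pflux p A\<bar> \<le> m powr (p - 1)" "\<bar>pflux p B\<bar> \<le> m powr (p - 1)"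
        using AC 1 p by (auto simp: abs_pflux intro!: powr_mono2)
      then show ?thesis
        unfolding abs_mult using AC 1 by (intro mult_mono) auto
    qed
    also have "\<dots> = 4 * (m powr (p - 1) * m)" by (simp add: algebra_simps)
    also have "m powr (p - 1) * m = m powr p"
      using m0 by (cases "m = 0") (auto simp: powr_diff)
    finally show ?thesis using mp by (simp add: abs_le_iff)
  next
    case 2
    then have "pflux p A - pflux p B \<le> 0" "C - B \<le> 0"
      using AC pflux_mono[OF p, of A B] by auto
    then have "0 \<le> (pflux p A - pflux p B) * (C - B)" by (rule mult_nonpos_nonpos)
    then show ?thesis by (rule order_trans[rotated])
        (simp only: neg_le_0_iff_le, intro mult_nonneg_nonneg add_nonneg_nonneg, auto)
  next
    case 3
    then have "0 \<le> pflux p A - pflux p B" "0 \<le> C - B"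
      using AC pflux_mono[OF p, of B A] by auto
    then have "0 \<le> (pflux p A - pflux p B) * (C - B)" by (rule mult_nonneg_nonneg)
    then show ?thesis by (rule order_trans[rotated])
        (simp only: neg_le_0_iff_le, intro mult_nonneg_nonneg add_nonneg_nonneg, auto)
  qed
qed

text \<open>Comparing the sum with twice the larger summand works for every positive exponent;
  \<open>weak_form_extension\<close> uses \<open>p - 1\<close>, which may be less than 1.\<close>

lemma powr_add_le:
  fixes a b :: real
  assumes "0 \<le> a" "0 \<le> b" "0 < p"
  shows "(a + b) powr p \<le> 2 powr p * (a powr p + b powr p)"
proof -
  have "(a + b) powr p \<le> (2 * max a b) powr p"
    using assms by (intro powr_mono2) auto
  also have "\<dots> = 2 powr p * max a b powr p"
    using assms by (simp add: powr_mult)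
  also have "\<dots> \<le> 2 powr p * (a powr p + b powr p)"
    by (intro mult_left_mono powr_max_le_sum) auto
  finally show ?thesis .
qed

section \<open>Dyadic summation of the truncated kernel\<close>

lemma dyadic_bracket:
  fixes r :: real
  assumes "1 \<le> r"
  obtains i :: nat where "2 powr real i \<le> r" "r \<le> 2 powr (real i + 1)"
proof
  define i where "i = nat \<lfloor>log 2 r\<rfloor>"
  have "0 \<le> log 2 r" using assms by simp
  then have "real i \<le> log 2 r" "log 2 r \<le> real i + 1"
    unfolding i_def by linarith+
  then have "2 powr real i \<le> 2 powr log 2 r" "2 powr log 2 r \<le> 2 powr (real i + 1)"
    by simp_all
  then show "2 powr real i \<le> r" "r \<le> 2 powr (real i + 1)"
    using assms by auto
qed

text \<open>Scaling dictates the power \<open>t powr - (s * p)\<close>. Beyond radius t the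
  integrand is |z|^(-N-sp), integrable at infinity because sp > 0; within it, it is t^(-p)
  |z|^(p-N-sp), integrable at 0 because s < 1. Covering each dyadic shell by the ball of its outer
  radius turns the integral into ball volumes and two geometric series.\<close>

lemma nn_integral_truncated_kernel:
  fixes s p :: real
  assumes s: "0 < s" "s < 1" and p: "1 < p"
  obtains C where "0 \<le> C"
    "\<And>t. 0 < t \<Longrightarrow> (\<integral>\<^sup>+z. ennreal (min 1 (norm z / t) powr p
        / norm (z::'a::euclidean_space) powr (real DIM('a) + s * p)) \<partial>lborel) \<le> ennreal (C * t powr - (s * p))"
proof
  define N where "N = real DIM('a)"
  define a where "a = N + s * p"
  define V where "V = unit_ball_vol N"
  \<comment> \<open>The ratios of the two series: one shell further out multiplies volume by 2^N and
    kernel by 2^(-a); one shell further in multiplies truncation by 2^(-p), kernel by 2^a and volume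
    by 2^(-N). Here a - N = sp.\<close>
  define q1 q2 where "q1 = 2 powr - (s * p)" and "q2 = 2 powr (s * p - p)"
  have N: "0 < N" by (simp add: N_def)
  have V: "0 \<le> V" by (simp add: V_def N_def)
  have sp: "0 < s * p" using s p by simp
  have spp: "s * p < p" using s p by simp
  have a: "0 < a" using N sp by (simp add: a_def)
  have q: "0 < q1" "q1 < 1" "0 < q2" "q2 < 1"
    using sp spp by (auto simp: q1_def q2_def powr_less_one)
  \<comment> \<open>The factor 2^N comes from using the outer radius for the volume in outer shells,
    2^a from using the inner radius for the kernel in inner shells.\<close>
  define C where "C = V * 2 powr N / (1 - q1) + V * 2 powr a / (1 - q2)"
  show "0 \<le> C" using V q by (simp add: C_def)
  fix t :: real assume t: "0 < t"
  \<comment> \<open>\<open>c i\<close> bounds the integrand for 2^i t <= |z| <= 2^(i+1) t, and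
    \<open>d i\<close> for 2^(-i-1) t <= |z| <= 2^(-i) t.\<close>
  define c where "c i = (2 powr real i * t) powr - a" for i :: nat
  define d where "d i = (2 powr - real i) powr p * (2 powr - (real i + 1) * t) powr - a" for i :: nat
  define B where "B r = (indicator (cball (0::'a) r) :: 'a \<Rightarrow> ennreal)" for r
  have [measurable]: "B r \<in> borel_measurable lborel" for r
    unfolding B_def by (intro borel_measurable_indicator) simp
  have vol: "(\<integral>\<^sup>+z. ennreal k * B r z \<partial>lborel) = ennreal (k * (V * r powr N))" if "0 \<le> k" "0 < r" for k r
  proof -
    have "(\<integral>\<^sup>+z. ennreal k * B r z \<partial>lborel) = ennreal k * emeasure lborel (cball (0::'a) r)"
      unfolding B_def by (subst nn_integral_cmult_indicator) auto
    also have "emeasure lborel (cball (0::'a) r) = ennreal (V * r powr N)"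
      using that by (simp add: emeasure_cball V_def N_def powr_realpow)
    finally show ?thesis using that by (simp add: ennreal_mult' )
  qed
  have pw: "ennreal (min 1 (norm z / t) powr p / norm z powr a)
      \<le> (\<Sum>i. ennreal (c i) * B (2 powr (real i + 1) * t) z) + (\<Sum>i. ennreal (d i) * B (2 powr - real i * t) z)"
    (is "?f z \<le> ?S1 + ?S2") for z :: 'a
  proof (cases "z = 0")
    case False
    define r where "r = norm z / t"
    have r: "0 < r" "norm z = r * t" using False t by (auto simp: r_def)
    show ?thesis
    proof (cases "1 \<le> r")
      case True
      then obtain i :: nat where i: "2 powr real i \<le> r" "r \<le> 2 powr (real i + 1)"
        by (rule dyadic_bracket)
      have "min 1 r powr p / norm z powr a = norm z powr - a"
        using True by (simp add: min_def powr_minus_divide)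
      also have "\<dots> \<le> c i"
        unfolding c_def r(2) using i a t by (intro powr_mono2') auto
      finally have "?f z \<le> ennreal (c i) * B (2 powr (real i + 1) * t) z"
        using i t by (simp add: B_def r_def[symmetric] r(2) ennreal_leI)
      also have "\<dots> \<le> ?S1"
        using sum_le_suminf[of "\<lambda>i. ennreal (c i) * B (2 powr (real i + 1) * t) z" "{i}"] by simp
      also have "\<dots> \<le> ?S1 + ?S2" by simp
      finally show ?thesis .
    next
      case False
      then have "1 \<le> 1 / r" using r by simp
      then obtain i :: nat where i: "2 powr real i \<le> 1 / r" "1 / r \<le> 2 powr (real i + 1)"
        by (rule dyadic_bracket)
      have i': "r \<le> 2 powr - real i" "2 powr - (real i + 1) \<le> r"
        using i r unfolding powr_minus_divide by (auto simp: field_simps)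
      have "min 1 r powr p / norm z powr a = r powr p * norm z powr - a"
        using False by (simp add: min_def powr_minus_divide)
      also have "\<dots> \<le> d i"
        unfolding d_def r(2) using i' a t r p
        by (intro mult_mono powr_mono2' powr_mono2 mult_right_mono) auto
      finally have "?f z \<le> ennreal (d i) * B (2 powr - real i * t) z"
        using i' t by (simp add: B_def r_def[symmetric] r(2) ennreal_leI)
      also have "\<dots> \<le> ?S2"
        using sum_le_suminf[of "\<lambda>i. ennreal (d i) * B (2 powr - real i * t) z" "{i}"] by simp
      also have "\<dots> \<le> ?S1 + ?S2" by simp
      finally show ?thesis .
    qed
  qed simp
  have c_vol: "c i * (V * (2 powr (real i + 1) * t) powr N) = (V * 2 powr N * t powr - (s * p)) * q1 ^ i" for i
  proof -
    have e1: "q1 ^ i = 2 powr (- (s * p) * real i)"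
      by (simp add: q1_def powr_realpow[symmetric] powr_powr)
    have e2: "c i * (2 powr (real i + 1) * t) powr N
        = 2 powr (real i * - a + (real i + 1) * N) * t powr (- a + N)"
      using t by (simp add: c_def powr_mult powr_powr powr_add powr_diff powr_minus_divide algebra_simps)
    have e3: "real i * - a + (real i + 1) * N = N + - (s * p) * real i" "- a + N = - (s * p)"
      by (simp_all add: a_def algebra_simps)
    show ?thesis
      unfolding mult.left_commute[of "c i"] e2 e3 e1 by (simp only: powr_add mult_ac)
  qed
  have d_vol: "d i * (V * (2 powr - real i * t) powr N) = (V * 2 powr a * t powr - (s * p)) * q2 ^ i" for i
  proof -
    have e1: "q2 ^ i = 2 powr ((s * p - p) * real i)"
      by (simp add: q2_def powr_realpow[symmetric] powr_powr)
    have e2: "d i * (2 powr - real i * t) powr N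
        = 2 powr (- real i * p + (real i + 1) * a + - real i * N) * t powr (- a + N)"
      using t by (simp add: d_def powr_mult powr_divide powr_powr powr_add powr_diff powr_minus_divide algebra_simps)
    have e3: "- real i * p + (real i + 1) * a + - real i * N = a + (s * p - p) * real i" "- a + N = - (s * p)"
      by (simp_all add: a_def algebra_simps)
    show ?thesis
      unfolding mult.left_commute[of "d i"] e2 e3 e1 by (simp only: powr_add mult_ac)
  qed
  have cd: "0 \<le> c i" "0 \<le> d i" for i by (simp_all add: c_def d_def)
  have rad: "0 < 2 powr (real i + 1) * t" "0 < 2 powr - real i * t" for i :: nat
    using t by simp_all
  have geo: "(\<Sum>i. ennreal (K * q ^ i)) = ennreal (K / (1 - q))" if "0 \<le> K" "0 < q" "q < 1" for K q :: real
  proof -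
    have "(\<lambda>i. K * q ^ i) sums (K * (1 / (1 - q)))"
      using that by (intro sums_mult geometric_sums) auto
    then show ?thesis
      using that by (subst suminf_ennreal_eq[of _ "K / (1 - q)"]) auto
  qed
  have "(\<integral>\<^sup>+z. ennreal (min 1 (norm z / t) powr p / norm (z::'a) powr a) \<partial>lborel)
      \<le> (\<integral>\<^sup>+z. (\<Sum>i. ennreal (c i) * B (2 powr (real i + 1) * t) z) + (\<Sum>i. ennreal (d i) * B (2 powr - real i * t) z) \<partial>lborel)"
    by (intro nn_integral_mono pw)
  also have "\<dots> = (\<Sum>i. \<integral>\<^sup>+z. ennreal (c i) * B (2 powr (real i + 1) * t) z \<partial>lborel)
      + (\<Sum>i. \<integral>\<^sup>+z. ennreal (d i) * B (2 powr - real i * t) z \<partial>lborel)"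
    by (simp add: nn_integral_add nn_integral_suminf)
  also have "\<dots> = (\<Sum>i. ennreal ((V * 2 powr N * t powr - (s * p)) * q1 ^ i))
      + (\<Sum>i. ennreal ((V * 2 powr a * t powr - (s * p)) * q2 ^ i))"
    by (simp only: vol c_vol d_vol cd rad)
  also have "\<dots> = ennreal (C * t powr - (s * p))"
    using V q by (subst (1 2) geo) (auto simp: C_def ennreal_plus[symmetric] algebra_simps simp del: ennreal_plus)
  finally show "(\<integral>\<^sup>+z. ennreal (min 1 (norm z / t) powr p
        / norm (z::'a) powr (real DIM('a) + s * p)) \<partial>lborel) \<le> ennreal (C * t powr - (s * p))"
    by (simp add: a_def N_def)
qed

section \<open>Exterior balls and the fractional Hardy inequality\<close>

text \<open>\<open>Ck\<close> controls derivatives only along basis vectors, whereas the mean value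
  inequality asks for an operator norm; this crude bound bridges the two.\<close>

lemma onorm_frechet_derivative_le:
  fixes g :: "'a::euclidean_space \<Rightarrow> real"
  assumes diff: "g differentiable at x" and B: "\<And>b. b \<in> Basis \<Longrightarrow> \<bar>frechet_derivative g (at x) b\<bar> \<le> B b"
  shows "onorm (frechet_derivative g (at x)) \<le> sum B Basis"
proof (rule onorm_bound)
  show "0 \<le> sum B Basis"
    using B by (meson abs_ge_zero order_trans sum_nonneg)
  fix h :: 'a
  let ?D = "frechet_derivative g (at x)"
  have lin: "linear ?D"
    using diff by (rule linear_frechet_derivative)
  have "norm (?D h) = \<bar>?D (\<Sum>b\<in>Basis. (h \<bullet> b) *\<^sub>R b)\<bar>"
    by (simp add: euclidean_representation)
  also have "\<dots> = \<bar>\<Sum>b\<in>Basis. (h \<bullet> b) * ?D b\<bar>"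
    by (simp add: linear_sum[OF lin] linear_cmul[OF lin])
  also have "\<dots> \<le> (\<Sum>b\<in>Basis. \<bar>(h \<bullet> b) * ?D b\<bar>)" by (rule sum_abs)
  also have "\<dots> \<le> (\<Sum>b\<in>Basis. norm h * B b)"
    using B by (intro sum_mono) (auto simp: abs_mult Basis_le_norm intro!: mult_mono)
  finally show "norm (?D h) \<le> sum B Basis * norm h"
    by (simp add: sum_distrib_left mult.commute)
qed

lemma Ck_1_lipschitz_on_cball:
  fixes g :: "'a::euclidean_space \<Rightarrow> real"
  assumes "Ck 1 g"
  obtains L where "0 \<le> L" "\<And>x y. x \<in> cball c r \<Longrightarrow> y \<in> cball c r \<Longrightarrow> \<bar>g x - g y\<bar> \<le> L * norm (x - y)"
proof -
  let ?D = "\<lambda>x. frechet_derivative g (at x)"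
  have diff: "g differentiable at x" for x
    using assms by simp
  have cont: "continuous_on UNIV (\<lambda>x. ?D x b)" if "b \<in> Basis" for b
    using assms that by simp
  have "\<exists>B. \<forall>x\<in>cball c r. \<bar>?D x b\<bar> \<le> B" if "b \<in> Basis" for b
  proof -
    have "bounded ((\<lambda>x. ?D x b) ` cball c r)"
      using cont[OF that] by (intro compact_imp_bounded compact_continuous_image)
        (auto intro: continuous_on_subset)
    then show ?thesis by (auto simp: bounded_iff)
  qed
  then obtain B where B: "\<And>b x. b \<in> Basis \<Longrightarrow> x \<in> cball c r \<Longrightarrow> \<bar>?D x b\<bar> \<le> B b"
    by metis
  have on: "onorm (?D x) \<le> \<bar>sum B Basis\<bar>" if "x \<in> cball c r" for x
    using onorm_frechet_derivative_le[OF diff B] that by (meson abs_ge_self order_trans)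
  show ?thesis
  proof
    show "0 \<le> \<bar>sum B Basis\<bar>" by simp
    fix x y assume "x \<in> cball c r" "y \<in> cball c r"
    then show "\<bar>g x - g y\<bar> \<le> \<bar>sum B Basis\<bar> * norm (x - y)"
      using differentiable_bound[of "cball c r" g ?D "\<bar>sum B Basis\<bar>" x y] on diff
      by (auto simp: frechet_derivative_works intro: has_derivative_at_withinI)
  qed
qed

text \<open>Below a Lipschitz graph there is room at every scale: descend by \<open>t\<close> along
  \<open>e\<close> from a boundary point, then move by less than \<open>\<rho> * t\<close>; the move
  raises the point by less than \<open>\<rho> * t\<close> and lowers the graph by at most
  \<open>L * \<rho> * t\<close>. The radius is proportional to \<open>t\<close>, as the scaling of
  the Hardy weight requires.\<close>

lemma exterior_ball_local:
  fixes \<Omega> :: "'a::euclidean_space set"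
  assumes "open \<Omega>" "smooth_boundary \<Omega>" "x0 \<in> frontier \<Omega>"
  obtains r \<rho> t0 where "0 < r" "0 < \<rho>" "0 < t0"
    "\<And>x t. x \<in> frontier \<Omega> \<Longrightarrow> x \<in> ball x0 r \<Longrightarrow> 0 < t \<Longrightarrow> t \<le> t0 \<Longrightarrow> \<exists>c. ball c (\<rho> * t) \<subseteq> ball x (2 * t) - \<Omega>"
proof -
  from assms obtain r e g where r: "0 < r" and e: "norm e = 1" and g: "smooth g"
    and eq: "\<Omega> \<inter> ball x0 r = {x \<in> ball x0 r. g (x - (x \<bullet> e) *\<^sub>R e) < x \<bullet> e}"
    unfolding smooth_boundary_def by meson
  define P where "P x = x - (x \<bullet> e) *\<^sub>R e" for x :: 'a
  have ee: "e \<bullet> e = 1" using e by (simp add: dot_square_norm)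
  have P_diff: "P x - P y = P (x - y)" for x y
    by (simp add: P_def algebra_simps inner_diff_left)
  have P_norm: "norm (P x) \<le> norm x" for x
  proof -
    have "P x \<bullet> P x = x \<bullet> x - (x \<bullet> e) * (x \<bullet> e)"
      using ee by (simp add: P_def inner_diff_left inner_diff_right inner_commute[of e x] algebra_simps)
    then show ?thesis by (simp add: norm_le)
  qed
  have "Ck 1 g" using g by (simp only: smooth_def)
  then obtain L where L: "0 \<le> L"
      "\<And>x y. x \<in> cball (P x0) r \<Longrightarrow> y \<in> cball (P x0) r \<Longrightarrow> \<bar>g x - g y\<bar> \<le> L * norm (x - y)"
    using Ck_1_lipschitz_on_cball[of g "P x0" r] by metis
  \<comment> \<open>Balances the two errors of the move: \<open>\<rho> + L * \<rho> = 1\<close> is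
    the descent per unit of \<open>t\<close>.\<close>
  define \<rho> where "\<rho> = 1 / (1 + L)"
  have \<rho>: "0 < \<rho>" "\<rho> \<le> 1" "\<rho> + L * \<rho> = 1" using L by (auto simp: \<rho>_def field_simps)
  show ?thesis
  proof
    \<comment> \<open>Since \<open>2 * t \<le> r / 4\<close>, the ball of radius
      \<open>2 * t\<close> around \<open>x\<close> stays in \<open>ball x0 r\<close>, where the
      graph description is valid.\<close>
    show "0 < r / 2" "0 < \<rho>" "0 < r / 8" using r \<rho> by auto
    fix x t assume x: "x \<in> frontier \<Omega>" "x \<in> ball x0 (r / 2)" and t: "0 < t" "t \<le> r / 8"
    have in_cball: "P y \<in> cball (P x0) r" if "y \<in> ball x0 r" for y
      using that P_norm[of "x0 - y"] by (simp add: dist_norm P_diff)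
    have xr: "x \<in> ball x0 r" using x(2) r by auto
    have "x \<notin> \<Omega>" using x(1) assms(1) by (simp add: frontier_def interior_open)
    then have gx: "x \<bullet> e \<le> g (P x)" using eq xr unfolding P_def by force
    have "y \<in> ball x (2 * t) - \<Omega>" if y: "y \<in> ball (x - t *\<^sub>R e) (\<rho> * t)" for y
    proof -
      define \<xi> where "\<xi> = y - x + t *\<^sub>R e"
      have y_eq: "y = x + (\<xi> - t *\<^sub>R e)" by (simp add: \<xi>_def)
      have n\<xi>: "norm \<xi> < \<rho> * t"
        using y by (simp add: \<xi>_def dist_norm norm_minus_commute algebra_simps)
      have le_t: "\<rho> * t \<le> t"
        using \<rho> t by (intro mult_left_le_one_le) auto
      have nt: "norm (t *\<^sub>R e) = t" using t e by simp
      have "norm (y - x) \<le> norm \<xi> + norm (t *\<^sub>R e)"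
        using norm_triangle_ineq4[of \<xi> "t *\<^sub>R e"] by (simp add: y_eq)
      also have "\<dots> < 2 * t"
        using n\<xi> le_t nt by linarith
      finally have yx: "norm (y - x) < 2 * t" .
      have yr: "y \<in> ball x0 r"
      proof -
        have "dist x0 y \<le> dist x0 x + dist x y" by (rule dist_triangle)
        also have "\<dots> < r"
          using x(2) yx t by (simp add: dist_norm norm_minus_commute)
        finally show ?thesis by simp
      qed
      have "P y - P x = P \<xi>"
        using ee by (simp add: P_def y_eq inner_diff_left inner_add_left algebra_simps)
      then have "\<bar>g (P y) - g (P x)\<bar> \<le> L * norm \<xi>"
        using L(2)[OF in_cball[OF yr] in_cball[OF xr]] mult_left_mono[OF P_norm[of \<xi>] L(1)] by simp
      moreover have "L * norm \<xi> \<le> L * \<rho> * t"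
        using n\<xi> mult_left_mono[of "norm \<xi>" "\<rho> * t" L] L(1) by (simp add: mult.assoc)
      moreover have "y \<bullet> e = x \<bullet> e + \<xi> \<bullet> e - t"
        using ee by (simp add: y_eq inner_diff_left inner_add_left)
      moreover have "\<xi> \<bullet> e \<le> norm \<xi>"
        using norm_cauchy_schwarz[of \<xi> e] e by simp
      moreover have "\<rho> * t + L * \<rho> * t = t"
        using \<rho>(3) by (metis distrib_right mult_1)
      ultimately have "y \<bullet> e \<le> g (P y)" using gx n\<xi> by linarith
      then have "y \<notin> \<Omega>" using eq yr unfolding P_def by force
      then show ?thesis using yx by (simp add: dist_norm norm_minus_commute)
    qed
    then show "\<exists>c. ball c (\<rho> * t) \<subseteq> ball x (2 * t) - \<Omega>" by blast
  qed
qed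

lemma exterior_ball_uniform:
  fixes \<Omega> :: "'a::euclidean_space set"
  assumes "open \<Omega>" "bounded \<Omega>" "smooth_boundary \<Omega>"
  obtains \<rho> t0 where "0 < \<rho>" "0 < t0"
    "\<And>x t. x \<in> frontier \<Omega> \<Longrightarrow> 0 < t \<Longrightarrow> t \<le> t0 \<Longrightarrow> \<exists>c. ball c (\<rho> * t) \<subseteq> ball x (2 * t) - \<Omega>"
proof -
  have "\<forall>x0\<in>frontier \<Omega>. \<exists>r \<rho> t0. 0 < r \<and> 0 < \<rho> \<and> 0 < t0 \<and>
      (\<forall>x t. x \<in> frontier \<Omega> \<longrightarrow> x \<in> ball x0 r \<longrightarrow> 0 < t \<longrightarrow> t \<le> t0 \<longrightarrow> (\<exists>c. ball c (\<rho> * t) \<subseteq> ball x (2 * t) - \<Omega>))"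
    using exterior_ball_local[OF assms(1,3)] by metis
  then obtain r \<rho> t0 where *: "\<And>x0. x0 \<in> frontier \<Omega> \<Longrightarrow> 0 < r x0 \<and> 0 < \<rho> x0 \<and> 0 < t0 x0"
    and **: "\<And>x0 x t. x0 \<in> frontier \<Omega> \<Longrightarrow> x \<in> frontier \<Omega> \<Longrightarrow> x \<in> ball x0 (r x0) \<Longrightarrow> 0 < t \<Longrightarrow> t \<le> t0 x0
        \<Longrightarrow> \<exists>c. ball c (\<rho> x0 * t) \<subseteq> ball x (2 * t) - \<Omega>"
    by metis
  have "compact (frontier \<Omega>)"
    using assms(2) by (rule compact_frontier_bounded)
  moreover have "frontier \<Omega> \<subseteq> (\<Union>x0\<in>frontier \<Omega>. ball x0 (r x0))"
    using * by force
  ultimately obtain F where F: "F \<subseteq> frontier \<Omega>" "finite F" "frontier \<Omega> \<subseteq> (\<Union>x0\<in>F. ball x0 (r x0))"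
    by (elim compactE_image[where C = "frontier \<Omega>" and f = "\<lambda>x0. ball x0 (r x0)"]) auto
  show ?thesis
  proof
    \<comment> \<open>The inserted 1 keeps \<open>Min\<close> meaningful when the finite subcover
      \<open>F\<close> is empty.\<close>
    show "0 < Min (insert 1 (\<rho> ` F))" "0 < Min (insert 1 (t0 ` F))"
      using F * by (auto simp: subset_iff)
    fix x t assume x: "x \<in> frontier \<Omega>" and t: "0 < t" "t \<le> Min (insert 1 (t0 ` F))"
    then obtain x0 where x0: "x0 \<in> F" "x \<in> ball x0 (r x0)" using F by blast
    have "Min (insert 1 (t0 ` F)) \<le> t0 x0" and \<rho>: "Min (insert 1 (\<rho> ` F)) \<le> \<rho> x0"
      using x0 F by (auto intro!: Min_le)
    then obtain c where c: "ball c (\<rho> x0 * t) \<subseteq> ball x (2 * t) - \<Omega>"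
      using **[of x0 x t] x0 F x t by auto
    have "ball c (Min (insert 1 (\<rho> ` F)) * t) \<subseteq> ball c (\<rho> x0 * t)"
      using \<rho> t by (intro subset_ball mult_right_mono) auto
    with c show "\<exists>c. ball c (Min (insert 1 (\<rho> ` F)) * t) \<subseteq> ball x (2 * t) - \<Omega>" by blast
  qed
qed

section \<open>Exterior mass of the kernel and the Hardy inequality\<close>

lemma infdist_Compl_pos:
  assumes "open \<Omega>" "- \<Omega> \<noteq> {}" "x \<in> \<Omega>"
  shows "0 < infdist x (- \<Omega>)"
proof -
  have "infdist x (- \<Omega>) \<noteq> 0"
    using in_closed_iff_infdist_zero[of "- \<Omega>" x] assms by (simp add: closed_Compl)
  then show ?thesis using infdist_nonneg[of x "- \<Omega>"] by linarith
qed

lemma bounded_Compl_nonempty: "bounded \<Omega> \<Longrightarrow> - (\<Omega> :: 'a::euclidean_space set) \<noteq> {}"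
  using not_bounded_UNIV[where 'a = 'a] by (metis Compl_empty_eq double_complement)

text \<open>Let d be the distance from x to the complement. An exterior ball at the nearest boundary
  point, of radius comparable to d, has volume of order d^N and lies within 3 d of x, where the
  kernel is at least (3 d)^(-N-sp). The product is of order d^(-sp).\<close>

lemma nn_integral_kernel_exterior_ge:
  fixes \<Omega> :: "'a::euclidean_space set" and s p :: real
  assumes \<Omega>: "open \<Omega>" "bounded \<Omega>" "smooth_boundary \<Omega>" and sp: "0 < s * p"
  obtains c where "0 < c"
    "\<And>x. x \<in> \<Omega> \<Longrightarrow> ennreal (c * infdist x (- \<Omega>) powr - (s * p))
      \<le> (\<integral>\<^sup>+y. ennreal (1 / norm (x - y) powr (real DIM('a) + s * p)) * indicator (- \<Omega>) y \<partial>lborel)"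
proof -
  obtain \<rho> t0 where \<rho>: "0 < \<rho>" and t0: "0 < t0" and ext:
    "\<And>x t. x \<in> frontier \<Omega> \<Longrightarrow> 0 < t \<Longrightarrow> t \<le> t0 \<Longrightarrow> \<exists>c. ball c (\<rho> * t) \<subseteq> ball x (2 * t) - \<Omega>"
    using exterior_ball_uniform[OF \<Omega>] by metis
  define N where "N = real DIM('a)"
  define a where "a = N + s * p"
  define V where "V = unit_ball_vol N"
  have N: "0 < N" by (simp add: N_def)
  have V: "0 < V" by (simp add: V_def N_def)
  have a: "0 < a" using N sp by (simp add: a_def)
  have ne: "- \<Omega> \<noteq> {}" using \<Omega>(2) by (rule bounded_Compl_nonempty)
  obtain q where q: "q \<in> - \<Omega>" using ne by blast
  obtain R where R: "\<And>x. x \<in> \<Omega> \<Longrightarrow> dist q x \<le> R"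
    using \<Omega>(2) unfolding bounded_any_center[of _ q] by blast
  define D where "D = max R t0"
  have D: "0 < D" "t0 \<le> D" using t0 by (auto simp: D_def)
  define c where "c = 3 powr - a * V * (\<rho> * t0 / D) powr N"
  show ?thesis
  proof
    show "0 < c" using V \<rho> t0 D by (simp add: c_def)
    fix x assume x: "x \<in> \<Omega>"
    define d where "d = infdist x (- \<Omega>)"
    have d: "0 < d" unfolding d_def using infdist_Compl_pos[OF \<Omega>(1) ne x] .
    have "d \<le> dist x q" unfolding d_def using q by (rule infdist_le)
    also have "\<dots> \<le> D" using R[OF x] by (simp add: D_def dist_commute)
    finally have dD: "d \<le> D" .
    obtain x1 where x1: "x1 \<in> - \<Omega>" "d = dist x x1"
      using infdist_attains_inf[of "- \<Omega>" x] ne \<Omega>(1) unfolding d_def by (metis closed_Compl)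
    have "ball x d \<subseteq> \<Omega>"
    proof
      fix y assume "y \<in> ball x d"
      then show "y \<in> \<Omega>"
        using infdist_le[of y "- \<Omega>" x] unfolding d_def by force
    qed
    then have "cball x d \<subseteq> closure \<Omega>"
      using d closure_mono[of "ball x d" \<Omega>] by (simp add: closure_ball)
    then have x1_fr: "x1 \<in> frontier \<Omega>"
      using x1 \<Omega>(1) by (auto simp: frontier_def interior_open)
    \<comment> \<open>Linear in \<open>d\<close>, and because \<open>d \<le> D\<close> and
      \<open>t0 \<le> D\<close> it is at most \<open>t0\<close>, so that the exterior ball exists,
      and at most \<open>d\<close>, so that the ball stays within \<open>3 * d\<close> of
      \<open>x\<close>.\<close>
    define t where "t = t0 * d / D"
    have "t0 * d \<le> t0 * D" "t0 * d \<le> D * d"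
      using dD D t0 d by (auto intro: mult_left_mono mult_right_mono)
    then have t: "0 < t" "t \<le> t0" "t \<le> d"
      using t0 d D by (auto simp: t_def field_simps)
    obtain z where z: "ball z (\<rho> * t) \<subseteq> ball x1 (2 * t) - \<Omega>"
      using ext[OF x1_fr t(1,2)] by blast
    have pw: "ennreal ((3 * d) powr - a) * indicator (ball z (\<rho> * t)) y
        \<le> ennreal (1 / norm (x - y) powr a) * indicator (- \<Omega>) y" for y
    proof (cases "y \<in> ball z (\<rho> * t)")
      case True
      then have y: "y \<in> ball x1 (2 * t)" "y \<notin> \<Omega>" using z by auto
      have "dist x y \<le> dist x x1 + dist x1 y" by (rule dist_triangle)
      also have "\<dots> \<le> 3 * d" using y x1 t by auto
      finally have le: "norm (x - y) \<le> 3 * d" by (simp add: dist_norm)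
      have "0 < norm (x - y)" using x y by auto
      then have "(3 * d) powr - a \<le> norm (x - y) powr - a"
        using le a by (intro powr_mono2') auto
      then show ?thesis using True y by (simp add: powr_minus_divide ennreal_leI)
    qed simp
    have "c * d powr - (s * p) = (3 * d) powr - a * (V * (\<rho> * t) powr N)"
    proof -
      have "(\<rho> * t) powr N = (\<rho> * t0 / D) powr N * d powr N"
        using \<rho> t0 D d by (simp add: t_def powr_mult[symmetric] mult.assoc)
      moreover have "(3 * d) powr - a * d powr N = 3 powr - a * d powr - (s * p)"
        using d by (simp add: powr_mult mult.assoc powr_add[symmetric] a_def)
      ultimately show ?thesis by (simp add: c_def)
    qed
    then have "ennreal (c * d powr - (s * p)) = ennreal ((3 * d) powr - a) * emeasure lborel (ball z (\<rho> * t))"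
      using V \<rho> t by (simp add: emeasure_ball V_def N_def powr_realpow ennreal_mult')
    also have "\<dots> = (\<integral>\<^sup>+y. ennreal ((3 * d) powr - a) * indicator (ball z (\<rho> * t)) y \<partial>lborel)"
      by (subst nn_integral_cmult_indicator) auto
    also have "\<dots> \<le> (\<integral>\<^sup>+y. ennreal (1 / norm (x - y) powr a) * indicator (- \<Omega>) y \<partial>lborel)"
      by (intro nn_integral_mono pw)
    finally show "ennreal (c * infdist x (- \<Omega>) powr - (s * p))
        \<le> (\<integral>\<^sup>+y. ennreal (1 / norm (x - y) powr (real DIM('a) + s * p)) * indicator (- \<Omega>) y \<partial>lborel)"
      by (simp add: d_def a_def N_def)
  qed
qed

text \<open>For y outside \<Omega> the difference \<open>W x - W y\<close> is just
  \<open>W x\<close>. Restricting the inner integral of the energy to such y therefore leaves |W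
  x|^p times the exterior mass of the kernel, which dominates the Hardy weight.\<close>

lemma fractional_hardy:
  fixes \<Omega> :: "'a::euclidean_space set" and s p :: real
  assumes \<Omega>: "open \<Omega>" "bounded \<Omega>" "smooth_boundary \<Omega>" and sp: "0 < s * p"
    and W [measurable]: "W \<in> borel_measurable borel" and W0: "\<And>x. x \<notin> \<Omega> \<Longrightarrow> W x = 0"
    and fin: "(\<integral>\<^sup>+z. ennreal (\<bar>W (fst z) - W (snd z)\<bar> powr p
        / norm (fst z - snd z) powr (real DIM('a) + s * p)) \<partial>(lborel \<Otimes>\<^sub>M lborel)) < \<infinity>"
  shows "(\<integral>\<^sup>+x. ennreal (\<bar>W x\<bar> powr p * infdist x (- \<Omega>) powr - (s * p)) \<partial>lborel) < \<infinity>"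
proof -
  define a where "a = real DIM('a) + s * p"
  obtain c where c: "0 < c" and le: "\<And>x. x \<in> \<Omega> \<Longrightarrow> ennreal (c * infdist x (- \<Omega>) powr - (s * p))
      \<le> (\<integral>\<^sup>+y. ennreal (1 / norm (x - y) powr a) * indicator (- \<Omega>) y \<partial>lborel)"
    using nn_integral_kernel_exterior_ge[OF \<Omega> sp] unfolding a_def by blast
  have [measurable]: "\<Omega> \<in> sets borel" using \<Omega>(1) by simp
  have [measurable]: "(\<lambda>x. infdist x (- \<Omega>)) \<in> borel_measurable borel"
    by (intro borel_measurable_continuous_onI continuous_intros)
  have pw: "ennreal c * ennreal (\<bar>W x\<bar> powr p * infdist x (- \<Omega>) powr - (s * p))
      \<le> (\<integral>\<^sup>+y. ennreal (\<bar>W x - W y\<bar> powr p / norm (x - y) powr a) \<partial>lborel)" for x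
  proof (cases "x \<in> \<Omega>")
    case True
    have "ennreal c * ennreal (\<bar>W x\<bar> powr p * infdist x (- \<Omega>) powr - (s * p))
        = ennreal (\<bar>W x\<bar> powr p) * ennreal (c * infdist x (- \<Omega>) powr - (s * p))"
      using c by (simp add: ennreal_mult'[symmetric] mult_ac)
    also have "\<dots> \<le> ennreal (\<bar>W x\<bar> powr p) * (\<integral>\<^sup>+y. ennreal (1 / norm (x - y) powr a) * indicator (- \<Omega>) y \<partial>lborel)"
      by (intro mult_left_mono le[OF True]) simp
    also have "\<dots> = (\<integral>\<^sup>+y. ennreal (\<bar>W x\<bar> powr p) * (ennreal (1 / norm (x - y) powr a) * indicator (- \<Omega>) y) \<partial>lborel)"
      by (rule nn_integral_cmult[symmetric]) measurable
    also have "\<dots> \<le> (\<integral>\<^sup>+y. ennreal (\<bar>W x - W y\<bar> powr p / norm (x - y) powr a) \<partial>lborel)"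
    proof (intro nn_integral_mono)
      fix y show "ennreal (\<bar>W x\<bar> powr p) * (ennreal (1 / norm (x - y) powr a) * indicator (- \<Omega>) y)
          \<le> ennreal (\<bar>W x - W y\<bar> powr p / norm (x - y) powr a)"
        by (cases "y \<in> \<Omega>") (auto simp: W0 ennreal_mult'[symmetric])
    qed
    finally show ?thesis .
  qed (simp add: W0)
  have "ennreal c * (\<integral>\<^sup>+x. ennreal (\<bar>W x\<bar> powr p * infdist x (- \<Omega>) powr - (s * p)) \<partial>lborel)
      = (\<integral>\<^sup>+x. ennreal c * ennreal (\<bar>W x\<bar> powr p * infdist x (- \<Omega>) powr - (s * p)) \<partial>lborel)"
    by (rule nn_integral_cmult[symmetric]) measurable
  also have "\<dots> \<le> (\<integral>\<^sup>+x. \<integral>\<^sup>+y. ennreal (\<bar>W x - W y\<bar> powr p / norm (x - y) powr a) \<partial>lborel \<partial>lborel)"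
    by (intro nn_integral_mono pw)
  also have "\<dots> = (\<integral>\<^sup>+z. ennreal (\<bar>W (fst z) - W (snd z)\<bar> powr p / norm (fst z - snd z) powr a) \<partial>(lborel \<Otimes>\<^sub>M lborel))"
    using lborel.nn_integral_fst[of "\<lambda>z. ennreal (\<bar>W (fst z) - W (snd z)\<bar> powr p / norm (fst z - snd z) powr a)" lborel]
    by simp
  also have "\<dots> < \<infinity>" using fin by (simp add: a_def)
  finally show ?thesis
    using c by (auto simp: ennreal_mult_less_top)
qed

section \<open>Smooth bumps and convolutions\<close>

text \<open>Differentiating exp(-1/t) produces negative powers of t; carrying the exponent
  \<open>m\<close> makes the span of the family closed under differentiation.\<close>

definition flat_exp :: "nat \<Rightarrow> real \<Rightarrow> real" where
  "flat_exp m t = (if 0 < t then exp (- 1 / t) / t ^ m else 0)"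

text \<open>The single term of order \<open>m + 2\<close> in the exponential series of 1/t beats the
  pole of order \<open>m\<close> by two powers. A quadratic bound makes the difference quotient at 0
  vanish.\<close>

lemma flat_exp_le: "\<bar>flat_exp m t\<bar> \<le> fact (m + 2) * t\<^sup>2"
proof (cases "0 < t")
  case True
  have "(1 / t) ^ (m + 2) / fact (m + 2) \<le> exp (1 / t)"
  proof -
    have "(\<Sum>n\<in>{m + 2}. (1 / t) ^ n /\<^sub>R fact n) \<le> (\<Sum>n. (1 / t) ^ n /\<^sub>R fact n)"
      using True by (intro sum_le_suminf summable_exp_generic) auto
    then show ?thesis by (simp add: exp_def divide_inverse mult.commute)
  qed
  then have "1 / (fact (m + 2) * t ^ (m + 2)) \<le> exp (1 / t)"
    by (simp add: power_divide mult.commute del: fact_Suc)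
  then have "1 / exp (1 / t) \<le> 1 / (1 / (fact (m + 2) * t ^ (m + 2)))"
    using True by (intro divide_left_mono) (auto simp del: fact_Suc)
  then have "exp (- 1 / t) \<le> fact (m + 2) * t ^ (m + 2)"
    by (simp add: exp_minus inverse_eq_divide del: fact_Suc)
  then have "exp (- 1 / t) / t ^ m \<le> fact (m + 2) * t ^ (m + 2) / t ^ m"
    using True by (intro divide_right_mono) auto
  then show ?thesis
    using True by (simp add: flat_exp_def power_add power2_eq_square del: fact_Suc)
qed (simp add: flat_exp_def)

lemma flat_exp_has_derivative:
  "(flat_exp m has_real_derivative (flat_exp (m + 2) t - real m * flat_exp (m + 1) t)) (at t)"
proof -
  consider "0 < t" | "t < 0" | "t = 0" by linarith
  then show ?thesis
  proof cases
    case 1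
    have "((\<lambda>t. exp (- 1 / t) / t ^ m) has_real_derivative (flat_exp (m + 2) t - real m * flat_exp (m + 1) t)) (at t)"
    proof -
      have E: "((\<lambda>t. exp (- 1 / t)) has_real_derivative exp (- 1 / t) / t\<^sup>2) (at t)"
        using 1 by (auto intro!: derivative_eq_intros simp: power2_eq_square)
      have "((\<lambda>t. t ^ m) has_real_derivative real m * t ^ (m - 1)) (at t)"
        using DERIV_pow[of m t] by simp
      from DERIV_divide[OF E this] show ?thesis
        by (rule DERIV_cong)
          (use 1 in \<open>cases m; simp add: flat_exp_def field_simps power2_eq_square power_add\<close>)+
    qed
    then show ?thesis
      by (rule has_field_derivative_transform_within_open[of _ _ _ "{0<..}"]) (use 1 in \<open>auto simp: flat_exp_def\<close>)
  next
    case 2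
    have "((\<lambda>t. 0) has_real_derivative (flat_exp (m + 2) t - real m * flat_exp (m + 1) t)) (at t)"
      using 2 by (simp add: flat_exp_def)
    then show ?thesis
      by (rule has_field_derivative_transform_within_open[of _ _ _ "{..<0}"]) (use 2 in \<open>auto simp: flat_exp_def\<close>)
  next
    case 3
    have "(\<lambda>h. flat_exp m h / h) \<midarrow>0\<rightarrow> 0"
    proof (rule Lim_null_comparison)
      have "norm (flat_exp m h / h) \<le> fact (m + 2) * \<bar>h\<bar>" for h
        using flat_exp_le[of m h]
        by (cases "h = 0")
          (simp_all add: divide_le_eq power2_eq_square abs_mult_self_eq mult.assoc del: fact_Suc)
      then show "\<forall>\<^sub>F h in at 0. norm (flat_exp m h / h) \<le> fact (m + 2) * \<bar>h\<bar>" by simp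
      show "(\<lambda>h. fact (m + 2) * \<bar>h\<bar>) \<midarrow>0\<rightarrow> (0::real)"
        by (auto intro!: tendsto_eq_intros)
    qed
    then show ?thesis using 3 by (simp add: DERIV_def flat_exp_def)
  qed
qed

text \<open>This class is closed under directional derivatives, which yields all orders of smoothness at once.\<close>

inductive bump_algebra :: "real \<Rightarrow> ('a::euclidean_space \<Rightarrow> real) \<Rightarrow> bool" for R where
  const: "bump_algebra R (\<lambda>x. c)"
| inner: "bump_algebra R (\<lambda>x. x \<bullet> b)"
| flat: "bump_algebra R (\<lambda>x. flat_exp m (R - x \<bullet> x))"
| add: "bump_algebra R f \<Longrightarrow> bump_algebra R g \<Longrightarrow> bump_algebra R (\<lambda>x. f x + g x)"
| mult: "bump_algebra R f \<Longrightarrow> bump_algebra R g \<Longrightarrow> bump_algebra R (\<lambda>x. f x * g x)"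

lemma bump_algebra_derivative:
  assumes "bump_algebra R g"
  shows "\<exists>D. (\<forall>x. (g has_derivative D x) (at x)) \<and> (\<forall>b. bump_algebra R (\<lambda>x. D x b))"
  using assms
proof induction
  case (const c)
  show ?case
    by (rule exI[of _ "\<lambda>x h. 0"]) (auto intro: bump_algebra.const)
next
  case (inner b)
  show ?case
    by (rule exI[of _ "\<lambda>x h. h \<bullet> b"]) (auto intro!: derivative_eq_intros bump_algebra.const)
next
  case (flat m)
  define E where "E x = flat_exp (m + 2) (R - x \<bullet> x) + (- real m) * flat_exp (m + 1) (R - x \<bullet> x)" for x :: 'a
  have "((\<lambda>x. flat_exp m (R - x \<bullet> x)) has_derivative (\<lambda>h. E x * ((- 2) * (x \<bullet> h)))) (at x)" for x
  proof -
    have "((\<lambda>x. R - x \<bullet> x) has_derivative (\<lambda>h. (- 2) * (x \<bullet> h))) (at x)"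
      by (auto intro!: derivative_eq_intros simp: inner_commute)
    from has_derivative_compose[OF this, OF flat_exp_has_derivative[unfolded has_field_derivative_def]]
    show ?thesis by (simp add: E_def mult_ac)
  qed
  moreover have "bump_algebra R (\<lambda>x. E x * ((- 2) * (x \<bullet> b)))" for b
    unfolding E_def by (intro bump_algebra.intros)
  ultimately show ?case
    by (intro exI[of _ "\<lambda>x h. E x * ((- 2) * (x \<bullet> h))"]) auto
next
  case (add f g)
  then obtain D E where *: "\<And>x. (f has_derivative D x) (at x)" "\<And>b. bump_algebra R (\<lambda>x. D x b)"
    "\<And>x. (g has_derivative E x) (at x)" "\<And>b. bump_algebra R (\<lambda>x. E x b)" by blast
  show ?case
    by (rule exI[of _ "\<lambda>x h. D x h + E x h"]) (auto intro!: has_derivative_add bump_algebra.add *)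
next
  case (mult f g)
  then obtain D E where *: "\<And>x. (f has_derivative D x) (at x)" "\<And>b. bump_algebra R (\<lambda>x. D x b)"
    "\<And>x. (g has_derivative E x) (at x)" "\<And>b. bump_algebra R (\<lambda>x. E x b)" by blast
  show ?case
    by (rule exI[of _ "\<lambda>x h. f x * E x h + D x h * g x"])
      (auto intro!: has_derivative_mult bump_algebra.add bump_algebra.mult * mult.hyps)
qed

lemma bump_algebra_Ck:
  assumes "bump_algebra R g" shows "Ck k g"
  using assms
proof (induction k arbitrary: g)
  case 0
  obtain D where "\<And>x. (g has_derivative D x) (at x)"
    using bump_algebra_derivative[OF 0] by blast
  then show ?case
    by (auto intro!: continuous_at_imp_continuous_on has_derivative_continuous)
next
  case (Suc k)
  obtain D where D: "\<And>x. (g has_derivative D x) (at x)" "\<And>b. bump_algebra R (\<lambda>x. D x b)"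
    using bump_algebra_derivative[OF Suc.prems] by blast
  have "frechet_derivative g (at x) = D x" for x
    using frechet_derivative_at[OF D(1)] by simp
  then show ?case using D Suc.IH by (auto simp: differentiable_def)
qed

text \<open>The classical bump exp(-1/(r^2 - |x|^2)) of the ball of radius r.\<close>

definition bump :: "real \<Rightarrow> 'a::euclidean_space \<Rightarrow> real" where
  "bump r x = flat_exp 0 (r\<^sup>2 - x \<bullet> x)"

lemma bump_Ck: "Ck k (bump r)"
  using bump_algebra_Ck[OF bump_algebra.flat, of k 0 "r\<^sup>2"] by (simp add: bump_def[abs_def])

lemma bump_nonneg: "0 \<le> bump r x"
  by (simp add: bump_def flat_exp_def)

lemma bump_pos_iff: "0 < r \<Longrightarrow> 0 < bump r x \<longleftrightarrow> norm x < r"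
  by (auto simp: bump_def flat_exp_def power2_norm_eq_inner[symmetric] abs_square_less_1
      power_strict_mono dest: power2_less_imp_less)

lemma bump_eq_0: "0 < r \<Longrightarrow> r \<le> norm x \<Longrightarrow> bump r x = 0"
  using bump_pos_iff[of r x] bump_nonneg[of r x] by linarith

section \<open>Smoothness of convolutions\<close>

lemma bounded_of_continuous_support:
  fixes g :: "'a::euclidean_space \<Rightarrow> real"
  assumes "continuous_on UNIV g" "\<And>x. x \<notin> cball 0 R \<Longrightarrow> g x = 0"
  obtains B where "0 \<le> B" "\<And>x. \<bar>g x\<bar> \<le> B"
proof -
  have "bounded (g ` cball 0 R)"
    using assms(1) by (intro compact_imp_bounded compact_continuous_image) (auto intro: continuous_on_subset)
  then obtain B where "\<forall>y\<in>g ` cball 0 R. norm y \<le> B"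
    unfolding bounded_iff by blast
  then have B: "\<bar>g x\<bar> \<le> B" if "x \<in> cball 0 R" for x
    using that by simp
  show ?thesis
  proof
    fix x show "\<bar>g x\<bar> \<le> \<bar>B\<bar>"
      using B[of x] assms(2)[of x] by (cases "x \<in> cball 0 R") auto
  qed simp
qed

lemma integrable_convolution:
  fixes g \<psi> :: "'a::euclidean_space \<Rightarrow> real"
  assumes "g \<in> borel_measurable borel" "\<And>x. \<bar>g x\<bar> \<le> B" "integrable lborel \<psi>"
  shows "integrable lborel (\<lambda>z. g (x - z) * \<psi> z)"
proof (rule Bochner_Integration.integrable_bound)
  show "integrable lborel (\<lambda>z. B * \<psi> z)" using assms(3) by simp
  show "(\<lambda>z. g (x - z) * \<psi> z) \<in> borel_measurable lborel"
    using assms by measurable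
  have "\<bar>g (x - z)\<bar> * \<bar>\<psi> z\<bar> \<le> \<bar>B\<bar> * \<bar>\<psi> z\<bar>" for z
    using assms(2)[of "x - z"] by (intro mult_right_mono) auto
  then show "AE z in lborel. norm (g (x - z) * \<psi> z) \<le> norm (B * \<psi> z)"
    by (simp add: abs_mult)
qed

lemma Ck_imp_continuous: "Ck k g \<Longrightarrow> continuous_on UNIV g"
  by (cases k) (auto intro!: differentiable_imp_continuous_on simp: differentiable_on_def)

lemma continuous_on_convolution:
  fixes g \<psi> :: "'a::euclidean_space \<Rightarrow> real"
  assumes g: "continuous_on UNIV g" "\<And>x. \<bar>g x\<bar> \<le> B" and \<psi>: "integrable lborel \<psi>"
  shows "continuous_on UNIV (\<lambda>x. \<integral>z. g (x - z) * \<psi> z \<partial>lborel)"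
proof -
  have [measurable]: "g \<in> borel_measurable borel" using g(1) by (rule borel_measurable_continuous_onI)
  have [measurable]: "\<psi> \<in> borel_measurable borel" using \<psi> by auto
  show ?thesis
    unfolding continuous_on_sequentially
  proof (intro allI ballI impI, elim conjE)
    fix X and a :: 'a assume "X \<longlonglongrightarrow> a"
    then have lim: "(\<lambda>n. g (X n - z)) \<longlonglongrightarrow> g (a - z)" for z
      using g(1) by (intro continuous_on_tendsto_compose[OF g(1)] tendsto_intros) auto
    show "((\<lambda>x. \<integral>z. g (x - z) * \<psi> z \<partial>lborel) \<circ> X) \<longlonglongrightarrow> (\<integral>z. g (a - z) * \<psi> z \<partial>lborel)"
      unfolding comp_def
    proof (rule integral_dominated_convergence)
      show "integrable lborel (\<lambda>z. B * \<bar>\<psi> z\<bar>)" using \<psi> by simp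
      show "AE z in lborel. (\<lambda>n. g (X n - z) * \<psi> z) \<longlonglongrightarrow> g (a - z) * \<psi> z"
        using lim by (intro AE_I2 tendsto_intros)
      show "AE z in lborel. norm (g (X n - z) * \<psi> z) \<le> B * \<bar>\<psi> z\<bar>" for n
        using g(2) by (intro AE_I2) (auto simp: abs_mult intro: mult_right_mono)
    qed measurable
  qed
qed

text \<open>All derivatives fall on \<open>g\<close>, so \<open>\<psi>\<close> need only be
  integrable. Both the increment of \<open>g\<close> and its linearisation are at most
  \<open>sum K Basis\<close> times the norm of the step, so the error quotient is dominated by
  \<open>2 * sum K Basis\<close> times the absolute value of \<open>\<psi>\<close>, and dominated
  convergence along sequences applies.\<close>

lemma has_derivative_convolution:
  fixes g \<psi> :: "'a::euclidean_space \<Rightarrow> real"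
  assumes g: "\<And>x. (g has_derivative D x) (at x)"
    and cont: "\<And>b. b \<in> Basis \<Longrightarrow> continuous_on UNIV (\<lambda>x. D x b)"
    and Db: "\<And>b x. b \<in> Basis \<Longrightarrow> \<bar>D x b\<bar> \<le> K b"
    and gb: "\<And>x. \<bar>g x\<bar> \<le> B" and \<psi>: "integrable lborel \<psi>"
  shows "((\<lambda>x. \<integral>z. g (x - z) * \<psi> z \<partial>lborel) has_derivative
           (\<lambda>h. \<Sum>b\<in>Basis. (h \<bullet> b) * (\<integral>z. D (x - z) b * \<psi> z \<partial>lborel))) (at x)"
    (is "(?F has_derivative ?F') _")
proof -
  have "continuous_on UNIV g"
    using g by (auto intro!: continuous_at_imp_continuous_on has_derivative_continuous)
  then have [measurable]: "g \<in> borel_measurable borel" by (rule borel_measurable_continuous_onI)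
  have [measurable]: "\<psi> \<in> borel_measurable borel" using \<psi> by auto
  have Dm [measurable]: "(\<lambda>x. D x b) \<in> borel_measurable borel" if "b \<in> Basis" for b
    using cont[OF that] by (rule borel_measurable_continuous_onI)
  have D_eq: "D x h = (\<Sum>b\<in>Basis. (h \<bullet> b) * D x b)" for x h
  proof -
    have lin: "linear (D x)" using g[of x] has_derivative_linear by blast
    have "D x h = D x (\<Sum>b\<in>Basis. (h \<bullet> b) *\<^sub>R b)" by (simp add: euclidean_representation)
    then show ?thesis by (simp add: linear_sum[OF lin] linear_cmul[OF lin])
  qed
  have int_D: "integrable lborel (\<lambda>z. D (x - z) b * \<psi> z)" if "b \<in> Basis" for b
    using integrable_convolution[OF Dm[OF that] Db[OF that] \<psi>] .
  have int_Dh: "integrable lborel (\<lambda>z. D (x - z) h * \<psi> z)" for h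
    by (subst D_eq) (use int_D in \<open>simp add: sum_distrib_right mult.assoc\<close>)
  have int_g: "integrable lborel (\<lambda>z. g (x - z) * \<psi> z)" for x
    by (rule integrable_convolution[OF _ gb \<psi>]) simp
  have F'_eq: "?F' h = (\<integral>z. D (x - z) h * \<psi> z \<partial>lborel)" for h
  proof -
    have "(\<integral>z. D (x - z) h * \<psi> z \<partial>lborel) = (\<integral>z. (\<Sum>b\<in>Basis. (h \<bullet> b) * (D (x - z) b * \<psi> z)) \<partial>lborel)"
      by (subst D_eq) (simp add: sum_distrib_right mult.assoc)
    also have "\<dots> = (\<Sum>b\<in>Basis. \<integral>z. (h \<bullet> b) * (D (x - z) b * \<psi> z) \<partial>lborel)"
      using int_D by (intro Bochner_Integration.integral_sum) auto
    finally show ?thesis by simp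
  qed
  have onD: "onorm (D x) \<le> sum K Basis" for x
  proof -
    have "frechet_derivative g (at x) = D x" using frechet_derivative_at[OF g[of x]] by simp
    moreover have "g differentiable at x" using g[of x] by (auto simp: differentiable_def)
    ultimately show ?thesis using onorm_frechet_derivative_le[of g x K] Db by simp
  qed
  have lip: "\<bar>g x - g y\<bar> \<le> sum K Basis * norm (x - y)" for x y
    using differentiable_bound[of UNIV g D "sum K Basis" x y] g onD by auto
  have Dh: "\<bar>D x h\<bar> \<le> sum K Basis * norm h" for x h
  proof -
    have "norm (D x h) \<le> onorm (D x) * norm h"
      using g[of x] by (intro onorm) (rule has_derivative_bounded_linear)
    then show ?thesis using mult_right_mono[OF onD[of x] norm_ge_zero[of h]] by simp
  qed
  show ?thesis
    unfolding has_derivative_at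
  proof
    have "bounded_linear (\<lambda>h. (h \<bullet> b) * c)" for b :: 'a and c :: real
      by (intro bounded_linear_mult_const bounded_linear_inner_left)
    then show "bounded_linear ?F'" by (intro bounded_linear_sum)
    show "(\<lambda>h. norm (?F (x + h) - ?F x - ?F' h) / norm h) \<midarrow>0\<rightarrow> 0"
      unfolding tendsto_at_iff_sequentially
    proof (intro allI impI)
      fix X :: "nat \<Rightarrow> 'a" assume X: "\<forall>i. X i \<in> UNIV - {0}" "X \<longlonglongrightarrow> 0"
      let ?q = "\<lambda>n z. (g (x + X n - z) - g (x - z) - D (x - z) (X n)) / norm (X n)"
      have quot: "(?F (x + X n) - ?F x - ?F' (X n)) / norm (X n) = (\<integral>z. ?q n z * \<psi> z \<partial>lborel)" for n
      proof -
        have "?F (x + X n) - ?F x - ?F' (X n)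
            = (\<integral>z. g (x + X n - z) * \<psi> z - g (x - z) * \<psi> z - D (x - z) (X n) * \<psi> z \<partial>lborel)"
          unfolding F'_eq using int_g int_Dh by simp
        also have "\<dots> = (\<integral>z. norm (X n) * (?q n z * \<psi> z) \<partial>lborel)"
          using X(1)[rule_format, of n] by (intro Bochner_Integration.integral_cong) (auto simp: left_diff_distrib)
        finally show ?thesis using X(1) by simp
      qed
      have "(\<lambda>n. \<integral>z. ?q n z * \<psi> z \<partial>lborel) \<longlonglongrightarrow> (\<integral>z. (0::real) \<partial>(lborel :: 'a measure))"
      proof (rule integral_dominated_convergence)
        show "integrable lborel (\<lambda>z. 2 * sum K Basis * \<bar>\<psi> z\<bar>)" using \<psi> by simp
        have lim: "(\<lambda>n. ?q n z) \<longlonglongrightarrow> 0" for z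
        proof -
          have "(\<lambda>h. norm (g (x - z + h) - g (x - z) - D (x - z) h) / norm h) \<midarrow>0\<rightarrow> 0"
            using g[of "x - z"] by (simp add: has_derivative_at)
          then have "(\<lambda>n. norm (g (x - z + X n) - g (x - z) - D (x - z) (X n)) / norm (X n)) \<longlonglongrightarrow> 0"
            using X unfolding tendsto_at_iff_sequentially by (simp add: comp_def)
          then have "(\<lambda>n. norm (?q n z)) \<longlonglongrightarrow> 0"
            by (simp add: algebra_simps)
          then show ?thesis by (rule tendsto_norm_zero_cancel)
        qed
        show "AE z in lborel. (\<lambda>n. ?q n z * \<psi> z) \<longlonglongrightarrow> 0"
          using lim by (intro AE_I2 tendsto_mult_left_zero)
        show "AE z in lborel. norm (?q n z * \<psi> z) \<le> 2 * sum K Basis * \<bar>\<psi> z\<bar>" for n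
        proof (rule AE_I2)
          fix z
          have "\<bar>g (x + X n - z) - g (x - z)\<bar> \<le> sum K Basis * norm (X n)"
            using lip[of "x + X n - z" "x - z"] by (simp add: algebra_simps)
          then have "\<bar>g (x + X n - z) - g (x - z) - D (x - z) (X n)\<bar> \<le> 2 * sum K Basis * norm (X n)"
            using Dh[of "x - z" "X n"] by linarith
          then have "\<bar>?q n z\<bar> \<le> 2 * sum K Basis"
            using X(1) by (simp add: field_simps)
          then show "norm (?q n z * \<psi> z) \<le> 2 * sum K Basis * \<bar>\<psi> z\<bar>"
            unfolding real_norm_def abs_mult[of _ "\<psi> z"] by (intro mult_right_mono) auto
        qed
        show "(\<lambda>z. ?q n z * \<psi> z) \<in> borel_measurable lborel" for n
          using borel_measurable_integrable[OF int_Dh[of "X n"]]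
          by (simp add: diff_divide_distrib left_diff_distrib)
      qed measurable
      then have "(\<lambda>n. norm ((?F (x + X n) - ?F x - ?F' (X n)) / norm (X n))) \<longlonglongrightarrow> 0"
        unfolding quot by (intro tendsto_norm_zero) simp
      then show "((\<lambda>h. norm (?F (x + h) - ?F x - ?F' h) / norm h) \<circ> X) \<longlonglongrightarrow> 0"
        by (simp add: comp_def)
    qed
  qed
qed

text \<open>A partial derivative of the convolution is the convolution with a partial derivative of
  \<open>g\<close>, which vanishes off the same ball; hence the induction runs over all
  \<open>g\<close>. The common ball supplies the uniform bounds needed to differentiate under the
  integral.\<close>

lemma Ck_convolution:
  fixes g \<psi> :: "'a::euclidean_space \<Rightarrow> real"
  assumes "Ck k g" "\<And>x. x \<notin> cball 0 R \<Longrightarrow> g x = 0" and \<psi>: "integrable lborel \<psi>"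
  shows "Ck k (\<lambda>x. \<integral>z. g (x - z) * \<psi> z \<partial>lborel)"
  using assms(1,2)
proof (induction k arbitrary: g)
  case 0
  then obtain B where "\<And>x. \<bar>g x\<bar> \<le> B"
    using bounded_of_continuous_support[of g R] by (metis Ck.simps(1))
  then show ?case using 0 continuous_on_convolution[OF _ _ \<psi>] by auto
next
  case (Suc k)
  let ?D = "\<lambda>x. frechet_derivative g (at x)"
  have D: "(g has_derivative ?D x) (at x)" for x
    using Suc.prems(1) by (simp add: frechet_derivative_works[symmetric])
  have Ck: "Ck k (\<lambda>x. ?D x b)" if "b \<in> Basis" for b
    using Suc.prems(1) that by simp
  have supp: "?D x b = 0" if "x \<notin> cball 0 R" for x b
  proof -
    have "(g has_derivative (\<lambda>h. 0)) (at x)"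
      by (rule has_derivative_transform_within_open[of "\<lambda>x. 0" _ _ _ "- cball 0 R"])
        (use that Suc.prems(2) in auto)
    from frechet_derivative_at[OF this] show ?thesis by metis
  qed
  obtain B where B: "\<And>x. \<bar>g x\<bar> \<le> B"
    using bounded_of_continuous_support[of g R] Suc.prems Ck_imp_continuous by metis
  have "\<exists>K. \<forall>x. \<bar>?D x b\<bar> \<le> K" if "b \<in> Basis" for b
    using bounded_of_continuous_support[of "\<lambda>x. ?D x b" R] supp Ck_imp_continuous[OF Ck[OF that]] by metis
  then obtain K where K: "\<And>b x. b \<in> Basis \<Longrightarrow> \<bar>?D x b\<bar> \<le> K b" by metis
  have der: "((\<lambda>x. \<integral>z. g (x - z) * \<psi> z \<partial>lborel) has_derivative
           (\<lambda>h. \<Sum>b\<in>Basis. (h \<bullet> b) * (\<integral>z. ?D (x - z) b * \<psi> z \<partial>lborel))) (at x)" for x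
    using D Ck_imp_continuous[OF Ck] K B \<psi> by (rule has_derivative_convolution)
  have "frechet_derivative (\<lambda>x. \<integral>z. g (x - z) * \<psi> z \<partial>lborel) (at x) b
      = (\<integral>z. ?D (x - z) b * \<psi> z \<partial>lborel)" if "b \<in> Basis" for b x
    using that by (simp add: frechet_derivative_at[OF der, symmetric] inner_Basis if_distrib[of "\<lambda>c. c * _"] cong: if_cong)
  moreover have "Ck k (\<lambda>x. \<integral>z. ?D (x - z) b * \<psi> z \<partial>lborel)" if "b \<in> Basis" for b
    using Suc.IH[OF Ck[OF that] supp] by simp
  moreover have "(\<lambda>x. \<integral>z. g (x - z) * \<psi> z \<partial>lborel) differentiable at x" for x
    using der[of x] by (rule differentiableI)
  ultimately show ?case by simp
qed

section \<open>Mollification\<close>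

lemma abs_powr_has_derivative:
  assumes "1 < p"
  shows "((\<lambda>t. \<bar>t\<bar> powr p) has_real_derivative p * pflux p t) (at t)"
proof -
  have pos: "((\<lambda>t. \<bar>t\<bar> powr p) has_real_derivative p * t powr (p - 1)) (at t)" if "0 < t" for t
    by (rule has_field_derivative_transform_within_open[of "\<lambda>t. t powr p" _ _ "{0<..}"])
      (use that in \<open>auto intro!: derivative_eq_intros simp: powr_diff\<close>)
  consider "0 < t" | "t < 0" | "t = 0" by linarith
  then show ?thesis
  proof cases
    case 1
    then show ?thesis using pos[of t] by (simp add: pflux_nonneg)
  next
    case 2
    then have "((\<lambda>t. \<bar>- t\<bar> powr p) has_real_derivative p * (- t) powr (p - 1) * (- 1)) (at t)"
      using pos[of "- t"] by (intro DERIV_chain2[where f = "\<lambda>t. \<bar>t\<bar> powr p" and g = uminus])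
        (auto intro!: derivative_eq_intros)
    moreover have "pflux p t = - ((- t) powr (p - 1))"
      using 2 pflux_nonneg[of "- t" p] by simp
    ultimately show ?thesis by simp
  next
    case 3
    have "(\<lambda>h. \<bar>h\<bar> powr p / h) \<midarrow>0\<rightarrow> 0"
    proof (rule Lim_null_comparison)
      have "norm (\<bar>h\<bar> powr p / h) \<le> \<bar>h\<bar> powr (p - 1)" for h :: real
        by (cases "h = 0") (auto simp: powr_diff)
      then show "\<forall>\<^sub>F h in at 0. norm (\<bar>h\<bar> powr p / h) \<le> \<bar>h\<bar> powr (p - 1)" by simp
      show "(\<lambda>h::real. \<bar>h\<bar> powr (p - 1)) \<midarrow>0\<rightarrow> 0"
        using assms by (auto intro!: tendsto_eq_intros)
    qed
    then show ?thesis using 3 by (simp add: DERIV_def pflux_def)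
  qed
qed

text \<open>The form of convexity behind Jensen's inequality: averaged with \<open>a\<close> equal
  to the mean of \<open>t\<close>, the linear term disappears.\<close>

lemma abs_powr_above_tangent:
  assumes p: "1 < p"
  shows "\<bar>a\<bar> powr p + p * pflux p a * (t - a) \<le> \<bar>t\<bar> powr p"
proof -
  have "convex_on UNIV (\<lambda>t. \<bar>t\<bar> powr p)"
    using p by (intro convex_on_realI[where f' = "\<lambda>t. p * pflux p t"])
      (auto intro: abs_powr_has_derivative pflux_mono)
  from convex_on_imp_above_tangent[OF this, of a t "p * pflux p a"] abs_powr_has_derivative[OF p, of a]
  show ?thesis by simp
qed

section \<open>Mollifiers and their effect on the energy\<close>

lemma nn_integral_lborel_translate:
  fixes F :: "'a::euclidean_space \<Rightarrow> ennreal"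
  assumes [measurable]: "F \<in> borel_measurable borel"
  shows "(\<integral>\<^sup>+x. F (c + x) \<partial>lborel) = (\<integral>\<^sup>+x. F x \<partial>lborel)"
proof -
  have "(\<integral>\<^sup>+x. F x \<partial>lborel) = (\<integral>\<^sup>+x. F x \<partial>distr lborel borel ((+) c))"
    by (simp add: lborel_distr_plus)
  also have "\<dots> = (\<integral>\<^sup>+x. F (c + x) \<partial>lborel)"
    by (rule nn_integral_distr) auto
  finally show ?thesis by simp
qed

lemma lborel_distr_reflect:
  "distr lborel borel (\<lambda>z. x - z) = (lborel :: 'a::euclidean_space measure)"
  by (subst lborel_affine[of "-1" x]) (auto simp: density_1)

definition mollifier :: "real \<Rightarrow> 'a::euclidean_space \<Rightarrow> real" where
  "mollifier r z = bump r z / (\<integral>x. bump r (x::'a) \<partial>lborel)"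

lemma bump_measurable [measurable]: "bump r \<in> borel_measurable borel"
  using Ck_imp_continuous[OF bump_Ck, of r] by (rule borel_measurable_continuous_onI)

lemma integrable_bump:
  assumes "0 < r"
  shows "integrable lborel (bump r :: 'a::euclidean_space \<Rightarrow> real)"
proof -
  have "bump r x = 0" if "x \<notin> cball (0::'a) r" for x
    using that by (intro bump_eq_0[OF assms]) auto
  moreover from this obtain B where "\<And>x. \<bar>bump r (x::'a)\<bar> \<le> B"
    using bounded_of_continuous_support[OF Ck_imp_continuous[OF bump_Ck]] by blast
  ultimately show ?thesis
    by (intro integrableI_bounded_set[of "cball 0 r" _ _ B]) (use emeasure_lborel_cball_finite[of "0::'a" r] in auto)
qed

lemma integral_bump_pos:
  assumes "0 < r"
  shows "0 < (\<integral>x. bump r (x::'a::euclidean_space) \<partial>lborel)"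
proof (rule ccontr)
  assume "\<not> ?thesis"
  then have "(\<integral>x. bump r (x::'a) \<partial>lborel) = 0"
    using Bochner_Integration.integral_nonneg[of lborel "bump r :: 'a \<Rightarrow> real"] bump_nonneg[of r]
    by (metis less_eq_real_def)
  then have "AE x in lborel. bump r (x::'a) = 0"
    using integral_nonneg_eq_0_iff_AE[OF integrable_bump[OF assms]] bump_nonneg[of r] by auto
  then have "AE x in lborel. x \<notin> ball (0::'a) r"
    using bump_pos_iff[OF assms] by (auto elim!: eventually_mono simp: less_le)
  then have "emeasure lborel (ball (0::'a) r) = 0"
    by (subst (asm) AE_iff_measurable[of "ball 0 r"]) auto
  moreover have "0 < unit_ball_vol (real DIM('a))" by simp
  ultimately show False using assms by (simp add: emeasure_ball)
qed

lemma mollifier_measurable [measurable]: "mollifier r \<in> borel_measurable borel"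
  unfolding mollifier_def[abs_def] by measurable

lemma mollifier_nonneg: "0 < r \<Longrightarrow> 0 \<le> mollifier r z"
  unfolding mollifier_def by (intro divide_nonneg_nonneg bump_nonneg less_imp_le integral_bump_pos)

lemma mollifier_eq_0: "0 < r \<Longrightarrow> r \<le> norm z \<Longrightarrow> mollifier r z = 0"
  by (simp add: mollifier_def bump_eq_0)

lemma integrable_mollifier: "0 < r \<Longrightarrow> integrable lborel (mollifier r)"
  unfolding mollifier_def[abs_def] by (simp add: integrable_bump)

lemma integral_mollifier: "0 < r \<Longrightarrow> (\<integral>z. mollifier r z \<partial>(lborel :: 'a::euclidean_space measure)) = 1"
  using integral_bump_pos[of r, where 'a = 'a] by (simp add: mollifier_def)

lemma nn_integral_mollifier:
  "0 < r \<Longrightarrow> (\<integral>\<^sup>+z. ennreal (mollifier r z) \<partial>(lborel :: 'a::euclidean_space measure)) = 1"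
  by (subst nn_integral_eq_integral)
    (auto simp: integrable_mollifier integral_mollifier mollifier_nonneg)

lemma smooth_mollifier: "smooth (mollifier r)"
proof -
  have "Ck k (\<lambda>x. g x / c)" if "Ck k g" for k c and g :: "'a \<Rightarrow> real"
    using that
  proof (induction k arbitrary: g)
    case 0
    then show ?case by (auto simp: divide_inverse intro!: continuous_intros)
  next
    case (Suc k)
    have der: "((\<lambda>x. g x / c) has_derivative (\<lambda>h. frechet_derivative g (at x) h / c)) (at x)" for x
      unfolding divide_inverse using Suc.prems
      by (intro has_derivative_mult_left) (simp add: frechet_derivative_works[symmetric])
    have "(\<lambda>x. g x / c) differentiable at x" for x
      using der by (rule differentiableI)
    moreover have "frechet_derivative (\<lambda>x. g x / c) (at x) b = frechet_derivative g (at x) b / c" for x b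
      by (simp add: frechet_derivative_at[OF der, symmetric])
    ultimately show ?case using Suc by simp
  qed
  then show ?thesis unfolding smooth_def mollifier_def[abs_def] using bump_Ck by blast
qed

text \<open>With the translation placed on \<open>\<psi>\<close>, mollification is an average of
  translates, which suits the energy and L^1 estimates; \<open>mollify_eq_convolution\<close> moves
  it to the smooth factor for differentiation.\<close>

definition mollify :: "real \<Rightarrow> ('a::euclidean_space \<Rightarrow> real) \<Rightarrow> 'a \<Rightarrow> real" where
  "mollify r \<psi> x = (\<integral>z. mollifier r z * \<psi> (x - z) \<partial>lborel)"

lemma mollify_eq_convolution:
  assumes [measurable]: "\<psi> \<in> borel_measurable borel"
  shows "mollify r \<psi> x = (\<integral>z. mollifier r (x - z) * \<psi> z \<partial>lborel)"
proof -
  have "(\<integral>z. mollifier r (x - z) * \<psi> z \<partial>lborel)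
      = (\<integral>z. mollifier r (x - z) * \<psi> z \<partial>distr lborel borel (\<lambda>z. x - z))"
    by (simp add: lborel_distr_reflect)
  also have "\<dots> = (\<integral>z. mollifier r (x - (x - z)) * \<psi> (x - z) \<partial>lborel)"
    by (rule integral_distr) auto
  finally show ?thesis by (simp add: mollify_def)
qed

lemma smooth_mollify:
  assumes "0 < r" "integrable lborel \<psi>"
  shows "smooth (mollify r \<psi>)"
proof -
  have [measurable]: "\<psi> \<in> borel_measurable borel" using assms(2) by auto
  have "Ck k (\<lambda>x. \<integral>z. mollifier r (x - z) * \<psi> z \<partial>lborel)" for k
    using smooth_mollifier assms(2)
    by (intro Ck_convolution[where R = r]) (auto simp: smooth_def intro!: mollifier_eq_0[OF assms(1)])
  moreover have "mollify r \<psi> = (\<lambda>x. \<integral>z. mollifier r (x - z) * \<psi> z \<partial>lborel)"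
    by (simp add: fun_eq_iff mollify_eq_convolution)
  ultimately show ?thesis by (simp add: smooth_def)
qed

lemma mollify_measurable [measurable]:
  assumes [measurable]: "\<psi> \<in> borel_measurable borel"
  shows "mollify r \<psi> \<in> borel_measurable borel"
  unfolding mollify_def[abs_def] by measurable

lemma integrable_mollifier_mult:
  assumes r: "0 < r" and [measurable]: "g \<in> borel_measurable borel" and B: "\<And>z. \<bar>g z\<bar> \<le> B"
  shows "integrable lborel (\<lambda>z. mollifier r z * g z)"
proof (rule Bochner_Integration.integrable_bound)
  show "integrable lborel (\<lambda>z. mollifier r z * B)" by (simp add: integrable_mollifier[OF r])
  have "\<bar>mollifier r z\<bar> * \<bar>g z\<bar> \<le> \<bar>mollifier r z\<bar> * \<bar>B\<bar>" for z
    using B[of z] by (intro mult_left_mono) auto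
  then show "AE z in lborel. norm (mollifier r z * g z) \<le> norm (mollifier r z * B)"
    by (simp add: abs_mult)
qed measurable

lemma abs_mollify_le:
  assumes r: "0 < r" and [measurable]: "\<psi> \<in> borel_measurable borel" and B: "\<And>z. \<bar>\<psi> z\<bar> \<le> B"
  shows "\<bar>mollify r \<psi> x\<bar> \<le> B"
proof -
  have "\<bar>mollify r \<psi> x\<bar> \<le> (\<integral>z. \<bar>mollifier r z * \<psi> (x - z)\<bar> \<partial>lborel)"
    unfolding mollify_def by (rule integral_abs_bound)
  also have "\<dots> \<le> (\<integral>z. mollifier r (z::'a) * B \<partial>lborel)"
  proof (rule integral_mono)
    show "integrable lborel (\<lambda>z. \<bar>mollifier r z * \<psi> (x - z)\<bar>)"
      using integrable_mollifier_mult[OF r, of "\<lambda>z. \<psi> (x - z)" B] B by (intro integrable_abs) auto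
    show "integrable lborel (\<lambda>z. mollifier r (z::'a) * B)"
      by (simp add: integrable_mollifier[OF r])
    show "\<bar>mollifier r z * \<psi> (x - z)\<bar> \<le> mollifier r z * B" for z
      using B by (auto simp: abs_mult mollifier_nonneg[OF r] intro!: mult_left_mono)
  qed
  also have "\<dots> = B" using integral_mollifier[OF r, where 'a = 'a] by simp
  finally show ?thesis .
qed

lemma mollify_eq_0:
  assumes r: "0 < r" and "\<And>y. norm (x - y) < r \<Longrightarrow> \<psi> y = 0"
  shows "mollify r \<psi> x = 0"
proof -
  have "mollifier r z * \<psi> (x - z) = 0" for z
    using assms(2)[of "x - z"] mollifier_eq_0[OF r, of z] by (cases "norm z < r") auto
  then have "(\<lambda>z. mollifier r z * \<psi> (x - z)) = (\<lambda>z. 0)" by blast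
  then show ?thesis by (simp only: mollify_def integral_zero)
qed

lemma mollify_diff_powr_le:
  assumes r: "0 < r" and p: "1 < p" and [measurable]: "\<psi> \<in> borel_measurable borel" and B: "\<And>z. \<bar>\<psi> z\<bar> \<le> B"
  shows "ennreal (\<bar>mollify r \<psi> x - mollify r \<psi> y\<bar> powr p)
      \<le> (\<integral>\<^sup>+z. ennreal (mollifier r z) * ennreal (\<bar>\<psi> (x - z) - \<psi> (y - z)\<bar> powr p) \<partial>lborel)"
proof -
  define t where "t z = \<psi> (x - z) - \<psi> (y - z)" for z
  define a where "a = mollify r \<psi> x - mollify r \<psi> y"
  have [measurable]: "t \<in> borel_measurable borel" unfolding t_def[abs_def] by measurable
  have t: "\<bar>t z\<bar> \<le> 2 * B" for z
    using B[of "x - z"] B[of "y - z"] by (simp add: t_def)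
  have int: "integrable lborel (\<lambda>z. mollifier r z * g z)"
    if "g \<in> borel_measurable borel" "\<And>z. \<bar>g z\<bar> \<le> B'" for g B'
    using integrable_mollifier_mult[OF r that] .
  have a_eq: "a = (\<integral>z. mollifier r z * t z \<partial>lborel)"
    unfolding a_def mollify_def t_def right_diff_distrib
    by (rule Bochner_Integration.integral_diff[symmetric]) (auto intro!: int B)
  have tp: "\<bar>\<bar>t z\<bar> powr p\<bar> \<le> (2 * B) powr p" for z
    using t[of z] p by (auto intro!: powr_mono2)
  have int1: "integrable lborel (\<lambda>z. mollifier r z * t z)" by (rule int[OF _ t]) measurable
  have int2: "integrable lborel (\<lambda>z. mollifier r z * \<bar>t z\<bar> powr p)" by (rule int[OF _ tp]) measurable
  \<comment> \<open>The tangent line at \<open>a\<close>, split into its constant and linear parts: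
    the mollifier has integral 1 and \<open>t\<close> has mean \<open>a\<close>, so the terms with
    \<open>pflux p a\<close> cancel.\<close>
  have "\<bar>a\<bar> powr p = (\<integral>z. mollifier r z * (\<bar>a\<bar> powr p - p * pflux p a * a) + (p * pflux p a) * (mollifier r z * t z) \<partial>lborel)"
    using int1 integral_mollifier[OF r, where 'a = 'a] a_eq by (simp add: integrable_mollifier[OF r])
  also have "\<dots> = (\<integral>z. mollifier r z * (\<bar>a\<bar> powr p + p * pflux p a * (t z - a)) \<partial>lborel)"
    by (intro Bochner_Integration.integral_cong) (auto simp: algebra_simps)
  also have "\<dots> \<le> (\<integral>z. mollifier r z * \<bar>t z\<bar> powr p \<partial>lborel)"
  proof (rule integral_mono[OF _ int2])
    have "integrable lborel (\<lambda>z. mollifier r z * (\<bar>a\<bar> powr p - p * pflux p a * a) + (p * pflux p a) * (mollifier r z * t z))"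
      using int1 by (simp add: integrable_mollifier[OF r])
    then show "integrable lborel (\<lambda>z. mollifier r z * (\<bar>a\<bar> powr p + p * pflux p a * (t z - a)))"
      by (simp add: algebra_simps)
    show "mollifier r z * (\<bar>a\<bar> powr p + p * pflux p a * (t z - a)) \<le> mollifier r z * \<bar>t z\<bar> powr p" for z
      by (intro mult_left_mono abs_powr_above_tangent[OF p] mollifier_nonneg[OF r])
  qed
  finally have "ennreal (\<bar>a\<bar> powr p) \<le> ennreal (\<integral>z. mollifier r z * \<bar>t z\<bar> powr p \<partial>lborel)"
    by (rule ennreal_leI)
  also have "\<dots> = (\<integral>\<^sup>+z. ennreal (mollifier r z * \<bar>t z\<bar> powr p) \<partial>lborel)"
    using int2 by (subst nn_integral_eq_integral) (auto simp: mollifier_nonneg[OF r])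
  also have "\<dots> = (\<integral>\<^sup>+z. ennreal (mollifier r z) * ennreal (\<bar>t z\<bar> powr p) \<partial>lborel)"
    by (simp add: ennreal_mult' mollifier_nonneg[OF r])
  finally show ?thesis by (simp add: a_def t_def)
qed

text \<open>The whole-space \<open>gagliardo_pow\<close> taken against Borel Lebesgue measure on the
  product, where Fubini's theorem and translation invariance are available.\<close>

definition gagliardo_energy :: "real \<Rightarrow> real \<Rightarrow> ('a::euclidean_space \<Rightarrow> real) \<Rightarrow> ennreal" where
  "gagliardo_energy s p u = (\<integral>\<^sup>+z. ennreal (\<bar>u (fst z) - u (snd z)\<bar> powr p
        / norm (fst z - snd z) powr (real DIM('a) + s * p)) \<partial>lborel)"

text \<open>The kernel depends only on x - y, so the energy is invariant under translating both
  points by the same z. Jensen's inequality bounds the mollified density by an average of such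
  translates, and Fubini's theorem finishes.\<close>

lemma gagliardo_energy_mollify_le:
  fixes \<psi> :: "'a::euclidean_space \<Rightarrow> real"
  assumes r: "0 < r" and p: "1 < p" and \<psi> [measurable]: "\<psi> \<in> borel_measurable borel" and B: "\<And>z. \<bar>\<psi> z\<bar> \<le> B"
  shows "gagliardo_energy s p (mollify r \<psi>) \<le> gagliardo_energy s p \<psi>"
proof -
  define a where "a = real DIM('a) + s * p"
  define E where "E w = ennreal (\<bar>\<psi> (fst w) - \<psi> (snd w)\<bar> powr p / norm (fst w - snd w) powr a)" for w :: "'a \<times> 'a"
  have [measurable]: "fst \<in> borel_measurable (borel :: ('a \<times> 'a) measure)"
    "snd \<in> borel_measurable (borel :: ('a \<times> 'a) measure)"
    by (auto intro!: borel_measurable_continuous_onI continuous_intros)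
  have [measurable]: "E \<in> borel_measurable borel"
    unfolding E_def[abs_def] by measurable
  have [measurable]: "(\<lambda>x. (- snd x, - snd x) + fst x) \<in> borel_measurable ((lborel :: ('a \<times> 'a) measure) \<Otimes>\<^sub>M (lborel :: 'a measure))"
    by measurable
  have *: "ennreal (\<bar>mollify r \<psi> (fst w) - mollify r \<psi> (snd w)\<bar> powr p / norm (fst w - snd w) powr a)
      \<le> (\<integral>\<^sup>+z. ennreal (mollifier r z) * E ((- z, - z) + w) \<partial>lborel)" for w :: "'a \<times> 'a"
  proof -
    have "ennreal (\<bar>mollify r \<psi> (fst w) - mollify r \<psi> (snd w)\<bar> powr p / norm (fst w - snd w) powr a)
        = ennreal (1 / norm (fst w - snd w) powr a) * ennreal (\<bar>mollify r \<psi> (fst w) - mollify r \<psi> (snd w)\<bar> powr p)"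
      by (simp add: ennreal_mult'[symmetric])
    also have "\<dots> \<le> ennreal (1 / norm (fst w - snd w) powr a) *
        (\<integral>\<^sup>+z. ennreal (mollifier r z) * ennreal (\<bar>\<psi> (fst w - z) - \<psi> (snd w - z)\<bar> powr p) \<partial>lborel)"
      by (intro mult_left_mono mollify_diff_powr_le[OF r p \<psi> B]) simp
    also have "\<dots> = (\<integral>\<^sup>+z. ennreal (1 / norm (fst w - snd w) powr a) *
        (ennreal (mollifier r z) * ennreal (\<bar>\<psi> (fst w - z) - \<psi> (snd w - z)\<bar> powr p)) \<partial>lborel)"
      by (rule nn_integral_cmult[symmetric]) measurable
    also have "\<dots> = (\<integral>\<^sup>+z. ennreal (mollifier r z) * E ((- z, - z) + w) \<partial>lborel)"
    proof (intro nn_integral_cong)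
      fix z
      have "E ((- z, - z) + w) = ennreal (1 / norm (fst w - snd w) powr a) * ennreal (\<bar>\<psi> (fst w - z) - \<psi> (snd w - z)\<bar> powr p)"
        by (simp add: E_def ennreal_mult'[symmetric] uminus_add_conv_diff)
      then show "ennreal (1 / norm (fst w - snd w) powr a) *
        (ennreal (mollifier r z) * ennreal (\<bar>\<psi> (fst w - z) - \<psi> (snd w - z)\<bar> powr p))
        = ennreal (mollifier r z) * E ((- z, - z) + w)" by (simp only: mult_ac)
    qed
    finally show ?thesis .
  qed
  have "gagliardo_energy s p (mollify r \<psi>)
      \<le> (\<integral>\<^sup>+w. \<integral>\<^sup>+z. ennreal (mollifier r z) * E ((- z, - z) + w) \<partial>lborel \<partial>lborel)"
    unfolding gagliardo_energy_def a_def[symmetric] by (intro nn_integral_mono *)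
  also have "\<dots> = (\<integral>\<^sup>+z. \<integral>\<^sup>+w. ennreal (mollifier r z) * E ((- z, - z) + w) \<partial>lborel \<partial>lborel)"
    by (intro lborel_pair.Fubini'[symmetric]) measurable
  also have "\<dots> = (\<integral>\<^sup>+z. ennreal (mollifier r (z::'a)) * (\<integral>\<^sup>+w. E w \<partial>lborel) \<partial>lborel)"
    by (intro nn_integral_cong) (simp add: nn_integral_cmult nn_integral_lborel_translate)
  also have "\<dots> = (\<integral>\<^sup>+w. E w \<partial>lborel)"
    by (simp add: nn_integral_multc nn_integral_mollifier[OF r])
  finally show ?thesis by (simp add: gagliardo_energy_def E_def a_def)
qed

section \<open>Convergence of mollifications\<close>

text \<open>A measurable function is an almost everywhere limit of continuous ones, by
  \<open>measurable_on\<close>; truncating these in height and in support makes the convergence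
  dominated.\<close>

lemma continuous_L1_approximation:
  fixes \<psi> :: "'a::euclidean_space \<Rightarrow> real"
  assumes [measurable]: "\<psi> \<in> borel_measurable borel" and B: "\<And>x. \<bar>\<psi> x\<bar> \<le> B"
    and supp: "\<And>x. x \<notin> cball 0 R \<Longrightarrow> \<psi> x = 0" and e: "0 < e"
  obtains g where "continuous_on UNIV g" "\<And>x. x \<notin> cball 0 (R + 1) \<Longrightarrow> g x = 0"
    "(\<integral>\<^sup>+x. ennreal \<bar>\<psi> x - g x\<bar> \<partial>lborel) < ennreal e"
proof -
  have B0: "0 \<le> B" using B[of 0] by linarith
  have "\<psi> \<in> borel_measurable lebesgue" by (intro measurable_completion) simp
  then have "\<psi> measurable_on UNIV" by (intro lebesgue_measurable_imp_measurable_on_real) auto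
  then obtain N g where N: "negligible N" and g: "\<And>n. continuous_on UNIV (g n)"
    and lim: "\<And>x. x \<notin> N \<Longrightarrow> (\<lambda>n. g n x) \<longlonglongrightarrow> \<psi> x"
    unfolding measurable_on_def by auto
  \<comment> \<open>The clamp and the factor, which is 1 on the ball of radius \<open>R\<close> and
    0 beyond \<open>R + 1\<close>, both leave \<open>\<psi>\<close> unchanged, so the limit
    survives.\<close>
  define h where "h n x = max (- B) (min B (g n x)) * max 0 (min 1 (R + 1 - norm x))" for n :: nat and x
  have h_cont: "continuous_on UNIV (h n)" for n
    unfolding h_def[abs_def] using g by (intro continuous_intros) auto
  have [measurable]: "h n \<in> borel_measurable borel" for n
    using h_cont by (rule borel_measurable_continuous_onI)
  have h_supp: "h n x = 0" if "x \<notin> cball 0 (R + 1)" for n x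
    using that by (simp add: h_def)
  have h_le: "\<bar>h n x\<bar> \<le> B" for n x
  proof -
    have "\<bar>max (- B) (min B (g n x))\<bar> * \<bar>max 0 (min 1 (R + 1 - norm x))\<bar> \<le> B * 1"
      using B0 by (intro mult_mono) auto
    then show ?thesis by (simp add: h_def abs_mult)
  qed
  have h_lim: "(\<lambda>n. h n x) \<longlonglongrightarrow> \<psi> x" if "x \<notin> N" for x
  proof -
    have "(\<lambda>n. h n x) \<longlonglongrightarrow> max (- B) (min B (\<psi> x)) * max 0 (min 1 (R + 1 - norm x))"
      unfolding h_def by (intro tendsto_intros lim that)
    also have "max (- B) (min B (\<psi> x)) * max 0 (min 1 (R + 1 - norm x)) = \<psi> x"
      using B[of x] supp[of x] B0 by (cases "norm x \<le> R") auto
    finally show ?thesis .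
  qed
  have AE_N: "AE x in lborel. x \<notin> N"
  proof -
    have "N \<in> null_sets lebesgue" using N by (simp add: negligible_iff_null_sets)
    then have "AE x in lebesgue. x \<notin> N" by (rule AE_not_in)
    then show ?thesis by (simp add: AE_completion_iff)
  qed
  have dom: "integrable lborel (\<lambda>x. 2 * B * indicator (cball (0::'a) (R + 1)) x)"
    using emeasure_lborel_cball_finite[of "0::'a" "R + 1"] by (intro integrable_mult_right) simp
  have bnd: "norm \<bar>\<psi> x - h n x\<bar> \<le> 2 * B * indicator (cball 0 (R + 1)) x" for n x
    using B[of x] h_le[of n x] h_supp[of x n] supp[of x] by (cases "norm x \<le> R + 1") auto
  have "(\<lambda>n. \<integral>x. \<bar>\<psi> x - h n x\<bar> \<partial>lborel) \<longlonglongrightarrow> (\<integral>x. (0::real) \<partial>(lborel :: 'a measure))"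
  proof (rule integral_dominated_convergence[OF _ _ dom])
    show "AE x in lborel. (\<lambda>n. \<bar>\<psi> x - h n x\<bar>) \<longlonglongrightarrow> 0"
      using AE_N
    proof eventually_elim
      case (elim x)
      have "(\<lambda>n. \<bar>\<psi> x - h n x\<bar>) \<longlonglongrightarrow> \<bar>\<psi> x - \<psi> x\<bar>"
        by (intro tendsto_intros h_lim elim)
      then show ?case by simp
    qed
  qed (use bnd in auto)
  then have "\<forall>\<^sub>F n in sequentially. (\<integral>x. \<bar>\<psi> x - h n x\<bar> \<partial>lborel) < e"
    using e by (intro order_tendstoD) auto
  then obtain n where n: "(\<integral>x. \<bar>\<psi> x - h n x\<bar> \<partial>lborel) < e"
    using eventually_happens by force
  have "integrable lborel (\<lambda>x. \<bar>\<psi> x - h n x\<bar>)"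
  proof (rule Bochner_Integration.integrable_bound[OF dom])
    show "AE x in lborel. norm \<bar>\<psi> x - h n x\<bar> \<le> norm (2 * B * indicator (cball 0 (R + 1)) x)"
      by (rule AE_I2, rule order_trans[OF bnd]) simp
  qed measurable
  then have "(\<integral>\<^sup>+x. ennreal \<bar>\<psi> x - h n x\<bar> \<partial>lborel) = ennreal (\<integral>x. \<bar>\<psi> x - h n x\<bar> \<partial>lborel)"
    by (rule nn_integral_eq_integral) simp
  also have "\<dots> < ennreal e" using n e by (simp add: ennreal_lessI)
  finally show ?thesis using that[of "h n"] h_cont h_supp by blast
qed

lemma translation_L1_continuous:
  fixes \<psi> :: "'a::euclidean_space \<Rightarrow> real"
  assumes [measurable]: "\<psi> \<in> borel_measurable borel" and B: "\<And>x. \<bar>\<psi> x\<bar> \<le> B"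
    and supp: "\<And>x. x \<notin> cball 0 R \<Longrightarrow> \<psi> x = 0" and e: "0 < e"
  obtains \<delta> where "0 < \<delta>" "\<And>z. norm z < \<delta> \<Longrightarrow> (\<integral>\<^sup>+x. ennreal \<bar>\<psi> (x - z) - \<psi> x\<bar> \<partial>lborel) \<le> ennreal e"
proof -
  obtain g where g: "continuous_on UNIV g" and g_supp: "\<And>x. x \<notin> cball 0 (R + 1) \<Longrightarrow> g x = 0"
    and g_close: "(\<integral>\<^sup>+x. ennreal \<bar>\<psi> x - g x\<bar> \<partial>lborel) < ennreal (e / 3)"
    using continuous_L1_approximation[OF assms(1) B supp, where e = "e / 3"] e by auto
  have [measurable]: "g \<in> borel_measurable borel" using g by (rule borel_measurable_continuous_onI)
  define V where "V = measure lborel (cball (0::'a) (R + 2))"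
  have V: "0 \<le> V" "emeasure lborel (cball (0::'a) (R + 2)) = ennreal V"
    using emeasure_lborel_cball_finite[of "0::'a" "R + 2"] by (auto simp: V_def emeasure_eq_ennreal_measure)
  \<comment> \<open>\<open>V + 1\<close> avoids dividing by a vanishing volume.\<close>
  define \<eta> where "\<eta> = e / (3 * (V + 1))"
  have \<eta>: "0 < \<eta>" "\<eta> * V \<le> e / 3"
    using e V by (auto simp: \<eta>_def field_simps)
  \<comment> \<open>\<open>g\<close> vanishes off radius \<open>R + 1\<close>; for shifts shorter
    than 1 the difference can be nonzero only within \<open>R + 2\<close>, and then both arguments
    lie within \<open>R + 3\<close>.\<close>
  have "uniformly_continuous_on (cball 0 (R + 3)) g"
    using g by (intro compact_uniformly_continuous) (auto intro: continuous_on_subset)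
  then obtain d where d: "0 < d"
    "\<And>x y. x \<in> cball 0 (R + 3) \<Longrightarrow> y \<in> cball 0 (R + 3) \<Longrightarrow> dist y x < d \<Longrightarrow> dist (g y) (g x) < \<eta>"
    unfolding uniformly_continuous_on_def using \<eta> by blast
  show ?thesis
  proof
    show "0 < min 1 d" using d by simp
    fix z :: 'a assume z: "norm z < min 1 d"
    have pw: "ennreal \<bar>g (x - z) - g x\<bar> \<le> ennreal \<eta> * indicator (cball 0 (R + 2)) x" for x
    proof (cases "norm x \<le> R + 2")
      case True
      moreover have "norm (x - z) \<le> R + 3"
        using norm_triangle_ineq4[of x z] True z by linarith
      ultimately have "dist (g (x - z)) (g x) < \<eta>"
        using z by (intro d) (auto simp: dist_norm norm_minus_commute)
      then show ?thesis using True by (simp add: dist_real_def ennreal_leI)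
    next
      case False
      then have "\<not> norm (x - z) \<le> R + 1"
        using norm_triangle_ineq[of "x - z" z] z by auto
      then show ?thesis using False g_supp[of x] g_supp[of "x - z"] by simp
    qed
    have "ennreal \<bar>\<psi> (x - z) - \<psi> x\<bar>
        \<le> ennreal \<bar>\<psi> (x - z) - g (x - z)\<bar> + ennreal \<bar>g (x - z) - g x\<bar> + ennreal \<bar>\<psi> x - g x\<bar>" for x
      by (auto simp: ennreal_plus[symmetric] simp del: ennreal_plus intro!: ennreal_leI)
    then have "(\<integral>\<^sup>+x. ennreal \<bar>\<psi> (x - z) - \<psi> x\<bar> \<partial>lborel)
        \<le> (\<integral>\<^sup>+x. ennreal \<bar>\<psi> (x - z) - g (x - z)\<bar> + ennreal \<bar>g (x - z) - g x\<bar> + ennreal \<bar>\<psi> x - g x\<bar> \<partial>lborel)"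
      by (intro nn_integral_mono)
    also have "\<dots> = (\<integral>\<^sup>+x. ennreal \<bar>\<psi> (x - z) - g (x - z)\<bar> \<partial>lborel)
        + (\<integral>\<^sup>+x. ennreal \<bar>g (x - z) - g x\<bar> \<partial>lborel) + (\<integral>\<^sup>+x. ennreal \<bar>\<psi> x - g x\<bar> \<partial>lborel)"
      by (subst nn_integral_add; (subst nn_integral_add)?; simp)
    also have "(\<integral>\<^sup>+x. ennreal \<bar>\<psi> (x - z) - g (x - z)\<bar> \<partial>lborel) = (\<integral>\<^sup>+x. ennreal \<bar>\<psi> x - g x\<bar> \<partial>lborel)"
      using nn_integral_lborel_translate[of "\<lambda>x. ennreal \<bar>\<psi> x - g x\<bar>" "- z"] by simp
    also have "(\<integral>\<^sup>+x. ennreal \<bar>g (x - z) - g x\<bar> \<partial>lborel) \<le> ennreal (e / 3)"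
    proof -
      have "(\<integral>\<^sup>+x. ennreal \<bar>g (x - z) - g x\<bar> \<partial>lborel) \<le> (\<integral>\<^sup>+x. ennreal \<eta> * indicator (cball (0::'a) (R + 2)) x \<partial>lborel)"
        by (intro nn_integral_mono pw)
      also have "\<dots> = ennreal (\<eta> * V)"
        using \<eta>(1) by (simp add: nn_integral_cmult_indicator V(2) ennreal_mult')
      also have "\<dots> \<le> ennreal (e / 3)" using \<eta> by (intro ennreal_leI)
      finally show ?thesis .
    qed
    also have "(\<integral>\<^sup>+x. ennreal \<bar>\<psi> x - g x\<bar> \<partial>lborel) \<le> ennreal (e / 3)"
      using g_close by (rule less_imp_le)
    also have "ennreal (e / 3) + ennreal (e / 3) + ennreal (e / 3) = ennreal e"
      using e by (simp add: ennreal_plus[symmetric] del: ennreal_plus)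
    finally show "(\<integral>\<^sup>+x. ennreal \<bar>\<psi> (x - z) - \<psi> x\<bar> \<partial>lborel) \<le> ennreal e"
      by (simp add: add_mono)
  qed
qed

text \<open>The mollification error is at most an average of translation errors over shifts shorter
  than \<open>r\<close>.\<close>

lemma mollify_L1_convergence:
  fixes \<psi> :: "'a::euclidean_space \<Rightarrow> real"
  assumes \<psi> [measurable]: "\<psi> \<in> borel_measurable borel" and B: "\<And>x. \<bar>\<psi> x\<bar> \<le> B"
    and supp: "\<And>x. x \<notin> cball 0 R \<Longrightarrow> \<psi> x = 0" and e: "0 < e"
  obtains \<delta> where "0 < \<delta>"
    "\<And>r. 0 < r \<Longrightarrow> r < \<delta> \<Longrightarrow> (\<integral>\<^sup>+x. ennreal \<bar>mollify r \<psi> x - \<psi> x\<bar> \<partial>lborel) \<le> ennreal e"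
proof -
  obtain \<delta> where \<delta>: "0 < \<delta>" "\<And>z. norm z < \<delta> \<Longrightarrow> (\<integral>\<^sup>+x. ennreal \<bar>\<psi> (x - z) - \<psi> x\<bar> \<partial>lborel) \<le> ennreal e"
    using translation_L1_continuous[OF assms] by blast
  show ?thesis
  proof
    show "0 < \<delta>" by fact
    fix r assume r: "0 < r" "r < \<delta>"
    have pw: "ennreal \<bar>mollify r \<psi> x - \<psi> x\<bar>
        \<le> (\<integral>\<^sup>+z. ennreal (mollifier r z) * ennreal \<bar>\<psi> (x - z) - \<psi> x\<bar> \<partial>lborel)" for x
    proof -
      have int1: "integrable lborel (\<lambda>z. mollifier r z * \<psi> (x - z))"
        by (rule integrable_mollifier_mult[OF r(1) _ B]) measurable
      have int2: "integrable lborel (\<lambda>z. mollifier r (z::'a) * \<psi> x)"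
        by (simp add: integrable_mollifier[OF r(1)])
      have "mollify r \<psi> x - \<psi> x = (\<integral>z. mollifier r z * \<psi> (x - z) - mollifier r z * \<psi> x \<partial>lborel)"
        unfolding mollify_def Bochner_Integration.integral_diff[OF int1 int2]
        using integral_mollifier[OF r(1), where 'a = 'a] by simp
      then have "ennreal \<bar>mollify r \<psi> x - \<psi> x\<bar>
          \<le> (\<integral>\<^sup>+z. ennreal (norm (mollifier r z * \<psi> (x - z) - mollifier r z * \<psi> x)) \<partial>lborel)"
        using integral_norm_bound_ennreal[OF Bochner_Integration.integrable_diff[OF int1 int2]] by simp
      also have "\<dots> = (\<integral>\<^sup>+z. ennreal (mollifier r z) * ennreal \<bar>\<psi> (x - z) - \<psi> x\<bar> \<partial>lborel)"
        by (intro nn_integral_cong)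
          (simp add: right_diff_distrib[symmetric] abs_mult mollifier_nonneg[OF r(1)] ennreal_mult')
      finally show ?thesis .
    qed
    have "(\<integral>\<^sup>+x. ennreal \<bar>mollify r \<psi> x - \<psi> x\<bar> \<partial>lborel)
        \<le> (\<integral>\<^sup>+x. \<integral>\<^sup>+z. ennreal (mollifier r z) * ennreal \<bar>\<psi> (x - z) - \<psi> x\<bar> \<partial>lborel \<partial>lborel)"
      by (intro nn_integral_mono pw)
    also have "\<dots> = (\<integral>\<^sup>+z. \<integral>\<^sup>+x. ennreal (mollifier r z) * ennreal \<bar>\<psi> (x - z) - \<psi> x\<bar> \<partial>lborel \<partial>lborel)"
      by (intro lborel_pair.Fubini'[symmetric]) measurable
    also have "\<dots> = (\<integral>\<^sup>+z. ennreal (mollifier r z) * (\<integral>\<^sup>+x. ennreal \<bar>\<psi> (x - z) - \<psi> x\<bar> \<partial>lborel) \<partial>lborel)"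
      by (intro nn_integral_cong nn_integral_cmult) measurable
    also have "\<dots> \<le> (\<integral>\<^sup>+z. ennreal (mollifier r (z::'a)) * ennreal e \<partial>lborel)"
    proof (intro nn_integral_mono)
      fix z :: 'a
      show "ennreal (mollifier r z) * (\<integral>\<^sup>+x. ennreal \<bar>\<psi> (x - z) - \<psi> x\<bar> \<partial>lborel) \<le> ennreal (mollifier r z) * ennreal e"
      proof (cases "norm z < r")
        case True
        then show ?thesis using r by (intro mult_left_mono \<delta>(2)) auto
      qed (simp add: mollifier_eq_0[OF r(1)])
    qed
    also have "\<dots> = ennreal e"
      by (simp add: nn_integral_multc nn_integral_mollifier[OF r(1)])
    finally show "(\<integral>\<^sup>+x. ennreal \<bar>mollify r \<psi> x - \<psi> x\<bar> \<partial>lborel) \<le> ennreal e" .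
  qed
qed

text \<open>Convergence in L^1 yields almost everywhere convergence along a subsequence, hence a
  chosen sequence of radii and not the full limit. The bound \<open>\<rho>\<close> keeps the
  supports under control.\<close>

lemma mollify_AE_convergence:
  fixes \<psi> :: "'a::euclidean_space \<Rightarrow> real"
  assumes \<psi> [measurable]: "\<psi> \<in> borel_measurable borel" and B: "\<And>x. \<bar>\<psi> x\<bar> \<le> B"
    and supp: "\<And>x. x \<notin> cball 0 R \<Longrightarrow> \<psi> x = 0" and \<rho>: "0 < \<rho>"
  obtains r :: "nat \<Rightarrow> real" where "\<And>n. 0 < r n" "\<And>n. r n < \<rho>"
    "AE x in lborel. (\<lambda>n. mollify (r n) \<psi> x) \<longlonglongrightarrow> \<psi> x"
proof -
  have "\<exists>r>0. r < \<rho> \<and> (\<integral>\<^sup>+x. ennreal \<bar>mollify r \<psi> x - \<psi> x\<bar> \<partial>lborel) \<le> ennreal (1 / real (Suc n))" for n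
  proof -
    obtain \<delta> where "0 < \<delta>"
      "\<And>r. 0 < r \<Longrightarrow> r < \<delta> \<Longrightarrow> (\<integral>\<^sup>+x. ennreal \<bar>mollify r \<psi> x - \<psi> x\<bar> \<partial>lborel) \<le> ennreal (1 / real (Suc n))"
      using mollify_L1_convergence[OF \<psi> B supp, where e = "1 / real (Suc n)"] by auto
    then show ?thesis using \<rho> by (intro exI[of _ "min \<delta> \<rho> / 2"]) auto
  qed
  then obtain r where r: "\<And>n. 0 < r n" "\<And>n. r n < \<rho>"
    and le: "\<And>n. (\<integral>\<^sup>+x. ennreal \<bar>mollify (r n) \<psi> x - \<psi> x\<bar> \<partial>lborel) \<le> ennreal (1 / real (Suc n))"
    by metis
  have int: "integrable lborel (\<lambda>x. mollify (r n) \<psi> x - \<psi> x)" for n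
    by (rule integrableI_bounded) (use le[of n] in \<open>auto simp: less_top[symmetric] top_unique\<close>)
  have "(\<lambda>n. \<integral>x. norm (mollify (r n) \<psi> x - \<psi> x) \<partial>lborel) \<longlonglongrightarrow> 0"
  proof (rule tendsto_sandwich[OF _ _ tendsto_const lim_inverse_n'])
    have "ennreal (\<integral>x. norm (mollify (r n) \<psi> x - \<psi> x) \<partial>lborel) \<le> ennreal (1 / real (Suc n))" for n
      using le[of n] nn_integral_eq_integral[OF integrable_norm[OF int[of n]]] by simp
    then have "(\<integral>x. norm (mollify (r n) \<psi> x - \<psi> x) \<partial>lborel) \<le> 1 / real (Suc n)" for n
      by (subst (asm) ennreal_le_iff) auto
    moreover have "1 / real (Suc n) \<le> 1 / real n" if "0 < n" for n
      using that by (simp add: field_simps)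
    ultimately have "(\<integral>x. norm (mollify (r n) \<psi> x - \<psi> x) \<partial>lborel) \<le> 1 / real n" if "0 < n" for n
      using that by (meson order_trans)
    then show "\<forall>\<^sub>F n in sequentially. (\<integral>x. norm (mollify (r n) \<psi> x - \<psi> x) \<partial>lborel) \<le> 1 / real n"
      by (intro eventually_mono[OF eventually_gt_at_top[of 0]])
  qed simp
  from tendsto_L1_AE_subseq[OF int this] obtain k where
    k: "AE x in lborel. (\<lambda>n. mollify (r (k n)) \<psi> x - \<psi> x) \<longlonglongrightarrow> 0" by blast
  show ?thesis
  proof (rule that[of "r \<circ> k"])
    show "AE x in lborel. (\<lambda>n. mollify ((r \<circ> k) n) \<psi> x) \<longlonglongrightarrow> \<psi> x"
      using k by (simp add: LIM_zero_iff)
  qed (use r in auto)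
qed

section \<open>Approximation by test functions\<close>

text \<open>The gap \<open>\<delta>\<close> serves twice: it leaves room for mollification inside
  \<Omega>, and it keeps pairs with one point in \<open>K\<close> and the other off
  \<open>K'\<close> away from the singularity of the kernel.\<close>

lemma compact_neighbourhood:
  fixes K :: "'a::euclidean_space set"
  assumes "compact K" "open \<Omega>" "K \<subseteq> \<Omega>"
  obtains \<delta> K' where "0 < \<delta>" "compact K'" "K \<subseteq> K'" "K' \<subseteq> \<Omega>"
    "\<And>x y. x \<in> K \<Longrightarrow> y \<notin> K' \<Longrightarrow> \<delta> \<le> norm (x - y)"
proof -
  obtain d where d: "0 < d" "\<forall>x\<in>K. \<forall>y\<in>- \<Omega>. d \<le> dist x y"
    using separate_compact_closed[of K "- \<Omega>"] assms by (auto simp: closed_Compl)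
  define K' where "K' = {x + y |x y. x \<in> K \<and> y \<in> cball 0 (d / 2)}"
  show ?thesis
  proof
    show "0 < d / 2" using d by simp
    show "compact K'" unfolding K'_def by (intro compact_sums assms compact_cball)
    have K': "y \<in> K'" if "x \<in> K" "norm (x - y) \<le> d / 2" for x y
    proof -
      have "y = x + (y - x)" "y - x \<in> cball 0 (d / 2)"
        using that by (auto simp: norm_minus_commute)
      then show ?thesis using that unfolding K'_def by blast
    qed
    then show "K \<subseteq> K'" using d by force
    show "K' \<subseteq> \<Omega>"
    proof
      fix w assume "w \<in> K'"
      then obtain x y where "x \<in> K" "norm y \<le> d / 2" "w = x + y" unfolding K'_def by auto
      then show "w \<in> \<Omega>" using d by (force simp: dist_norm)
    qed
    show "d / 2 \<le> norm (x - y)" if "x \<in> K" "y \<notin> K'" for x y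
      using K'[of x y] that by linarith
  qed
qed

text \<open>The mollification radii stay below the gap between \<open>K\<close> and the complement
  of \<open>K'\<close>, so one compact set contains all the supports; this allows bounds uniform in
  n.\<close>

lemma test_function_approximation:
  fixes \<psi> :: "'a::euclidean_space \<Rightarrow> real"
  assumes p: "1 < p" and \<Omega>: "open \<Omega>" and K: "compact K" "K \<subseteq> \<Omega>"
    and \<psi> [measurable]: "\<psi> \<in> borel_measurable borel" and B: "\<And>x. \<bar>\<psi> x\<bar> \<le> B"
    and supp: "\<And>x. x \<notin> K \<Longrightarrow> \<psi> x = 0"
  obtains \<phi> :: "nat \<Rightarrow> 'a \<Rightarrow> real" and K' where "compact K'" "K' \<subseteq> \<Omega>"
    "\<And>n. test_function \<Omega> (\<phi> n)" "\<And>n x. \<bar>\<phi> n x\<bar> \<le> B" "\<And>n x. x \<notin> K' \<Longrightarrow> \<phi> n x = 0"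
    "\<And>n. \<phi> n \<in> borel_measurable borel"
    "\<And>n. gagliardo_energy s p (\<phi> n) \<le> gagliardo_energy s p \<psi>"
    "AE x in lborel. (\<lambda>n. \<phi> n x) \<longlonglongrightarrow> \<psi> x"
proof -
  obtain \<delta> K' where \<delta>: "0 < \<delta>" and K': "compact K'" "K \<subseteq> K'" "K' \<subseteq> \<Omega>"
    and sep: "\<And>x y. x \<in> K \<Longrightarrow> y \<notin> K' \<Longrightarrow> \<delta> \<le> norm (x - y)"
    by (rule compact_neighbourhood[OF K(1) \<Omega> K(2)]) (rule that; assumption)
  obtain R where R: "K \<subseteq> ball 0 R"
    using bounded_subset_ballD[OF compact_imp_bounded[OF K(1)], of 0] by blast
  have supp_R: "\<psi> x = 0" if "x \<notin> cball 0 R" for x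
  proof (rule supp)
    show "x \<notin> K" using that R by force
  qed
  obtain r :: "nat \<Rightarrow> real" where r: "\<And>n. 0 < r n" "\<And>n. r n < \<delta>"
    and lim: "AE x in lborel. (\<lambda>n. mollify (r n) \<psi> x) \<longlonglongrightarrow> \<psi> x"
    by (rule mollify_AE_convergence[where R = R, OF \<psi> B _ \<delta>]) (erule supp_R, rule that)
  have int: "integrable lborel \<psi>"
    using emeasure_lborel_cball_finite[of "0::'a" R] B supp_R
    by (intro integrableI_bounded_set[of "cball 0 R" _ _ B]) auto
  have zero: "mollify (r n) \<psi> x = 0" if x: "x \<notin> K'" for n x
  proof (rule mollify_eq_0[OF r(1)])
    fix y assume "norm (x - y) < r n"
    then have "y \<notin> K" using sep[of y x] x r(2)[of n] by (auto simp: norm_minus_commute)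
    then show "\<psi> y = 0" by (rule supp)
  qed
  have test: "test_function \<Omega> (mollify (r n) \<psi>)" for n
  proof -
    have "closure {x. mollify (r n) \<psi> x \<noteq> 0} \<subseteq> K'"
      using zero K'(1) by (intro closure_minimal compact_imp_closed) auto
    moreover from this have "bounded {x. mollify (r n) \<psi> x \<noteq> 0}"
      by (rule bounded_subset[OF compact_imp_bounded[OF K'(1)] order_trans[OF closure_subset]])
    ultimately show ?thesis
      unfolding test_function_def compact_closure using smooth_mollify[OF r(1) int] K'(3) by blast
  qed
  show ?thesis
  proof
    show "compact K'" "K' \<subseteq> \<Omega>" by (fact K')+
    show "test_function \<Omega> (mollify (r n) \<psi>)" for n by (rule test)
    show "\<bar>mollify (r n) \<psi> x\<bar> \<le> B" for n x by (rule abs_mollify_le[OF r(1) \<psi> B])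
    show "mollify (r n) \<psi> x = 0" if "x \<notin> K'" for n x using that by (rule zero)
    show "mollify (r n) \<psi> \<in> borel_measurable borel" for n by measurable
    show "gagliardo_energy s p (mollify (r n) \<psi>) \<le> gagliardo_energy s p \<psi>" for n
      by (rule gagliardo_energy_mollify_le[OF r(1) p \<psi> B])
  qed (rule lim)
qed

text \<open>Fatou applies to \<open>a n + R + F n\<close> and to \<open>a n + R - F n\<close>; the bound on the integrals of \<open>a n\<close> lets the
  dominating terms cancel.\<close>

lemma fatou_generalized:
  fixes F :: "nat \<Rightarrow> 'a \<Rightarrow> real"
  assumes F: "\<And>n. has_bochner_integral M (F n) (c n)" "c \<longlonglongrightarrow> c'"
    and a [measurable]: "\<And>n. a n \<in> borel_measurable M" "a' \<in> borel_measurable M"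
      "R \<in> borel_measurable M" "F' \<in> borel_measurable M"
    and nonneg: "\<And>n x. 0 \<le> a n x" "\<And>x. 0 \<le> R x"
    and lim: "AE x in M. (\<lambda>n. F n x) \<longlonglongrightarrow> F' x" "AE x in M. (\<lambda>n. a n x) \<longlonglongrightarrow> a' x"
    and le: "\<And>n. AE x in M. \<bar>F n x\<bar> \<le> a n x + R x"
    and fin: "\<And>n. (\<integral>\<^sup>+x. ennreal (a n x) \<partial>M) \<le> (\<integral>\<^sup>+x. ennreal (a' x) \<partial>M)"
      "(\<integral>\<^sup>+x. ennreal (a' x) \<partial>M) < \<infinity>" "(\<integral>\<^sup>+x. ennreal (R x) \<partial>M) < \<infinity>"
  shows "has_bochner_integral M F' c'"
proof -
  have a'_nonneg: "AE x in M. 0 \<le> a' x"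
    using lim(2) by eventually_elim (use nonneg in \<open>auto intro: LIMSEQ_le_const\<close>)
  have int_a': "integrable M a'"
    using fin(2) a'_nonneg by (intro integrableI_nonneg) auto
  have int_R: "integrable M R"
    using fin(3) nonneg by (intro integrableI_nonneg) auto
  have int_a: "integrable M (a n)" for n
    using fin(1)[of n] fin(2) nonneg by (intro integrableI_nonneg) (auto intro: le_less_trans)
  have a_le: "integral\<^sup>L M (a n) \<le> integral\<^sup>L M a'" for n
  proof -
    have "ennreal (integral\<^sup>L M (a n)) \<le> ennreal (integral\<^sup>L M a')"
      using fin(1)[of n] nn_integral_eq_integral[OF int_a[of n]] nn_integral_eq_integral[OF int_a' a'_nonneg] nonneg
      by simp
    moreover have "0 \<le> integral\<^sup>L M a'" by (intro integral_nonneg_AE a'_nonneg)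
    ultimately show ?thesis by (simp add: ennreal_le_iff)
  qed
  have le_all: "AE x in M. \<forall>n. \<bar>F n x\<bar> \<le> a n x + R x"
    using le by (simp add: AE_all_countable)
  have F'_le: "AE x in M. \<bar>F' x\<bar> \<le> a' x + R x"
    using lim le_all
  proof eventually_elim
    case (elim x)
    show ?case
      by (rule LIMSEQ_le[of "\<lambda>n. \<bar>F n x\<bar>" _ "\<lambda>n. a n x + R x"]) (use elim in \<open>auto intro!: tendsto_intros\<close>)
  qed
  have int_F': "integrable M F'"
    by (rule Bochner_Integration.integrable_bound[of _ "\<lambda>x. a' x + R x"])
      (use int_a' int_R F'_le in \<open>auto elim!: eventually_mono\<close>)
  \<comment> \<open>One inequality for a general sequence \<open>G\<close>; applied to
    \<open>F\<close> and to its negative it gives equality of the limits.\<close>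
  have half: "integral\<^sup>L M G' \<le> d'"
    if G: "\<And>n. has_bochner_integral M (G n) (d n)" "d \<longlonglongrightarrow> d'" and int: "integrable M G'"
      and limG: "AE x in M. (\<lambda>n. G n x) \<longlonglongrightarrow> G' x" and leG: "AE x in M. \<forall>n. \<bar>G n x\<bar> \<le> a n x + R x"
    for G G' and d :: "nat \<Rightarrow> real" and d'
  proof -
    have [measurable]: "G n \<in> borel_measurable M" for n
      using G(1)[of n] by (auto simp: has_bochner_integral_iff)
    define A where "A = integral\<^sup>L M a' + integral\<^sup>L M R"
    have G'_le: "AE x in M. \<bar>G' x\<bar> \<le> a' x + R x"
      using lim(2) limG leG
    proof eventually_elim
      case (elim x)
      show ?case
        by (rule LIMSEQ_le[of "\<lambda>n. \<bar>G n x\<bar>" _ "\<lambda>n. a n x + R x"]) (use elim in \<open>auto intro!: tendsto_intros\<close>)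
    qed
    have nn: "(\<integral>\<^sup>+x. ennreal (G n x + a n x + R x) \<partial>M) \<le> ennreal (d n + A)" for n
    proof -
      have "integrable M (\<lambda>x. G n x + a n x + R x)"
        using G(1)[of n] int_a int_R by (auto simp: has_bochner_integral_iff)
      moreover have "AE x in M. 0 \<le> G n x + a n x + R x"
        using leG by eventually_elim (auto simp: abs_le_iff dest!: spec[of _ n])
      ultimately have "(\<integral>\<^sup>+x. ennreal (G n x + a n x + R x) \<partial>M) = ennreal (\<integral>x. G n x + a n x + R x \<partial>M)"
        by (rule nn_integral_eq_integral)
      also have "(\<integral>x. G n x + a n x + R x \<partial>M) = d n + integral\<^sup>L M (a n) + integral\<^sup>L M R"
        using G(1)[of n] int_a int_R by (simp add: has_bochner_integral_iff)
      finally show ?thesis using a_le[of n] by (auto simp: A_def intro!: ennreal_leI)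
    qed
    have nonneg': "AE x in M. 0 \<le> G' x + a' x + R x"
      using G'_le by eventually_elim auto
    have int': "integrable M (\<lambda>x. G' x + a' x + R x)" using int int_a' int_R by simp
    have "ennreal (integral\<^sup>L M G' + A) = ennreal (\<integral>x. G' x + a' x + R x \<partial>M)"
      using int int_a' int_R by (simp add: A_def add.assoc)
    also have "\<dots> = (\<integral>\<^sup>+x. ennreal (G' x + a' x + R x) \<partial>M)"
      by (rule nn_integral_eq_integral[OF int' nonneg', symmetric])
    also have "\<dots> = (\<integral>\<^sup>+x. liminf (\<lambda>n. ennreal (G n x + a n x + R x)) \<partial>M)"
    proof (rule nn_integral_cong_AE)
      show "AE x in M. ennreal (G' x + a' x + R x) = liminf (\<lambda>n. ennreal (G n x + a n x + R x))"
        using limG lim(2)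
      proof eventually_elim
        case (elim x)
        have "(\<lambda>n. ennreal (G n x + a n x + R x)) \<longlonglongrightarrow> ennreal (G' x + a' x + R x)"
          by (intro tendsto_ennrealI tendsto_intros elim)
        then show ?case by (simp add: lim_imp_Liminf)
      qed
    qed
    also have "\<dots> \<le> liminf (\<lambda>n. \<integral>\<^sup>+x. ennreal (G n x + a n x + R x) \<partial>M)"
      by (rule nn_integral_liminf) measurable
    also have "\<dots> \<le> liminf (\<lambda>n. ennreal (d n + A))"
      by (intro Liminf_mono always_eventually allI nn)
    also have "\<dots> = ennreal (d' + A)"
      by (intro lim_imp_Liminf tendsto_ennrealI tendsto_intros G) auto
    finally have *: "ennreal (integral\<^sup>L M G' + A) \<le> ennreal (d' + A)" .
    have ge: "0 \<le> integral\<^sup>L M G' + A"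
      using integral_nonneg_AE[OF nonneg'] int int_a' int_R by (simp add: A_def)
    \<comment> \<open>\<open>ennreal\<close> sends negative reals to 0, so the comparison
      \<open>*\<close> descends to the reals only once the right-hand side is known to be
      nonnegative.\<close>
    have ge': "0 \<le> d' + A"
    proof (rule LIMSEQ_le_const)
      show "(\<lambda>n. d n + A) \<longlonglongrightarrow> d' + A" by (intro tendsto_intros G)
      have "0 \<le> d n + A" for n
      proof -
        have "0 \<le> (\<integral>x. G n x + a n x + R x \<partial>M)"
          using leG by (intro integral_nonneg_AE) (auto elim!: eventually_mono simp: abs_le_iff dest!: spec[of _ n])
        also have "\<dots> = d n + integral\<^sup>L M (a n) + integral\<^sup>L M R"
          using G(1)[of n] int_a int_R by (simp add: has_bochner_integral_iff)
        finally show ?thesis using a_le[of n] by (simp add: A_def)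
      qed
      then show "\<exists>N. \<forall>n\<ge>N. 0 \<le> d n + A" by blast
    qed
    show ?thesis using * ge ge' by (simp add: ennreal_le_iff)
  qed
  have "integral\<^sup>L M F' \<le> c'"
    by (rule half[OF F int_F' lim(1) le_all])
  moreover have "integral\<^sup>L M (\<lambda>x. - F' x) \<le> - c'"
  proof (rule half)
    show "has_bochner_integral M (\<lambda>x. - F n x) (- c n)" for n
      using F(1) by (rule has_bochner_integral_minus)
    show "(\<lambda>n. - c n) \<longlonglongrightarrow> - c'" using F(2) by (rule tendsto_minus)
    show "AE x in M. (\<lambda>n. - F n x) \<longlonglongrightarrow> - F' x"
      using lim(1) by eventually_elim (rule tendsto_minus)
  qed (use int_F' le_all in auto)
  ultimately show ?thesis using int_F' by (auto simp: has_bochner_integral_iff)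
qed

section \<open>Extension of the weak formulation\<close>

lemma fst_borel_measurable [measurable]:
  "(fst :: 'a::euclidean_space \<times> 'b::euclidean_space \<Rightarrow> 'a) \<in> borel_measurable borel"
  by (intro borel_measurable_continuous_onI continuous_intros)

lemma snd_borel_measurable [measurable]:
  "(snd :: 'a::euclidean_space \<times> 'b::euclidean_space \<Rightarrow> 'b) \<in> borel_measurable borel"
  by (intro borel_measurable_continuous_onI continuous_intros)

text \<open>Sigma-finiteness is an explicit premise so that the lemma serves both
  \<open>lborel\<close> and \<open>lebesgue\<close>.\<close>

lemma AE_pair_fst:
  assumes "sigma_finite_measure M2" "AE x in M1. P x"
  shows "AE z in M1 \<Otimes>\<^sub>M M2. P (fst z)"
proof -
  interpret sigma_finite_measure M2 by fact
  obtain N where N: "{x \<in> space M1. \<not> P x} \<subseteq> N" "emeasure M1 N = 0" "N \<in> sets M1"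
    using assms(2) by (rule AE_E)
  have "N \<times> space M2 \<in> null_sets (M1 \<Otimes>\<^sub>M M2)"
    using N by (auto simp: null_sets_def emeasure_pair_measure_Times)
  moreover have "{z \<in> space (M1 \<Otimes>\<^sub>M M2). \<not> P (fst z)} \<subseteq> N \<times> space M2"
    using N(1) by (auto simp: space_pair_measure)
  ultimately show ?thesis by (rule AE_I')
qed

lemma AE_pair_snd:
  assumes "sigma_finite_measure M2" "AE x in M2. P x"
  shows "AE z in M1 \<Otimes>\<^sub>M M2. P (snd z)"
proof -
  interpret sigma_finite_measure M2 by fact
  obtain N where N: "{x \<in> space M2. \<not> P x} \<subseteq> N" "emeasure M2 N = 0" "N \<in> sets M2"
    using assms(2) by (rule AE_E)
  have "space M1 \<times> N \<in> null_sets (M1 \<Otimes>\<^sub>M M2)"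
    using N by (auto simp: null_sets_def emeasure_pair_measure_Times)
  moreover have "{z \<in> space (M1 \<Otimes>\<^sub>M M2). \<not> P (snd z)} \<subseteq> space M1 \<times> N"
    using N(1) by (auto simp: space_pair_measure)
  ultimately show ?thesis by (rule AE_I')
qed

lemma AE_lborel_fst_snd:
  assumes "AE x in (lborel :: 'a::euclidean_space measure). P x"
  shows "AE z in (lborel :: ('a \<times> 'a) measure). P (fst z) \<and> P (snd z)"
proof -
  have "AE z in lborel \<Otimes>\<^sub>M lborel. P (fst z) \<and> P (snd z)"
    by (intro AE_conjI AE_pair_fst AE_pair_snd sigma_finite_lborel assms)
  then show ?thesis by (simp only: lborel_prod)
qed

text \<open>Integrating out the other variable at scale \<open>t y\<close> leaves
  \<open>h y * t y powr - (s * p)\<close>. A constant scale accounts for pairs at a fixed distance,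
  a multiple of the distance to the complement for the error of a cutoff. The scale has to be
  positive only where \<open>h\<close> lives, so the latter may vanish outside \<Omega>.\<close>

lemma nn_integral_weighted_kernel:
  fixes h t :: "'a::euclidean_space \<Rightarrow> real" and s p :: real
  assumes s: "0 < s" "s < 1" and p: "1 < p"
    and [measurable]: "h \<in> borel_measurable borel" "t \<in> borel_measurable borel"
    and h: "\<And>y. 0 \<le> h y" and t: "\<And>y. h y \<noteq> 0 \<Longrightarrow> 0 < t y"
    and fin: "(\<integral>\<^sup>+y. ennreal (h y * t y powr - (s * p)) \<partial>lborel) < \<infinity>"
  shows "(\<integral>\<^sup>+z. ennreal (h (fst z) * (min 1 (norm (fst z - snd z) / t (fst z)) powr p
            / norm (fst z - snd z) powr (real DIM('a) + s * p))) \<partial>lborel) < \<infinity>" (is ?fst)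
    and "(\<integral>\<^sup>+z. ennreal (h (snd z) * (min 1 (norm (fst z - snd z) / t (snd z)) powr p
            / norm (fst z - snd z) powr (real DIM('a) + s * p))) \<partial>lborel) < \<infinity>" (is ?snd)
proof -
  define a where "a = real DIM('a) + s * p"
  define k where "k r z = min 1 (norm z / r) powr p / norm z powr a" for r and z :: 'a
  have [measurable]: "(\<lambda>x. k (f x) (g x)) \<in> borel_measurable M"
    if "f \<in> borel_measurable M" "g \<in> borel_measurable M" for f and g :: "'b \<Rightarrow> 'a" and M :: "'b measure"
    unfolding k_def using that by measurable
  obtain C where C: "0 \<le> C"
    "\<And>r. 0 < r \<Longrightarrow> (\<integral>\<^sup>+z. ennreal (k r z) \<partial>lborel) \<le> ennreal (C * r powr - (s * p))"
    using nn_integral_truncated_kernel[OF s p, where 'a = 'a] unfolding k_def a_def by blast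
  have inner: "(\<integral>\<^sup>+x. ennreal (h y * k (t y) (x - y)) \<partial>lborel) \<le> ennreal C * ennreal (h y * t y powr - (s * p))" for y
  proof (cases "h y = 0")
    case False
    have "(\<integral>\<^sup>+x. ennreal (h y * k (t y) (x - y)) \<partial>lborel) = (\<integral>\<^sup>+x. ennreal (h y) * ennreal (k (t y) (x - y)) \<partial>lborel)"
      by (simp add: ennreal_mult' h)
    also have "\<dots> = ennreal (h y) * (\<integral>\<^sup>+x. ennreal (k (t y) (x - y)) \<partial>lborel)"
      by (rule nn_integral_cmult) measurable
    also have "(\<integral>\<^sup>+x. ennreal (k (t y) (x - y)) \<partial>lborel) = (\<integral>\<^sup>+x. ennreal (k (t y) x) \<partial>lborel)"
      using nn_integral_lborel_translate[of "\<lambda>x. ennreal (k (t y) x)" "- y"] by simp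
    also have "ennreal (h y) * \<dots> \<le> ennreal (h y) * ennreal (C * t y powr - (s * p))"
      using t[OF False] by (intro mult_left_mono C) auto
    also have "\<dots> = ennreal C * ennreal (h y * t y powr - (s * p))"
      using h C by (simp add: ennreal_mult'[symmetric] mult_ac)
    finally show ?thesis .
  qed simp
  have k_sym: "k r (x - y) = k r (y - x)" for r x y
    by (simp add: k_def norm_minus_commute)
  have total: "(\<integral>\<^sup>+y. \<integral>\<^sup>+x. ennreal (h y * k (t y) (x - y)) \<partial>lborel \<partial>lborel) < \<infinity>"
  proof -
    have "(\<integral>\<^sup>+y. \<integral>\<^sup>+x. ennreal (h y * k (t y) (x - y)) \<partial>lborel \<partial>lborel)
        \<le> (\<integral>\<^sup>+y. ennreal C * ennreal (h y * t y powr - (s * p)) \<partial>lborel)"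
      by (intro nn_integral_mono inner)
    also have "\<dots> = ennreal C * (\<integral>\<^sup>+y. ennreal (h y * t y powr - (s * p)) \<partial>lborel)"
      by (rule nn_integral_cmult) measurable
    also have "\<dots> < \<infinity>" using fin by (simp add: ennreal_mult_less_top)
    finally show ?thesis .
  qed
  have "(\<integral>\<^sup>+z. ennreal (h (fst z) * k (t (fst z)) (fst z - snd z)) \<partial>(lborel \<Otimes>\<^sub>M lborel))
      = (\<integral>\<^sup>+y. \<integral>\<^sup>+x. ennreal (h y * k (t y) (x - y)) \<partial>lborel \<partial>lborel)"
    using lborel.nn_integral_fst[of "\<lambda>z. ennreal (h (fst z) * k (t (fst z)) (fst z - snd z))" lborel]
    by (simp add: k_sym)
  then show ?fst using total by (simp add: k_def a_def lborel_prod)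
  have "(\<integral>\<^sup>+z. ennreal (h (snd z) * k (t (snd z)) (fst z - snd z)) \<partial>(lborel \<Otimes>\<^sub>M lborel))
      = (\<integral>\<^sup>+y. \<integral>\<^sup>+x. ennreal (h y * k (t y) (x - y)) \<partial>lborel \<partial>lborel)"
    using lborel_pair.nn_integral_snd[of "\<lambda>z. ennreal (h (snd z) * k (t (snd z)) (fst z - snd z))"]
    by simp
  then show ?snd using total by (simp add: k_def a_def lborel_prod)
qed

definition form_density :: "real \<Rightarrow> real \<Rightarrow> ('a::euclidean_space \<Rightarrow> real) \<Rightarrow> ('a \<Rightarrow> real) \<Rightarrow> 'a \<times> 'a \<Rightarrow> real" where
  "form_density s p u \<phi> z = pflux p (u (fst z) - u (snd z)) * (\<phi> (fst z) - \<phi> (snd z))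
     / norm (fst z - snd z) powr (real DIM('a) + s * p)"

lemma pflux_measurable [measurable]: "pflux p \<in> borel_measurable borel"
  unfolding pflux_def[abs_def] by measurable

text \<open>Three zones of pairs: with both points in \<open>K3\<close>, the local energy of
  \<open>u\<close> and the energy of \<open>\<phi> n\<close> suffice; at distance at least
  \<open>\<delta>\<close>, the integrability of |u|^(p-1) and the bound on \<open>\<phi> n\<close>
  do; otherwise the integrand vanishes. The energy densities of \<open>\<phi> n\<close> are
  controlled only through their integrals, whence \<open>fatou_generalized\<close> in place of
  dominated convergence.\<close>

lemma weak_form_extension:
  fixes u g \<psi> :: "'a::euclidean_space \<Rightarrow> real" and s p :: real
  assumes s: "0 < s" "s < 1" and p: "1 < p" and \<Omega>: "open \<Omega>"
    and u [measurable]: "u \<in> borel_measurable borel"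
    and loc: "\<And>K. compact K \<Longrightarrow> K \<subseteq> \<Omega> \<Longrightarrow> (\<integral>\<^sup>+z. ennreal (\<bar>u (fst z) - u (snd z)\<bar> powr p
        / norm (fst z - snd z) powr (real DIM('a) + s * p)) * indicator (K \<times> K) z \<partial>lborel) < \<infinity>"
    and Lp: "(\<integral>\<^sup>+x. ennreal (\<bar>u x\<bar> powr (p - 1)) \<partial>lborel) < \<infinity>"
    and g: "\<And>K. compact K \<Longrightarrow> K \<subseteq> \<Omega> \<Longrightarrow> set_integrable lebesgue K g"
    and weak: "\<And>\<phi>. test_function \<Omega> \<phi> \<Longrightarrow>
        has_bochner_integral lborel (form_density s p u \<phi>) (LINT x:\<Omega>|lebesgue. g x * \<phi> x)"
    and \<psi> [measurable]: "\<psi> \<in> borel_measurable borel" and B: "\<And>x. \<bar>\<psi> x\<bar> \<le> B"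
    and K: "compact K" "K \<subseteq> \<Omega>" "\<And>x. x \<notin> K \<Longrightarrow> \<psi> x = 0"
    and energy: "gagliardo_energy s p \<psi> < \<infinity>"
  shows "has_bochner_integral lborel (form_density s p u \<psi>) (LINT x:\<Omega>|lebesgue. g x * \<psi> x)"
proof -
  define a where "a = real DIM('a) + s * p"
  obtain \<phi> :: "nat \<Rightarrow> 'a \<Rightarrow> real" and K1 where K1: "compact K1" "K1 \<subseteq> \<Omega>"
    and test: "\<And>n. test_function \<Omega> (\<phi> n)" and \<phi>_B: "\<And>n x. \<bar>\<phi> n x\<bar> \<le> B"
    and \<phi>_0: "\<And>n x. x \<notin> K1 \<Longrightarrow> \<phi> n x = 0" and [measurable]: "\<And>n. \<phi> n \<in> borel_measurable borel"
    and \<phi>_E: "\<And>n. gagliardo_energy s p (\<phi> n) \<le> gagliardo_energy s p \<psi>"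
    and lim: "AE x in lborel. (\<lambda>n. \<phi> n x) \<longlonglongrightarrow> \<psi> x"
    by (rule test_function_approximation[OF p \<Omega> K(1,2) \<psi> B, where s = s]) (erule K(3), rule that)
  define K2 where "K2 = K \<union> K1"
  have K2: "compact K2" "K2 \<subseteq> \<Omega>" using K K1 by (auto simp: K2_def)
  obtain \<delta> K3 where \<delta>: "0 < \<delta>" and K3: "compact K3" "K2 \<subseteq> K3" "K3 \<subseteq> \<Omega>"
    and sep: "\<And>x y. x \<in> K2 \<Longrightarrow> y \<notin> K3 \<Longrightarrow> \<delta> \<le> norm (x - y)"
    by (rule compact_neighbourhood[OF K2(1) \<Omega> K2(2)]) (rule that; assumption)
  have \<phi>_02: "\<phi> n x = 0" if "x \<notin> K2" for n x using that \<phi>_0 by (simp add: K2_def)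
  have [measurable]: "K3 \<times> K3 \<in> sets borel"
    using K3(1) by (intro borel_compact compact_Times)
  have B0: "0 \<le> B" using B[of 0] by linarith
  define k where "k z = 1 / norm (fst z - snd z) powr a" for z :: "'a \<times> 'a"
  \<comment> \<open>Equal to 1 at distance at least \<open>\<delta>\<close>; its decay near the
    diagonal makes \<open>R2\<close> integrable over all pairs.\<close>
  define m where "m z = min 1 (norm (fst z - snd z) / \<delta>) powr p" for z :: "'a \<times> 'a"
  have k0: "0 \<le> k z" for z by (simp add: k_def)
  have m0: "0 \<le> m z" for z by (simp add: m_def)
  have [measurable]: "k \<in> borel_measurable borel" "m \<in> borel_measurable borel"
    unfolding k_def[abs_def] m_def[abs_def] by measurable
  define R1 where "R1 z = \<bar>u (fst z) - u (snd z)\<bar> powr p * k z * indicator (K3 \<times> K3) z" for z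
  \<comment> \<open>\<open>2 * B\<close> bounds the differences of \<open>\<phi> n\<close>, and
    \<open>2 powr (p - 1)\<close> is the constant of \<open>powr_add_le\<close>.\<close>
  define L where "L = 2 * B * 2 powr (p - 1)"
  have L0: "0 \<le> L" using B0 by (simp add: L_def)
  define R2 where "R2 z = L * (\<bar>u (fst z)\<bar> powr (p - 1) * (m z * k z)) + L * (\<bar>u (snd z)\<bar> powr (p - 1) * (m z * k z))" for z
  have R0: "0 \<le> R1 z" "0 \<le> R2 z" for z
    using k0 m0 L0 by (auto simp: R1_def R2_def)
  have [measurable]: "R1 \<in> borel_measurable borel" "R2 \<in> borel_measurable borel"
    unfolding R1_def[abs_def] R2_def[abs_def] by measurable
  have R1_fin: "(\<integral>\<^sup>+z. ennreal (R1 z) \<partial>lborel) < \<infinity>"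
  proof -
    have "ennreal (R1 z) = ennreal (\<bar>u (fst z) - u (snd z)\<bar> powr p / norm (fst z - snd z) powr a) * indicator (K3 \<times> K3) z" for z
      by (auto simp: R1_def k_def indicator_def)
    then show ?thesis using loc[OF K3(1,3)] by (simp add: a_def)
  qed
  have R2_fin: "(\<integral>\<^sup>+z. ennreal (R2 z) \<partial>lborel) < \<infinity>"
  proof -
    have fin: "(\<integral>\<^sup>+y. ennreal (\<bar>u y\<bar> powr (p - 1) * \<delta> powr - (s * p)) \<partial>lborel) < \<infinity>"
      using Lp by (simp add: ennreal_mult'' nn_integral_multc ennreal_mult_less_top)
    note * = nn_integral_weighted_kernel[OF s p, of "\<lambda>y. \<bar>u y\<bar> powr (p - 1)" "\<lambda>_. \<delta>", OF _ _ _ _ fin]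
    have "(\<integral>\<^sup>+z. ennreal (\<bar>u (fst z)\<bar> powr (p - 1) * (m z * k z)) \<partial>lborel) < \<infinity>"
      "(\<integral>\<^sup>+z. ennreal (\<bar>u (snd z)\<bar> powr (p - 1) * (m z * k z)) \<partial>lborel) < \<infinity>"
      using * \<delta> by (simp_all add: m_def k_def a_def)
    moreover have "(\<integral>\<^sup>+z. ennreal (R2 z) \<partial>lborel)
        = ennreal L * (\<integral>\<^sup>+z. ennreal (\<bar>u (fst z)\<bar> powr (p - 1) * (m z * k z)) \<partial>lborel)
        + ennreal L * (\<integral>\<^sup>+z. ennreal (\<bar>u (snd z)\<bar> powr (p - 1) * (m z * k z)) \<partial>lborel)"
    proof -
      have "ennreal (R2 z) = ennreal L * ennreal (\<bar>u (fst z)\<bar> powr (p - 1) * (m z * k z))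
          + ennreal L * ennreal (\<bar>u (snd z)\<bar> powr (p - 1) * (m z * k z))" for z
        unfolding R2_def using L0 k0[of z] m0[of z]
        by (subst ennreal_plus) (auto simp: ennreal_mult)
      then show ?thesis
        by (simp add: nn_integral_add nn_integral_cmult)
    qed
    ultimately show ?thesis by (simp add: ennreal_mult_less_top)
  qed
  have bound: "\<bar>form_density s p u (\<phi> n) z\<bar> \<le> \<bar>\<phi> n (fst z) - \<phi> n (snd z)\<bar> powr p * k z + (R1 z + R2 z)" for n z
  proof -
    define x y where "x = fst z" and "y = snd z"
    have z: "z = (x, y)" by (simp add: x_def y_def)
    have abs_eq: "\<bar>form_density s p u (\<phi> n) z\<bar> = \<bar>u x - u y\<bar> powr (p - 1) * \<bar>\<phi> n x - \<phi> n y\<bar> * k z"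
      by (simp add: form_density_def abs_mult abs_pflux k_def a_def x_def y_def)
    have P0: "0 \<le> \<bar>\<phi> n x - \<phi> n y\<bar> powr p * k z" using k0 by simp
    consider "x \<in> K3" "y \<in> K3" | "x \<notin> K2" "y \<notin> K2" | "\<delta> \<le> norm (x - y)"
      using sep K3(2) by (metis norm_minus_commute subsetD)
    then show ?thesis
    proof cases
      case 1
      then have "R1 z = \<bar>u x - u y\<bar> powr p * k z" by (simp add: R1_def z)
      moreover have "\<bar>u x - u y\<bar> powr (p - 1) * \<bar>\<phi> n x - \<phi> n y\<bar> * k z
          \<le> (\<bar>u x - u y\<bar> powr p + \<bar>\<phi> n x - \<phi> n y\<bar> powr p) * k z"
        using p k0 by (intro mult_right_mono powr_pred_mult_le) auto
      ultimately show ?thesis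
        using R0(2)[of z] unfolding abs_eq by (simp add: distrib_right z)
    next
      case 2
      then show ?thesis using R0[of z] k0[of z] unfolding abs_eq by (simp add: \<phi>_02)
    next
      case 3
      then have "m z = 1" using \<delta> by (simp add: m_def z min_def)
      then have R2_eq: "R2 z = 2 powr (p - 1) * (\<bar>u x\<bar> powr (p - 1) + \<bar>u y\<bar> powr (p - 1)) * (2 * B) * k z"
        by (simp add: R2_def L_def z algebra_simps)
      have "\<bar>u x - u y\<bar> powr (p - 1) \<le> (\<bar>u x\<bar> + \<bar>u y\<bar>) powr (p - 1)"
        using p by (intro powr_mono2) auto
      also have "\<dots> \<le> 2 powr (p - 1) * (\<bar>u x\<bar> powr (p - 1) + \<bar>u y\<bar> powr (p - 1))"
        using p by (intro powr_add_le) auto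
      finally have "\<bar>u x - u y\<bar> powr (p - 1) * \<bar>\<phi> n x - \<phi> n y\<bar> * k z \<le> R2 z"
        unfolding R2_eq using \<phi>_B[of n x] \<phi>_B[of n y] k0[of z]
        by (intro mult_right_mono mult_mono) auto
      then show ?thesis using P0 R0(1)[of z] abs_eq by (simp add: z)
    qed
  qed
  have lim_pair: "AE z in lborel. (\<lambda>n. \<phi> n (fst z)) \<longlonglongrightarrow> \<psi> (fst z) \<and> (\<lambda>n. \<phi> n (snd z)) \<longlonglongrightarrow> \<psi> (snd z)"
    using lim by (rule AE_lborel_fst_snd)
  \<comment> \<open>\<open>g\<close> is integrable only on compact subsets; the common set
    \<open>K2\<close> provides the majorant.\<close>
  have c_lim: "(\<lambda>n. LINT x:\<Omega>|lebesgue. g x * \<phi> n x) \<longlonglongrightarrow> (LINT x:\<Omega>|lebesgue. g x * \<psi> x)"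
  proof -
    have gK: "integrable lebesgue (\<lambda>x. indicator K2 x *\<^sub>R g x)"
      using g[OF K2] by (simp add: set_integrable_def)
    have eq: "indicator \<Omega> x *\<^sub>R (g x * w x) = (indicator K2 x *\<^sub>R g x) * w x"
      if "\<And>x. x \<notin> K2 \<Longrightarrow> w x = 0" for w :: "'a \<Rightarrow> real" and x
      using that K2(2) by (cases "x \<in> K2") (auto simp: indicator_def)
    have [measurable]: "\<phi> n \<in> borel_measurable lebesgue" "\<psi> \<in> borel_measurable lebesgue" for n
      by (auto intro!: measurable_completion)
    have [measurable]: "(\<lambda>x. indicator K2 x *\<^sub>R g x) \<in> borel_measurable lebesgue"
      using gK by (rule borel_measurable_integrable)
    have "(\<lambda>n. \<integral>x. (indicator K2 x *\<^sub>R g x) * \<phi> n x \<partial>lebesgue) \<longlonglongrightarrow> (\<integral>x. (indicator K2 x *\<^sub>R g x) * \<psi> x \<partial>lebesgue)"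
    proof (rule integral_dominated_convergence)
      show "integrable lebesgue (\<lambda>x. \<bar>indicator K2 x *\<^sub>R g x\<bar> * B)"
        using gK by (intro integrable_mult_left integrable_abs)
      show "AE x in lebesgue. (\<lambda>n. (indicator K2 x *\<^sub>R g x) * \<phi> n x) \<longlonglongrightarrow> (indicator K2 x *\<^sub>R g x) * \<psi> x"
        using lim[THEN AE_completion] by eventually_elim (intro tendsto_intros)
      show "AE x in lebesgue. norm ((indicator K2 x *\<^sub>R g x) * \<phi> n x) \<le> \<bar>indicator K2 x *\<^sub>R g x\<bar> * B" for n
        unfolding real_norm_def abs_mult[where b = "\<phi> n x" for x]
        by (intro AE_I2 mult_left_mono \<phi>_B) auto
    qed measurable
    moreover have "\<psi> x = 0" if "x \<notin> K2" for x using that K(3) by (simp add: K2_def)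
    then have "indicator \<Omega> x *\<^sub>R (g x * \<psi> x) = (indicator K2 x *\<^sub>R g x) * \<psi> x" for x by (rule eq)
    moreover have "indicator \<Omega> x *\<^sub>R (g x * \<phi> n x) = (indicator K2 x *\<^sub>R g x) * \<phi> n x" for n x
      using \<phi>_02 by (rule eq)
    ultimately show ?thesis unfolding set_lebesgue_integral_def by (simp only:)
  qed
  show ?thesis
  proof (rule fatou_generalized[where R = "\<lambda>z. R1 z + R2 z"
        and a = "\<lambda>n z. \<bar>\<phi> n (fst z) - \<phi> n (snd z)\<bar> powr p * k z"
        and a' = "\<lambda>z. \<bar>\<psi> (fst z) - \<psi> (snd z)\<bar> powr p * k z", OF weak[OF test] c_lim])
    show "AE z in lborel. (\<lambda>n. form_density s p u (\<phi> n) z) \<longlonglongrightarrow> form_density s p u \<psi> z"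
      using lim_pair
    proof eventually_elim
      case (elim z)
      then show ?case unfolding form_density_def divide_inverse by (intro tendsto_intros) auto
    qed
    show "AE z in lborel. (\<lambda>n. \<bar>\<phi> n (fst z) - \<phi> n (snd z)\<bar> powr p * k z) \<longlonglongrightarrow> \<bar>\<psi> (fst z) - \<psi> (snd z)\<bar> powr p * k z"
      using lim_pair
    proof eventually_elim
      case (elim z)
      then show ?case using p by (intro tendsto_mult tendsto_powr2 tendsto_intros) auto
    qed
    have E_eq: "(\<integral>\<^sup>+z. ennreal (\<bar>w (fst z) - w (snd z)\<bar> powr p * k z) \<partial>lborel) = gagliardo_energy s p w" for w
      by (simp add: gagliardo_energy_def k_def a_def)
    show "(\<integral>\<^sup>+z. ennreal (\<bar>\<phi> n (fst z) - \<phi> n (snd z)\<bar> powr p * k z) \<partial>lborel)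
        \<le> (\<integral>\<^sup>+z. ennreal (\<bar>\<psi> (fst z) - \<psi> (snd z)\<bar> powr p * k z) \<partial>lborel)" for n
      unfolding E_eq by (rule \<phi>_E)
    show "(\<integral>\<^sup>+z. ennreal (\<bar>\<psi> (fst z) - \<psi> (snd z)\<bar> powr p * k z) \<partial>lborel) < \<infinity>"
      unfolding E_eq by (rule energy)
    have "(\<integral>\<^sup>+z. ennreal (R1 z + R2 z) \<partial>lborel) = (\<integral>\<^sup>+z. ennreal (R1 z) \<partial>lborel) + (\<integral>\<^sup>+z. ennreal (R2 z) \<partial>lborel)"
      using R0 by (simp add: nn_integral_add)
    then show "(\<integral>\<^sup>+z. ennreal (R1 z + R2 z) \<partial>lborel) < \<infinity>"
      using R1_fin R2_fin by simp
    show "AE z in lborel. \<bar>form_density s p u (\<phi> n) z\<bar> \<le> \<bar>\<phi> n (fst z) - \<phi> n (snd z)\<bar> powr p * k z + (R1 z + R2 z)" for n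
      by (intro AE_I2 bound)
    show "form_density s p u \<psi> \<in> borel_measurable lborel"
      unfolding form_density_def[abs_def] by measurable
  qed (use k0 R0 in auto)
qed

section \<open>Comparison\<close>

text \<open>The point is independence of \<open>n\<close>. The cutoff is 0 up to 1/n and 1 from 2/n
  on, with Lipschitz constant n. If n b <= 4 this constant is at most 4/b. If n b > 4, either a is
  within b/4 of b and both cutoffs have saturated at 1, or |a - b| >= b/4 and the trivial bound 1 is
  enough.\<close>

lemma cutoff_diff_bound:
  fixes a b n :: real
  assumes "0 \<le> a" "0 < b" "0 \<le> n"
  shows "\<bar>min 1 (max 0 (n * a - 1)) - min 1 (max 0 (n * b - 1))\<bar> \<le> min 1 (4 * \<bar>a - b\<bar> / b)"
proof -
  have le1: "\<bar>min 1 (max 0 (n * a - 1)) - min 1 (max 0 (n * b - 1))\<bar> \<le> 1" by auto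
  have lip: "\<bar>min 1 (max 0 (n * a - 1)) - min 1 (max 0 (n * b - 1))\<bar> \<le> n * \<bar>a - b\<bar>"
  proof -
    have "\<bar>min 1 (max 0 (n * a - 1)) - min 1 (max 0 (n * b - 1))\<bar> \<le> \<bar>n * a - n * b\<bar>" by auto
    also have "\<dots> = n * \<bar>a - b\<bar>"
      using assms(3) by (simp add: right_diff_distrib[symmetric] abs_mult)
    finally show ?thesis .
  qed
  consider "b \<le> 4 * \<bar>a - b\<bar>" | "n * b \<le> 4" | "4 * \<bar>a - b\<bar> < b" "4 < n * b" by linarith
  then show ?thesis
  proof cases
    case 1
    then have "1 \<le> 4 * \<bar>a - b\<bar> / b" using assms(2) by simp
    then show ?thesis using le1 by simp
  next
    case 2
    then have "n \<le> 4 / b" using assms(2) by (simp add: field_simps)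
    then have "n * \<bar>a - b\<bar> \<le> 4 / b * \<bar>a - b\<bar>" by (intro mult_right_mono) auto
    then show ?thesis using lip le1 by simp
  next
    case 3
    then have "\<bar>a - b\<bar> < b / 4" by simp
    then have "3 / 4 * b \<le> a" unfolding abs_less_iff by linarith
    then have "n * (3 / 4 * b) \<le> n * a" using assms(3) by (rule mult_left_mono)
    then have "2 \<le> n * a" "2 \<le> n * b" using 3(2) by simp_all
    then show ?thesis using assms(2) by simp
  qed
qed

text \<open>For \<open>\<gamma> > 1\<close> only a power \<open>u\<^sup>\<beta>\<close> has finite energy; away from small values it controls \<open>u\<close> itself.\<close>

lemma abs_diff_le_powr_diff:
  fixes a b \<beta> \<epsilon> :: real
  assumes "0 \<le> a" "0 \<le> b" "1 \<le> \<beta>" "0 < \<epsilon>" "\<epsilon> \<le> max a b"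
  shows "\<bar>a - b\<bar> \<le> \<epsilon> powr (1 - \<beta>) * \<bar>a powr \<beta> - b powr \<beta>\<bar>"
proof -
  \<comment> \<open>For b <= a one has a^\<beta> - b^\<beta> >= a^(\<beta>-1) (a - b), and a >=
    \<epsilon> bounds the factor below by \<epsilon>^(\<beta>-1).\<close>
  have *: "a - b \<le> \<epsilon> powr (1 - \<beta>) * (a powr \<beta> - b powr \<beta>)"
    if "0 \<le> b" "b \<le> a" "\<epsilon> \<le> a" for a b
  proof -
    have a: "0 < a" using that assms(4) by linarith
    have "b powr \<beta> = b powr (\<beta> - 1) * b" using that by (cases "b = 0") (auto simp: powr_diff)
    also have "\<dots> \<le> a powr (\<beta> - 1) * b"
      using that assms(3) by (intro mult_right_mono powr_mono2) auto
    finally have "a powr (\<beta> - 1) * (a - b) \<le> a powr \<beta> - b powr \<beta>"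
      using a by (simp add: right_diff_distrib powr_diff)
    then have "\<epsilon> powr (1 - \<beta>) * (a powr (\<beta> - 1) * (a - b)) \<le> \<epsilon> powr (1 - \<beta>) * (a powr \<beta> - b powr \<beta>)"
      by (intro mult_left_mono) auto
    moreover have "\<epsilon> powr (\<beta> - 1) * (a - b) \<le> a powr (\<beta> - 1) * (a - b)"
      using that assms by (intro mult_right_mono powr_mono2) auto
    then have "\<epsilon> powr (1 - \<beta>) * (\<epsilon> powr (\<beta> - 1) * (a - b)) \<le> \<epsilon> powr (1 - \<beta>) * (a powr (\<beta> - 1) * (a - b))"
      by (intro mult_left_mono) auto
    moreover have "\<epsilon> powr (1 - \<beta>) * (\<epsilon> powr (\<beta> - 1) * (a - b)) = a - b"
      using assms(4) by (simp add: mult.assoc[symmetric] powr_add[symmetric])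
    ultimately show ?thesis by linarith
  qed
  show ?thesis
  proof (cases "b \<le> a")
    case True
    then have "b powr \<beta> \<le> a powr \<beta>" using assms by (intro powr_mono2) auto
    then show ?thesis using *[of b a] True assms by simp
  next
    case False
    then have "a powr \<beta> \<le> b powr \<beta>" using assms by (intro powr_mono2) auto
    then show ?thesis using *[of a b] False assms by (simp add: abs_minus_commute)
  qed
qed

definition unit_clamp :: "real \<Rightarrow> real" where
  "unit_clamp t = min (max t 0) 1"

lemma unit_clamp_bounds: "0 \<le> unit_clamp t" "unit_clamp t \<le> 1"
  by (auto simp: unit_clamp_def)

lemma unit_clamp_eq_0: "t \<le> 0 \<Longrightarrow> unit_clamp t = 0"
  by (simp add: unit_clamp_def)

lemma unit_clamp_mono: "a \<le> b \<Longrightarrow> unit_clamp a \<le> unit_clamp b"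
  by (auto simp: unit_clamp_def)

text \<open>Clamping acts on differences as a factor in [0,1], so the lower bound for the product
  with \<open>C - B\<close> carries over to the clamped test function.\<close>

lemma unit_clamp_diff:
  obtains \<theta> where "0 \<le> \<theta>" "\<theta> \<le> 1" "unit_clamp a - unit_clamp b = \<theta> * (a - b)"
proof
  let ?\<theta> = "if a = b then 0 else (unit_clamp a - unit_clamp b) / (a - b)"
  show "0 \<le> ?\<theta>"
    using unit_clamp_mono[of a b] unit_clamp_mono[of b a] by (auto simp: divide_simps)
  show "?\<theta> \<le> 1"
    by (auto simp: divide_simps unit_clamp_def)
  show "unit_clamp a - unit_clamp b = ?\<theta> * (a - b)" by simp
qed

lemma unit_clamp_lipschitz: "\<bar>unit_clamp a - unit_clamp b\<bar> \<le> \<bar>a - b\<bar>"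
  by (auto simp: unit_clamp_def)

lemma unit_clamp_measurable [measurable]: "unit_clamp \<in> borel_measurable borel"
  unfolding unit_clamp_def[abs_def] by measurable

text \<open>\<open>v\<close> has energy only on compact subsets, and this is used for pairs in
  \<open>K3\<close>. Any other pair that contributes has one point in \<open>K\<close> and distance
  at least \<open>\<delta>\<close>; there the clamp bounds the difference by 1, and the finite
  measure of \<open>K\<close> makes the total finite.\<close>

lemma gagliardo_energy_clamp_finite:
  fixes \<phi> v :: "'a::euclidean_space \<Rightarrow> real" and s p :: real
  assumes s: "0 < s" "s < 1" and p: "1 < p" and \<Omega>: "open \<Omega>"
    and [measurable]: "\<phi> \<in> borel_measurable borel" "v \<in> borel_measurable borel"
    and loc: "\<And>K. compact K \<Longrightarrow> K \<subseteq> \<Omega> \<Longrightarrow> (\<integral>\<^sup>+z. ennreal (\<bar>v (fst z) - v (snd z)\<bar> powr p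
        / norm (fst z - snd z) powr (real DIM('a) + s * p)) * indicator (K \<times> K) z \<partial>lborel) < \<infinity>"
    and energy: "gagliardo_energy s p \<phi> < \<infinity>"
    and K: "compact K" "K \<subseteq> \<Omega>" "\<And>x. x \<notin> K \<Longrightarrow> unit_clamp (\<phi> x - v x) = 0"
  shows "gagliardo_energy s p (\<lambda>x. unit_clamp (\<phi> x - v x)) < \<infinity>"
proof -
  define a where "a = real DIM('a) + s * p"
  define \<psi> where "\<psi> x = unit_clamp (\<phi> x - v x)" for x
  obtain \<delta> K3 where \<delta>: "0 < \<delta>" and K3: "compact K3" "K \<subseteq> K3" "K3 \<subseteq> \<Omega>"
    and sep: "\<And>x y. x \<in> K \<Longrightarrow> y \<notin> K3 \<Longrightarrow> \<delta> \<le> norm (x - y)"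
    by (rule compact_neighbourhood[OF K(1) \<Omega> K(2)]) (rule that; assumption)
  define k where "k z = 1 / norm (fst z - snd z) powr a" for z :: "'a \<times> 'a"
  define m where "m z = min 1 (norm (fst z - snd z) / \<delta>) powr p" for z :: "'a \<times> 'a"
  have k0: "0 \<le> k z" and m0: "0 \<le> m z" for z by (simp_all add: k_def m_def)
  have [measurable]: "k \<in> borel_measurable borel" "m \<in> borel_measurable borel"
    unfolding k_def[abs_def] m_def[abs_def] by measurable
  have [measurable]: "K3 \<times> K3 \<in> sets borel" "K \<in> sets borel"
    using K3(1) K(1) by (auto intro!: borel_compact compact_Times)
  define P where "P w z = ennreal (\<bar>w (fst z) - w (snd z)\<bar> powr p * k z)" for w :: "'a \<Rightarrow> real" and z
  have [measurable]: "P w \<in> borel_measurable borel" if [measurable]: "w \<in> borel_measurable borel" for w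
    unfolding P_def[abs_def] by measurable
  define T where "T h z = ennreal (h z * (m z * k z))" for h :: "'a \<times> 'a \<Rightarrow> real" and z
  have [measurable]: "T h \<in> borel_measurable borel" if [measurable]: "h \<in> borel_measurable borel" for h
    unfolding T_def[abs_def] by measurable
  let ?f = "\<lambda>z. indicator K (fst z) :: real" and ?s = "\<lambda>z. indicator K (snd z) :: real"
  have bound: "P \<psi> z \<le> ennreal (2 powr p) * (P \<phi> z + P v z * indicator (K3 \<times> K3) z) + (T ?f z + T ?s z)" for z
  proof -
    define x y where "x = fst z" and "y = snd z"
    have z: "z = (x, y)" by (simp add: x_def y_def)
    consider "x \<in> K3" "y \<in> K3" | "x \<notin> K" "y \<notin> K" | "\<delta> \<le> norm (x - y)" "x \<in> K \<or> y \<in> K"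
      using sep K3(2) by (metis norm_minus_commute subsetD)
    then show ?thesis
    proof cases
      case 1
      have "\<bar>\<psi> x - \<psi> y\<bar> powr p \<le> (\<bar>\<phi> x - \<phi> y\<bar> + \<bar>v x - v y\<bar>) powr p"
        using p unit_clamp_lipschitz[of "\<phi> x - v x" "\<phi> y - v y"]
        by (intro powr_mono2) (auto simp: \<psi>_def)
      also have "\<dots> \<le> 2 powr p * (\<bar>\<phi> x - \<phi> y\<bar> powr p + \<bar>v x - v y\<bar> powr p)"
        using p by (intro powr_add_le) auto
      finally have "\<bar>\<psi> x - \<psi> y\<bar> powr p * k z \<le> 2 powr p * (\<bar>\<phi> x - \<phi> y\<bar> powr p + \<bar>v x - v y\<bar> powr p) * k z"
        using k0 by (rule mult_right_mono)
      then have "\<bar>\<psi> x - \<psi> y\<bar> powr p * k z \<le> 2 powr p * (\<bar>\<phi> x - \<phi> y\<bar> powr p * k z + \<bar>v x - v y\<bar> powr p * k z)"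
        by (simp only: distrib_left distrib_right mult.assoc)
      then have "P \<psi> z \<le> ennreal (2 powr p * (\<bar>\<phi> x - \<phi> y\<bar> powr p * k z + \<bar>v x - v y\<bar> powr p * k z))"
        unfolding P_def x_def y_def by (rule ennreal_leI)
      also have "\<dots> = ennreal (2 powr p) * (P \<phi> z + P v z)"
        using k0 by (simp add: P_def x_def y_def ennreal_mult' ennreal_plus)
      finally show ?thesis using 1 by (simp add: z add_increasing2)
    next
      case 2
      then have "\<psi> x = 0" "\<psi> y = 0" using K(3) by (auto simp: \<psi>_def)
      then show ?thesis by (simp add: P_def z)
    next
      case 3
      have "m z = 1" using 3(1) \<delta> by (simp add: m_def z min_def)
      moreover have "\<bar>\<psi> x - \<psi> y\<bar> powr p \<le> 1 powr p"
        using p unit_clamp_bounds[of "\<phi> x - v x"] unit_clamp_bounds[of "\<phi> y - v y"]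
        by (intro powr_mono2) (auto simp: \<psi>_def abs_le_iff)
      then have "\<bar>\<psi> x - \<psi> y\<bar> powr p * k z \<le> 1 * k z" using k0 by (intro mult_right_mono) auto
      ultimately have "P \<psi> z \<le> ennreal (m z * k z)"
        unfolding P_def by (intro ennreal_leI) (simp add: z)
      also have "\<dots> \<le> T ?f z + T ?s z"
        using 3(2) by (auto simp: T_def z add_increasing add_increasing2)
      also have "\<dots> \<le> ennreal (2 powr p) * (P \<phi> z + P v z * indicator (K3 \<times> K3) z) + (T ?f z + T ?s z)"
        by (simp add: add_increasing)
      finally show ?thesis .
    qed
  qed
  have fin_K: "(\<integral>\<^sup>+y. ennreal (indicator K y * \<delta> powr - (s * p)) \<partial>lborel) < \<infinity>"
  proof -
    have "(\<integral>\<^sup>+y. ennreal (indicator K y * \<delta> powr - (s * p)) \<partial>lborel)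
        = (\<integral>\<^sup>+y. ennreal (\<delta> powr - (s * p)) * indicator K y \<partial>lborel)"
      by (intro nn_integral_cong) (auto simp: indicator_def)
    also have "\<dots> = ennreal (\<delta> powr - (s * p)) * emeasure lborel K"
      by (rule nn_integral_cmult_indicator) simp
    also have "\<dots> < \<infinity>"
      using emeasure_bounded_finite[OF compact_imp_bounded[OF K(1)]] by (simp add: ennreal_mult_less_top)
    finally show ?thesis .
  qed
  note wk = nn_integral_weighted_kernel[OF s p, of "indicator K" "\<lambda>_. \<delta>", OF _ _ _ _ fin_K]
  have T_fin: "(\<integral>\<^sup>+z. T ?f z \<partial>lborel) < \<infinity>" "(\<integral>\<^sup>+z. T ?s z \<partial>lborel) < \<infinity>"
    using wk \<delta> by (simp_all add: T_def m_def k_def a_def)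
  have P_\<phi>: "(\<integral>\<^sup>+z. P \<phi> z \<partial>lborel) < \<infinity>"
    using energy by (simp add: P_def k_def a_def gagliardo_energy_def)
  have P_v: "(\<integral>\<^sup>+z. P v z * indicator (K3 \<times> K3) z \<partial>lborel) < \<infinity>"
    using loc[OF K3(1,3)] by (simp add: P_def k_def a_def)
  have [measurable]: "\<psi> \<in> borel_measurable borel" unfolding \<psi>_def[abs_def] by measurable
  have "gagliardo_energy s p \<psi> = (\<integral>\<^sup>+z. P \<psi> z \<partial>lborel)"
    by (simp add: P_def k_def a_def gagliardo_energy_def)
  also have "\<dots> \<le> (\<integral>\<^sup>+z. ennreal (2 powr p) * (P \<phi> z + P v z * indicator (K3 \<times> K3) z) + (T ?f z + T ?s z) \<partial>lborel)"
    by (intro nn_integral_mono bound)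
  also have "\<dots> = ennreal (2 powr p) * ((\<integral>\<^sup>+z. P \<phi> z \<partial>lborel) + (\<integral>\<^sup>+z. P v z * indicator (K3 \<times> K3) z \<partial>lborel))
      + ((\<integral>\<^sup>+z. T ?f z \<partial>lborel) + (\<integral>\<^sup>+z. T ?s z \<partial>lborel))"
    by (simp add: nn_integral_add nn_integral_cmult)
  also have "\<dots> < \<infinity>" using T_fin P_\<phi> P_v by (simp add: ennreal_mult_less_top)
  finally show ?thesis by (simp add: \<psi>_def[abs_def])
qed

section \<open>Comparison of two solutions\<close>

text \<open>Sign conditions hold at every point and all pair integrals are taken against
  \<open>lborel\<close>, so the comparison can argue pointwise and use Fubini's theorem
  directly.\<close>

definition borel_solution ::
  "real \<Rightarrow> real \<Rightarrow> real \<Rightarrow> ('a::euclidean_space \<Rightarrow> real) \<Rightarrow> 'a set \<Rightarrow> ('a \<Rightarrow> real) \<Rightarrow> bool" where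
  "borel_solution s p \<gamma> f \<Omega> u \<longleftrightarrow> u \<in> borel_measurable borel \<and>
     (\<forall>x\<in>\<Omega>. 0 < u x) \<and> (\<forall>x. x \<notin> \<Omega> \<longrightarrow> u x = 0) \<and>
     (\<forall>K. compact K \<longrightarrow> K \<subseteq> \<Omega> \<longrightarrow> (\<integral>\<^sup>+z. ennreal (\<bar>u (fst z) - u (snd z)\<bar> powr p
        / norm (fst z - snd z) powr (real DIM('a) + s * p)) * indicator (K \<times> K) z \<partial>lborel) < \<infinity>) \<and>
     (\<integral>\<^sup>+x. ennreal (\<bar>u x\<bar> powr (p - 1)) \<partial>lborel) < \<infinity> \<and>
     (\<forall>K. compact K \<longrightarrow> K \<subseteq> \<Omega> \<longrightarrow> set_integrable lebesgue K (\<lambda>x. f x / u x powr \<gamma>)) \<and>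
     (\<forall>\<phi>. test_function \<Omega> \<phi> \<longrightarrow> has_bochner_integral lborel (form_density s p u \<phi>)
        (LINT x:\<Omega>|lebesgue. f x / u x powr \<gamma> * \<phi> x)) \<and>
     gagliardo_energy s p (\<lambda>x. u x powr max ((\<gamma> + p - 1) / p) 1) < \<infinity>"

lemma borel_solution_le_plus:
  fixes u v f :: "'a::euclidean_space \<Rightarrow> real" and s p \<gamma> \<epsilon> :: real
  assumes s: "0 < s" "s < 1" and p: "1 < p" and \<gamma>: "0 < \<gamma>" and \<epsilon>: "0 < \<epsilon>"
    and \<Omega>: "open \<Omega>" "bounded \<Omega>" "smooth_boundary \<Omega>"
    and f: "AE x in lebesgue. x \<in> \<Omega> \<longrightarrow> 0 \<le> f x"
    and sol: "borel_solution s p \<gamma> f \<Omega> u" "borel_solution s p \<gamma> f \<Omega> v"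
  shows "AE x in lborel. u x \<le> v x + \<epsilon>"
proof -
  have [measurable]: "u \<in> borel_measurable borel" "v \<in> borel_measurable borel"
    using sol by (auto simp: borel_solution_def)
  have u_pos: "0 < u x" and v_pos: "0 < v x" if "x \<in> \<Omega>" for x
    using sol that by (auto simp: borel_solution_def)
  have u_out: "u x = 0" and v_out: "v x = 0" if "x \<notin> \<Omega>" for x
    using sol that by (auto simp: borel_solution_def)
  have u0: "0 \<le> u x" and v0: "0 \<le> v x" for x
    using u_pos[of x] u_out[of x] v_pos[of x] v_out[of x] by (cases "x \<in> \<Omega>"; simp)+
  have sp: "0 < s * p" using s p by simp
  define \<beta> where "\<beta> = max ((\<gamma> + p - 1) / p) 1"
  have \<beta>: "1 \<le> \<beta>" by (simp add: \<beta>_def)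
  define W where "W x = u x powr \<beta>" for x
  have [measurable]: "W \<in> borel_measurable borel" unfolding W_def[abs_def] by measurable
  have W_energy: "gagliardo_energy s p W < \<infinity>"
    using sol(1) by (simp add: borel_solution_def W_def[abs_def] \<beta>_def)
  \<comment> \<open>The constant of \<open>abs_diff_le_powr_diff\<close> at threshold
    \<open>\<epsilon>\<close>; comparing \<open>u x\<close> with 0 in that lemma gives
    \<open>U x \<le> c * W x\<close>.\<close>
  define c where "c = \<epsilon> powr (1 - \<beta>)"
  have c0: "0 \<le> c" by (simp add: c_def)
  define a where "a = real DIM('a) + s * p"
  define k where "k z = 1 / norm (fst z - snd z) powr a" for z :: "'a \<times> 'a"
  have k0: "0 \<le> k z" for z by (simp add: k_def)
  have [measurable]: "k \<in> borel_measurable borel" unfolding k_def[abs_def] by measurable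
  define U where "U x = max (u x - \<epsilon>) 0" for x
  have [measurable]: "U \<in> borel_measurable borel" unfolding U_def[abs_def] by measurable
  have U0: "0 \<le> U x" for x by (simp add: U_def)
  have U_out: "U x = 0" if "x \<notin> \<Omega>" for x using u_out[OF that] \<epsilon> by (simp add: U_def)
  have U_le: "U x \<le> c * W x" for x
  proof (cases "\<epsilon> \<le> u x")
    case True
    then have "\<bar>u x - 0\<bar> \<le> \<epsilon> powr (1 - \<beta>) * \<bar>u x powr \<beta> - 0 powr \<beta>\<bar>"
      using \<beta> \<epsilon> u0 by (intro abs_diff_le_powr_diff) auto
    then show ?thesis using True \<epsilon> by (simp add: U_def W_def c_def)
  next
    case False
    then show ?thesis using c0 by (simp add: U_def W_def)
  qed
  define d where "d x = infdist x (- \<Omega>)" for x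
  have [measurable]: "d \<in> borel_measurable borel"
    unfolding d_def[abs_def] by (intro borel_measurable_continuous_onI continuous_intros)
  have d_pos: "0 < d x" if "x \<in> \<Omega>" for x
    unfolding d_def using infdist_Compl_pos[OF \<Omega>(1) bounded_Compl_nonempty[OF \<Omega>(2)] that] .
  have d_out: "d x = 0" if "x \<notin> \<Omega>" for x using that by (simp add: d_def)
  have d0: "0 \<le> d x" for x by (simp add: d_def infdist_nonneg)
  have d_lip: "\<bar>d x - d y\<bar> \<le> norm (x - y)" for x y
    unfolding d_def using infdist_triangle_abs[of x "- \<Omega>" y] by (simp add: dist_norm)

  \<comment> \<open>\<open>A\<close> dominates the differences of \<open>u\<close> on pairs where
    the larger value is at least \<open>\<epsilon>\<close>, and those of \<open>U\<close> on all
    pairs; \<open>T\<close> dominates the error of the cutoff, its scale \<open>d / 4\<close> coming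
    from \<open>cutoff_diff_bound\<close>. In \<open>G\<close> the 4 is that of
    \<open>pflux_product_lower_bound\<close> and \<open>2 powr p\<close> that of
    \<open>powr_add_le\<close>. None of them involves \<open>n\<close>.\<close>
  define A where "A z = c powr p * (\<bar>W (fst z) - W (snd z)\<bar> powr p * k z)" for z
  define T where "T z = U (snd z) powr p * (min 1 (norm (fst z - snd z) / (d (snd z) / 4)) powr p * k z)" for z
  define G where "G z = 4 * (A z + 2 powr p * (A z + T z))" for z
  have A0: "0 \<le> A z" and T0: "0 \<le> T z" for z using k0 by (simp_all add: A_def T_def)
  have [measurable]: "A \<in> borel_measurable borel" "T \<in> borel_measurable borel"
    unfolding A_def[abs_def] T_def[abs_def] by measurable
  have [measurable]: "G \<in> borel_measurable borel" unfolding G_def[abs_def] by measurable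
  have A_fin: "(\<integral>\<^sup>+z. ennreal (A z) \<partial>lborel) < \<infinity>"
  proof -
    have "ennreal (A z) = ennreal (c powr p) * ennreal (\<bar>W (fst z) - W (snd z)\<bar> powr p
        / norm (fst z - snd z) powr (real DIM('a) + s * p))" for z
      by (simp add: A_def k_def a_def ennreal_mult'[symmetric])
    then have "(\<integral>\<^sup>+z. ennreal (A z) \<partial>lborel) = ennreal (c powr p) * gagliardo_energy s p W"
      by (simp add: nn_integral_cmult gagliardo_energy_def)
    then show ?thesis using W_energy by (simp add: ennreal_mult_less_top)
  qed
  have T_fin: "(\<integral>\<^sup>+z. ennreal (T z) \<partial>lborel) < \<infinity>"
  proof -
    have W_out: "W x = 0" if "x \<notin> \<Omega>" for x using u_out[OF that] by (simp add: W_def)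
    \<comment> \<open>Applied to \<open>W\<close>, whose energy is finite by the definition of a
      solution, and passed on to \<open>U\<close> through \<open>U x \<le> c * W x\<close>.\<close>
    have hardy: "(\<integral>\<^sup>+x. ennreal (\<bar>W x\<bar> powr p * d x powr - (s * p)) \<partial>lborel) < \<infinity>"
      unfolding d_def using W_energy
      by (intro fractional_hardy[OF \<Omega> sp _ W_out]) (auto simp: gagliardo_energy_def lborel_prod)
    have pw: "ennreal (U y powr p * (d y / 4) powr - (s * p))
        \<le> ennreal (c powr p * 4 powr (s * p)) * ennreal (\<bar>W y\<bar> powr p * d y powr - (s * p))" for y
    proof -
      have "U y powr p \<le> (c * \<bar>W y\<bar>) powr p"
        using U_le[of y] U0[of y] p by (intro powr_mono2) (auto simp: W_def)
      then have "U y powr p \<le> c powr p * \<bar>W y\<bar> powr p" using c0 by (simp add: powr_mult)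
      then have "U y powr p * (d y / 4) powr - (s * p) \<le> c powr p * \<bar>W y\<bar> powr p * (d y / 4) powr - (s * p)"
        by (intro mult_right_mono) auto
      moreover have "(d y / 4) powr - (s * p) = d y powr - (s * p) * 4 powr (s * p)"
        using d0[of y] by (simp add: powr_divide powr_minus_divide)
      ultimately have "U y powr p * (d y / 4) powr - (s * p)
          \<le> (c powr p * 4 powr (s * p)) * (\<bar>W y\<bar> powr p * d y powr - (s * p))"
        by (simp only: mult_ac)
      then show ?thesis by (simp add: ennreal_mult'[symmetric] ennreal_leI)
    qed
    have "(\<integral>\<^sup>+y. ennreal (U y powr p * (d y / 4) powr - (s * p)) \<partial>lborel)
        \<le> (\<integral>\<^sup>+y. ennreal (c powr p * 4 powr (s * p)) * ennreal (\<bar>W y\<bar> powr p * d y powr - (s * p)) \<partial>lborel)"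
      by (intro nn_integral_mono pw)
    also have "\<dots> = ennreal (c powr p * 4 powr (s * p)) * (\<integral>\<^sup>+y. ennreal (\<bar>W y\<bar> powr p * d y powr - (s * p)) \<partial>lborel)"
      by (rule nn_integral_cmult) measurable
    also have "\<dots> < \<infinity>" using hardy by (simp add: ennreal_mult_less_top)
    finally have fin: "(\<integral>\<^sup>+y. ennreal (U y powr p * (d y / 4) powr - (s * p)) \<partial>lborel) < \<infinity>" .
    have pos: "0 < d y / 4" if "U y powr p \<noteq> 0" for y
    proof -
      have "y \<in> \<Omega>" using that U_out[of y] by auto
      then show ?thesis using d_pos by simp
    qed
    show ?thesis
      using nn_integral_weighted_kernel(2)[OF s p, of "\<lambda>y. U y powr p" "\<lambda>y. d y / 4", OF _ _ _ pos fin]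
      by (simp add: T_def k_def a_def)
  qed
  have G_fin: "(\<integral>\<^sup>+z. ennreal (G z) \<partial>lborel) < \<infinity>"
  proof -
    have "ennreal (G z) = ennreal 4 * (ennreal (A z) + ennreal (2 powr p) * (ennreal (A z) + ennreal (T z)))" for z
      using A0 T0 by (simp add: G_def ennreal_mult ennreal_plus)
    then show ?thesis
      using A_fin T_fin by (simp add: nn_integral_add nn_integral_cmult ennreal_mult_less_top)
  qed
  have G0: "0 \<le> G z" for z using A0[of z] T0[of z] by (simp add: G_def)

  have Du: "\<bar>u x - u y\<bar> powr p * k (x, y) \<le> A (x, y)" if "\<epsilon> \<le> max (u x) (u y)" for x y
  proof -
    have "\<bar>u x - u y\<bar> \<le> c * \<bar>W x - W y\<bar>"
      unfolding c_def W_def using that \<beta> \<epsilon> u0 by (intro abs_diff_le_powr_diff) auto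
    then have "\<bar>u x - u y\<bar> powr p \<le> (c * \<bar>W x - W y\<bar>) powr p" using p by (intro powr_mono2) auto
    also have "\<dots> = c powr p * \<bar>W x - W y\<bar> powr p" using c0 by (simp add: powr_mult)
    finally have "\<bar>u x - u y\<bar> powr p * k (x, y) \<le> c powr p * \<bar>W x - W y\<bar> powr p * k (x, y)"
      using k0 by (rule mult_right_mono)
    then show ?thesis by (simp add: A_def mult.assoc)
  qed
  have DU: "\<bar>U x - U y\<bar> powr p * k (x, y) \<le> A (x, y)" for x y
  proof (cases "\<epsilon> \<le> max (u x) (u y)")
    case True
    have "\<bar>U x - U y\<bar> powr p \<le> \<bar>u x - u y\<bar> powr p"
      using p by (intro powr_mono2) (auto simp: U_def)
    then have "\<bar>U x - U y\<bar> powr p * k (x, y) \<le> \<bar>u x - u y\<bar> powr p * k (x, y)"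
      using k0 by (rule mult_right_mono)
    also have "\<dots> \<le> A (x, y)" using True by (rule Du)
    finally show ?thesis .
  next
    case False
    then have "U x = 0" "U y = 0" by (auto simp: U_def)
    then show ?thesis using A0 by simp
  qed

  \<comment> \<open>Vanishes where d <= 1/(n+1) and equals 1 where d >= 2/(n+1).\<close>
  define \<eta> where "\<eta> n x = min 1 (max 0 (real (Suc n) * d x - 1))" for n x
  define \<phi> where "\<phi> n x = U x * \<eta> n x" for n x
  define \<psi> where "\<psi> n x = unit_clamp (\<phi> n x - v x)" for n x
  define \<psi>' where "\<psi>' x = unit_clamp (U x - v x)" for x
  have [measurable]: "\<phi> n \<in> borel_measurable borel" for n
    unfolding \<phi>_def[abs_def] \<eta>_def[abs_def] by measurable
  have [measurable]: "\<psi> n \<in> borel_measurable borel" for n unfolding \<psi>_def[abs_def] by measurable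
  have [measurable]: "\<psi>' \<in> borel_measurable borel" unfolding \<psi>'_def[abs_def] by measurable
  have \<eta>01: "0 \<le> \<eta> n x" "\<eta> n x \<le> 1" for n x by (auto simp: \<eta>_def)
  have \<phi>_le: "0 \<le> \<phi> n x" "\<phi> n x \<le> U x" for n x
    using U0[of x] \<eta>01[of n x] by (auto simp: \<phi>_def mult_left_le)
  have D\<phi>: "\<bar>\<phi> n x - \<phi> n y\<bar> powr p * k (x, y) \<le> 2 powr p * (A (x, y) + T (x, y))" for n x y
  proof -
    define r where "r = min 1 (norm (x - y) / (d y / 4))"
    have r0: "0 \<le> r" using d0[of y] by (simp add: r_def)
    have "U y * \<bar>\<eta> n x - \<eta> n y\<bar> \<le> U y * r"
    proof (cases "y \<in> \<Omega>")
      case True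
      have "\<bar>\<eta> n x - \<eta> n y\<bar> \<le> min 1 (4 * \<bar>d x - d y\<bar> / d y)"
        unfolding \<eta>_def using d0[of x] d_pos[OF True] by (intro cutoff_diff_bound) auto
      also have "\<dots> \<le> r"
        unfolding r_def using d_lip[of x y] d_pos[OF True] by (intro min.mono) (auto simp: field_simps)
      finally show ?thesis using U0 by (intro mult_left_mono)
    qed (simp add: U_out)
    moreover have "\<bar>\<eta> n x * (U x - U y)\<bar> \<le> \<bar>U x - U y\<bar>"
      using \<eta>01[of n x] by (simp add: abs_mult mult_left_le_one_le)
    \<comment> \<open>This order of the product rule attaches the cutoff difference to the value at
      \<open>y\<close>, matching \<open>T\<close>, whose weight and scale sit at the second
      point.\<close>
    moreover have "\<phi> n x - \<phi> n y = \<eta> n x * (U x - U y) + U y * (\<eta> n x - \<eta> n y)"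
      by (simp add: \<phi>_def algebra_simps)
    ultimately have "\<bar>\<phi> n x - \<phi> n y\<bar> \<le> \<bar>U x - U y\<bar> + U y * r"
      using U0[of y] abs_triangle_ineq[of "\<eta> n x * (U x - U y)" "U y * (\<eta> n x - \<eta> n y)"]
      by (simp add: abs_mult)
    then have "\<bar>\<phi> n x - \<phi> n y\<bar> powr p \<le> (\<bar>U x - U y\<bar> + U y * r) powr p"
      using p by (intro powr_mono2) auto
    also have "\<dots> \<le> 2 powr p * (\<bar>U x - U y\<bar> powr p + (U y * r) powr p)"
      using p U0 r0 by (intro powr_add_le) auto
    finally have "\<bar>\<phi> n x - \<phi> n y\<bar> powr p * k (x, y)
        \<le> 2 powr p * (\<bar>U x - U y\<bar> powr p + (U y * r) powr p) * k (x, y)"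
      using k0 by (rule mult_right_mono)
    also have "\<dots> = 2 powr p * (\<bar>U x - U y\<bar> powr p * k (x, y) + T (x, y))"
      using U0[of y] r0 by (simp add: T_def r_def powr_mult algebra_simps)
    also have "\<dots> \<le> 2 powr p * (A (x, y) + T (x, y))"
      using DU by (intro mult_left_mono add_right_mono) auto
    finally show ?thesis .
  qed
  have \<phi>_energy: "gagliardo_energy s p (\<phi> n) < \<infinity>" for n
  proof -
    have "gagliardo_energy s p (\<phi> n) \<le> (\<integral>\<^sup>+z. ennreal (G z) \<partial>lborel)"
      unfolding gagliardo_energy_def
    proof (intro nn_integral_mono ennreal_leI)
      fix z :: "'a \<times> 'a"
      have "\<bar>\<phi> n (fst z) - \<phi> n (snd z)\<bar> powr p * k z \<le> 2 powr p * (A z + T z)"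
        using D\<phi>[of n "fst z" "snd z"] by simp
      also have "\<dots> \<le> G z" using A0[of z] T0[of z] by (simp add: G_def)
      finally show "\<bar>\<phi> n (fst z) - \<phi> n (snd z)\<bar> powr p / norm (fst z - snd z) powr (real DIM('a) + s * p) \<le> G z"
        by (simp add: k_def a_def)
    qed
    then show ?thesis using G_fin by (rule le_less_trans)
  qed

  define K where "K n = {x. 1 / real (Suc n) \<le> d x}" for n
  have K_sub: "K n \<subseteq> \<Omega>" for n
  proof
    fix x assume "x \<in> K n"
    then have "d x \<noteq> 0" by (auto simp: K_def divide_le_0_iff)
    then show "x \<in> \<Omega>" using d_out by blast
  qed
  have K_compact: "compact (K n)" for n
  proof -
    have "closed (K n)"
      unfolding K_def d_def by (intro closed_Collect_le continuous_intros)
    then show ?thesis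
      using bounded_subset[OF \<Omega>(2) K_sub] by (simp add: compact_eq_bounded_closed)
  qed
  have \<psi>_out: "\<psi> n x = 0" if "x \<notin> K n" for n x
  proof -
    have "real (Suc n) * d x \<le> 1" using that by (simp add: K_def field_simps)
    then have "\<phi> n x = 0" by (simp add: \<phi>_def \<eta>_def)
    then show ?thesis using v0[of x] by (simp add: \<psi>_def unit_clamp_eq_0)
  qed
  have \<psi>_bounds: "0 \<le> \<psi> n x" "\<psi> n x \<le> 1" for n x
    unfolding \<psi>_def by (rule unit_clamp_bounds)+
  have \<psi>_abs: "\<bar>\<psi> n x\<bar> \<le> 1" for n x using \<psi>_bounds[of n x] by simp
  have \<psi>_energy: "gagliardo_energy s p (\<psi> n) < \<infinity>" for n
    unfolding \<psi>_def[abs_def]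
  proof (rule gagliardo_energy_clamp_finite[OF s p \<Omega>(1) _ _ _ \<phi>_energy K_compact K_sub])
    show "unit_clamp (\<phi> n x - v x) = 0" if "x \<notin> K n" for x
      using \<psi>_out[OF that] by (simp add: \<psi>_def)
  qed (use sol(2) in \<open>auto simp: borel_solution_def\<close>)
  have ext: "has_bochner_integral lborel (form_density s p w (\<psi> n)) (LINT x:\<Omega>|lebesgue. f x / w x powr \<gamma> * \<psi> n x)"
    if w: "borel_solution s p \<gamma> f \<Omega> w" for w n
    by (rule weak_form_extension[OF s p \<Omega>(1) _ _ _ _ _ _ \<psi>_abs K_compact K_sub \<psi>_out \<psi>_energy])
      (use w in \<open>auto simp: borel_solution_def\<close>)
  define H where "H \<zeta> z = (pflux p (u (fst z) - u (snd z)) - pflux p (v (fst z) - v (snd z))) * (\<zeta> (fst z) - \<zeta> (snd z)) * k z"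
    for \<zeta> :: "'a \<Rightarrow> real" and z
  have [measurable]: "H \<zeta> \<in> borel_measurable borel" if [measurable]: "\<zeta> \<in> borel_measurable borel" for \<zeta>
    unfolding H_def[abs_def] by measurable
  have H_int: "integrable lborel (H (\<psi> n))" and H_le: "integral\<^sup>L lborel (H (\<psi> n)) \<le> 0" for n
  proof -
    have H_eq: "H (\<psi> n) = (\<lambda>z. form_density s p u (\<psi> n) z - form_density s p v (\<psi> n) z)"
      by (simp add: fun_eq_iff H_def form_density_def k_def a_def left_diff_distrib diff_divide_distrib)
    have hb: "has_bochner_integral lborel (H (\<psi> n))
        ((LINT x:\<Omega>|lebesgue. f x / u x powr \<gamma> * \<psi> n x) - (LINT x:\<Omega>|lebesgue. f x / v x powr \<gamma> * \<psi> n x))"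
      unfolding H_eq by (intro has_bochner_integral_diff ext sol)
    then show "integrable lborel (H (\<psi> n))" by (rule integrable.intros)
    have int: "integrable lebesgue (\<lambda>x. indicator \<Omega> x *\<^sub>R (f x / w x powr \<gamma> * \<psi> n x))"
      if w: "borel_solution s p \<gamma> f \<Omega> w" for w
    proof -
      have 1: "integrable lebesgue (\<lambda>x. indicator (K n) x *\<^sub>R (f x / w x powr \<gamma>))"
        using w K_compact K_sub by (simp add: borel_solution_def set_integrable_def)
      have eq: "(\<lambda>x. indicator \<Omega> x *\<^sub>R (f x / w x powr \<gamma> * \<psi> n x))
          = (\<lambda>x. (indicator (K n) x *\<^sub>R (f x / w x powr \<gamma>)) * \<psi> n x)"
      proof
        fix x show "indicator \<Omega> x *\<^sub>R (f x / w x powr \<gamma> * \<psi> n x)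
          = (indicator (K n) x *\<^sub>R (f x / w x powr \<gamma>)) * \<psi> n x"
          using K_sub[of n] \<psi>_out[of x n] by (cases "x \<in> K n") (auto simp: indicator_def)
      qed
      have [measurable]: "\<psi> n \<in> borel_measurable lebesgue" by (intro measurable_completion) simp
      show ?thesis
        unfolding eq
      proof (rule Bochner_Integration.integrable_bound[OF 1])
        show "(\<lambda>x. (indicator (K n) x *\<^sub>R (f x / w x powr \<gamma>)) * \<psi> n x) \<in> borel_measurable lebesgue"
          using borel_measurable_integrable[OF 1] by measurable
        show "AE x in lebesgue. norm ((indicator (K n) x *\<^sub>R (f x / w x powr \<gamma>)) * \<psi> n x)
            \<le> norm (indicator (K n) x *\<^sub>R (f x / w x powr \<gamma>))"
          unfolding norm_mult[where y = "\<psi> n x" for x] using \<psi>_abs[of n] by (intro AE_I2 mult_left_le) auto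
      qed
    qed
    have "(LINT x:\<Omega>|lebesgue. f x / u x powr \<gamma> * \<psi> n x) \<le> (LINT x:\<Omega>|lebesgue. f x / v x powr \<gamma> * \<psi> n x)"
      unfolding set_lebesgue_integral_def
    proof (rule integral_mono_AE[OF int[OF sol(1)] int[OF sol(2)]])
      show "AE x in lebesgue. indicator \<Omega> x *\<^sub>R (f x / u x powr \<gamma> * \<psi> n x) \<le> indicator \<Omega> x *\<^sub>R (f x / v x powr \<gamma> * \<psi> n x)"
        using f
      proof eventually_elim
        case (elim x)
        show ?case
        proof (cases "x \<in> \<Omega> \<and> \<psi> n x \<noteq> 0")
          case True
          then have "v x \<le> \<phi> n x" unfolding \<psi>_def using unit_clamp_eq_0[of "\<phi> n x - v x"] by force
          also have "\<dots> \<le> u x" using \<phi>_le(2)[of n x] \<epsilon> u0[of x] by (simp add: U_def)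
          finally have "v x powr \<gamma> \<le> u x powr \<gamma>" using v0 \<gamma> by (intro powr_mono2) auto
          then have "f x / u x powr \<gamma> \<le> f x / v x powr \<gamma>"
            using elim True u_pos[of x] v_pos[of x] by (intro divide_left_mono mult_pos_pos) auto
          then have "f x / u x powr \<gamma> * \<psi> n x \<le> f x / v x powr \<gamma> * \<psi> n x"
            using \<psi>_bounds(1) by (rule mult_right_mono)
          then show ?thesis using True by simp
        qed auto
      qed
    qed
    then show "integral\<^sup>L lborel (H (\<psi> n)) \<le> 0"
      using has_bochner_integral_integral_eq[OF hb] by simp
  qed

  have H_lower: "0 \<le> H (\<psi> n) z + G z" for n z
  proof -
    define x y where "x = fst z" and "y = snd z"
    have z: "z = (x, y)" by (simp add: x_def y_def)
    let ?A = "u x - u y" and ?B = "v x - v y" and ?C = "\<phi> n x - \<phi> n y"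
    obtain \<theta> where \<theta>: "0 \<le> \<theta>" "\<theta> \<le> 1"
      "\<psi> n x - \<psi> n y = \<theta> * ((\<phi> n x - v x) - (\<phi> n y - v y))"
      unfolding \<psi>_def by (rule unit_clamp_diff)
    show ?thesis
    proof (cases "\<psi> n x = 0 \<and> \<psi> n y = 0")
      case True
      then show ?thesis using G0 by (simp add: H_def z)
    next
      case False
      \<comment> \<open>If \<open>\<psi> n\<close> is nonzero at one of the points, then
        \<open>\<phi> n\<close> exceeds \<open>v\<close>, hence 0, there, which forces
        \<open>U\<close> to be positive.\<close>
      have "\<epsilon> \<le> max (u x) (u y)"
      proof (rule ccontr)
        assume "\<not> ?thesis"
        then have "U x = 0" "U y = 0" by (auto simp: U_def)
        then have "\<phi> n x = 0" "\<phi> n y = 0" by (auto simp: \<phi>_def)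
        then show False using False v0[of x] v0[of y] by (auto simp: \<psi>_def unit_clamp_eq_0)
      qed
      then have Au: "\<bar>?A\<bar> powr p * k z \<le> A z" using Du by (simp add: z)
      have "- (4 * (\<bar>?A\<bar> powr p + \<bar>?C\<bar> powr p)) \<le> (pflux p ?A - pflux p ?B) * (?C - ?B)"
        using p by (rule pflux_product_lower_bound)
      then have "\<theta> * k z * - (4 * (\<bar>?A\<bar> powr p + \<bar>?C\<bar> powr p)) \<le> \<theta> * k z * ((pflux p ?A - pflux p ?B) * (?C - ?B))"
        using \<theta> k0 by (intro mult_left_mono) auto
      also have "\<dots> = H (\<psi> n) z"
        unfolding H_def z fst_conv snd_conv \<theta>(3) by (simp add: algebra_simps)
      finally have lower: "- (\<theta> * (4 * (\<bar>?A\<bar> powr p * k z + \<bar>?C\<bar> powr p * k z))) \<le> H (\<psi> n) z"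
        by (simp add: algebra_simps)
      have "\<theta> * (4 * (\<bar>?A\<bar> powr p * k z + \<bar>?C\<bar> powr p * k z)) \<le> 1 * (4 * (\<bar>?A\<bar> powr p * k z + \<bar>?C\<bar> powr p * k z))"
        using \<theta> k0 by (intro mult_right_mono) auto
      also have "\<dots> \<le> G z" using Au D\<phi>[of n x y] by (simp add: G_def z)
      finally show ?thesis using lower by linarith
    qed
  qed
  have \<psi>_lim: "(\<lambda>n. \<psi> n x) \<longlonglongrightarrow> \<psi>' x" for x
  proof (cases "x \<in> \<Omega>")
    case True
    obtain N :: nat where N: "2 / d x < real N" using reals_Archimedean2 by blast
    have "\<psi> n x = \<psi>' x" if "N \<le> n" for n
    proof -
      have "2 / d x \<le> real (Suc n)" using N that by linarith
      then have "2 \<le> real (Suc n) * d x" using d_pos[OF True] by (simp only: pos_divide_le_eq)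
      then have "\<eta> n x = 1" by (simp add: \<eta>_def)
      then show ?thesis by (simp add: \<psi>_def \<psi>'_def \<phi>_def)
    qed
    then show ?thesis by (intro tendsto_eventually) (auto simp: eventually_sequentially)
  next
    case False
    then show ?thesis using U_out[OF False] by (simp add: \<psi>_def \<psi>'_def \<phi>_def)
  qed
  \<comment> \<open>Where u <= \<epsilon> both arguments are at most -v <= 0, so under the clamp the
    positive part in \<open>U\<close> leaves no trace. In this form monotonicity in u - v is
    visible.\<close>
  have \<psi>'_eq: "\<psi>' x = unit_clamp (u x - v x - \<epsilon>)" for x
    using v0[of x] by (auto simp: \<psi>'_def U_def unit_clamp_def)
  have H_nonneg: "0 \<le> H \<psi>' z" for z
  proof -
    define x y where "x = fst z" and "y = snd z"
    have "0 \<le> (pflux p (u x - u y) - pflux p (v x - v y)) * (\<psi>' x - \<psi>' y)"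
    proof (cases "v x - v y \<le> u x - u y")
      case True
      then have "\<psi>' y \<le> \<psi>' x" unfolding \<psi>'_eq by (intro unit_clamp_mono) auto
      then show ?thesis using pflux_mono[OF p True] by simp
    next
      case False
      then have "\<psi>' x \<le> \<psi>' y" unfolding \<psi>'_eq by (intro unit_clamp_mono) auto
      then show ?thesis using pflux_mono[OF p, of "u x - u y" "v x - v y"] False
        by (intro mult_nonpos_nonpos) auto
    qed
    then show ?thesis using k0 by (simp add: H_def x_def y_def)
  qed
  have int_G: "integrable lborel G"
    using G_fin G0 by (intro integrableI_nonneg) auto
  have "(\<integral>\<^sup>+z. ennreal (H \<psi>' z) \<partial>lborel) + (\<integral>\<^sup>+z. ennreal (G z) \<partial>lborel) = (\<integral>\<^sup>+z. ennreal (H \<psi>' z + G z) \<partial>lborel)"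
    using H_nonneg G0 by (simp add: nn_integral_add)
  \<comment> \<open>Fatou's lemma for the nonnegative \<open>H (\<psi> n) z + G z\<close>: the
    integrals of \<open>H (\<psi> n)\<close> are at most 0, so the lower limit is at most the
    integral of \<open>G\<close>, which is finite and cancels.\<close>
  also have "\<dots> = (\<integral>\<^sup>+z. liminf (\<lambda>n. ennreal (H (\<psi> n) z + G z)) \<partial>lborel)"
  proof (intro nn_integral_cong)
    fix z :: "'a \<times> 'a"
    have "(\<lambda>n. ennreal (H (\<psi> n) z + G z)) \<longlonglongrightarrow> ennreal (H \<psi>' z + G z)"
      unfolding H_def by (intro tendsto_ennrealI tendsto_intros \<psi>_lim)
    then show "ennreal (H \<psi>' z + G z) = liminf (\<lambda>n. ennreal (H (\<psi> n) z + G z))"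
      by (simp add: lim_imp_Liminf)
  qed
  also have "\<dots> \<le> liminf (\<lambda>n. \<integral>\<^sup>+z. ennreal (H (\<psi> n) z + G z) \<partial>lborel)"
    by (rule nn_integral_liminf) measurable
  also have "\<dots> \<le> liminf (\<lambda>n. \<integral>\<^sup>+z. ennreal (G z) \<partial>lborel)"
  proof (intro Liminf_mono always_eventually allI)
    fix n
    have "(\<integral>\<^sup>+z. ennreal (H (\<psi> n) z + G z) \<partial>lborel) = ennreal (\<integral>z. H (\<psi> n) z + G z \<partial>lborel)"
      using H_int[of n] int_G H_lower by (intro nn_integral_eq_integral) auto
    also have "\<dots> \<le> ennreal (integral\<^sup>L lborel G)"
      using H_int[of n] int_G H_le[of n] by (intro ennreal_leI) simp
    also have "\<dots> = (\<integral>\<^sup>+z. ennreal (G z) \<partial>lborel)"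
      using int_G G0 by (intro nn_integral_eq_integral[symmetric]) auto
    finally show "(\<integral>\<^sup>+z. ennreal (H (\<psi> n) z + G z) \<partial>lborel) \<le> (\<integral>\<^sup>+z. ennreal (G z) \<partial>lborel)" .
  qed
  also have "\<dots> = (\<integral>\<^sup>+z. ennreal (G z) \<partial>lborel)" by (simp add: Liminf_const)
  finally have "(\<integral>\<^sup>+z. ennreal (G z) \<partial>lborel) + (\<integral>\<^sup>+z. ennreal (H \<psi>' z) \<partial>lborel)
      \<le> (\<integral>\<^sup>+z. ennreal (G z) \<partial>lborel) + 0"
    by (simp add: add.commute)
  then have "(\<integral>\<^sup>+z. ennreal (H \<psi>' z) \<partial>lborel) = 0"
    using G_fin unfolding ennreal_add_left_cancel_le by auto
  then have H_zero: "AE z in lborel. H \<psi>' z = 0"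
    using H_nonneg by (subst (asm) nn_integral_0_iff_AE) (auto simp: ennreal_eq_0_iff intro: antisym elim!: eventually_mono)

  define P where "P = {x. 0 < \<psi>' x}"
  have [measurable]: "P \<in> sets borel" "\<Omega> \<in> sets borel" unfolding P_def using \<Omega>(1) by measurable
  have pos: "H \<psi>' (x, y) \<noteq> 0" if "x \<in> P" "y \<notin> \<Omega>" for x y
  proof -
    have y0: "u y = 0" "v y = 0" "\<psi>' y = 0"
      using that u_out v_out \<epsilon> by (auto simp: \<psi>'_eq unit_clamp_eq_0)
    have x: "0 < \<psi>' x" using that by (simp add: P_def)
    then have "0 < u x - v x - \<epsilon>" unfolding \<psi>'_eq using unit_clamp_eq_0[of "u x - v x - \<epsilon>"] by force
    then have "v x - v y < u x - u y" using y0 \<epsilon> by simp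
    then have "pflux p (v x - v y) < pflux p (u x - u y)" by (rule pflux_strict_mono[OF p])
    moreover have "x \<noteq> y" using x y0 by auto
    ultimately show ?thesis using x y0 by (simp add: H_def k_def)
  qed
  have "AE z in lborel. z \<notin> P \<times> (- \<Omega>)"
    using H_zero by eventually_elim (use pos in auto)
  then have "emeasure (lborel \<Otimes>\<^sub>M lborel) (P \<times> (- \<Omega>)) = 0"
    unfolding lborel_prod[symmetric] by (subst (asm) AE_iff_measurable[of "P \<times> (- \<Omega>)"]) (auto simp: space_pair_measure)
  then have "emeasure lborel P * emeasure lborel (- \<Omega>) = 0"
    by (simp add: lborel.emeasure_pair_measure_Times)
  moreover have "emeasure lborel (- \<Omega>) \<noteq> 0"
  proof
    assume "emeasure lborel (- \<Omega>) = 0"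
    moreover have "emeasure lborel (UNIV :: 'a set) \<le> emeasure lborel (- \<Omega>) + emeasure lborel \<Omega>"
      using emeasure_subadditive[of "- \<Omega>" lborel \<Omega>] by (simp add: Un_commute Compl_partition)
    ultimately show False using emeasure_bounded_finite[OF \<Omega>(2)] by simp
  qed
  ultimately have "emeasure lborel P = 0" by simp
  then have "AE x in lborel. x \<notin> P" by (intro AE_not_in) (auto simp: null_sets_def)
  then show ?thesis
  proof eventually_elim
    case (elim x)
    then have "\<not> 0 < u x - v x - \<epsilon>" by (auto simp: P_def \<psi>'_eq unit_clamp_def)
    then show ?case by simp
  qed
qed

lemma borel_solution_le:
  fixes u v f :: "'a::euclidean_space \<Rightarrow> real" and s p \<gamma> :: real
  assumes "0 < s" "s < 1" "1 < p" "0 < \<gamma>"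
    and "open \<Omega>" "bounded \<Omega>" "smooth_boundary \<Omega>"
    and "AE x in lebesgue. x \<in> \<Omega> \<longrightarrow> 0 \<le> f x"
    and "borel_solution s p \<gamma> f \<Omega> u" "borel_solution s p \<gamma> f \<Omega> v"
  shows "AE x in lborel. u x \<le> v x"
proof -
  have "AE x in lborel. \<forall>n. u x \<le> v x + 1 / real (Suc n)"
    unfolding AE_all_countable using assms by (intro allI borel_solution_le_plus) auto
  then show ?thesis
  proof eventually_elim
    case (elim x)
    show ?case
    proof (rule field_le_epsilon)
      fix e :: real assume "0 < e"
      then obtain n where "1 / real (Suc n) < e" using nat_approx_posE by blast
      then show "u x \<le> v x + e" using elim[rule_format, of n] by linarith
    qed
  qed
qed

section \<open>Passage to Borel representatives\<close>

lemma sigma_finite_lebesgue: "sigma_finite_measure (lebesgue :: 'a::euclidean_space measure)"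
proof
  obtain A :: "'a set set" where A: "countable A" "A \<subseteq> sets lborel" "\<Union>A = space lborel"
    "\<forall>a\<in>A. emeasure lborel a \<noteq> \<infinity>"
    using lborel.sigma_finite_countable by blast
  then show "\<exists>A. countable A \<and> A \<subseteq> sets (lebesgue :: 'a measure) \<and> \<Union>A = space (lebesgue :: 'a measure)
      \<and> (\<forall>a\<in>A. emeasure lebesgue a \<noteq> \<infinity>)"
    by (intro exI[of _ A]) auto
qed

text \<open>The identity map, read into the Borel sets, forgets the extra sets added by completing
  each factor; integrals of Borel functions then transfer by the rules for image measures.\<close>

lemma lborel_eq_distr_lebesgue_pair:
  "(lborel :: ('a::euclidean_space \<times> 'a) measure) = distr (lebesgue \<Otimes>\<^sub>M lebesgue) (lborel \<Otimes>\<^sub>M lborel) (\<lambda>z. z)"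
proof -
  have "distr lebesgue lborel (\<lambda>x. x) = (lborel :: 'a measure)"
    by (subst distr_completion) (simp_all add: distr_id)
  then have "distr (lebesgue \<Otimes>\<^sub>M lebesgue) (lborel \<Otimes>\<^sub>M lborel) (\<lambda>(x, y). (x, y))
      = (lborel :: 'a measure) \<Otimes>\<^sub>M (lborel :: 'a measure)"
    using pair_measure_distr[of "\<lambda>x. x" lebesgue "lborel :: 'a measure" "\<lambda>x. x" lebesgue "lborel :: 'a measure"]
    by (simp add: measurable_completion sigma_finite_lborel)
  then show ?thesis by (simp add: lborel_prod flip: id_def)
qed

lemma measurable_lebesgue_pair_lborel:
  "(\<lambda>z. z) \<in> measurable (lebesgue \<Otimes>\<^sub>M lebesgue) ((lborel :: 'a::euclidean_space measure) \<Otimes>\<^sub>M (lborel :: 'a measure))"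
proof -
  have "(\<lambda>z. (fst z, snd z)) \<in> measurable (lebesgue \<Otimes>\<^sub>M lebesgue) ((lborel :: 'a measure) \<Otimes>\<^sub>M (lborel :: 'a measure))"
    by (intro measurable_Pair measurable_compose[OF measurable_fst] measurable_compose[OF measurable_snd]
        measurable_completion) simp_all
  then show ?thesis by simp
qed

lemma nn_integral_lebesgue_pair:
  fixes F :: "'a::euclidean_space \<times> 'a \<Rightarrow> ennreal"
  assumes "F \<in> borel_measurable borel"
  shows "(\<integral>\<^sup>+z. F z \<partial>(lebesgue \<Otimes>\<^sub>M lebesgue)) = (\<integral>\<^sup>+z. F z \<partial>lborel)"
proof -
  have "F \<in> borel_measurable (lborel \<Otimes>\<^sub>M lborel)" using assms by (simp add: lborel_prod)
  then show ?thesis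
    by (subst lborel_eq_distr_lebesgue_pair) (simp add: nn_integral_distr[OF measurable_lebesgue_pair_lborel])
qed

lemma has_bochner_integral_lebesgue_pair:
  fixes F :: "'a::euclidean_space \<times> 'a \<Rightarrow> real"
  assumes "F \<in> borel_measurable borel" "has_bochner_integral (lebesgue \<Otimes>\<^sub>M lebesgue) F c"
  shows "has_bochner_integral lborel F c"
proof -
  have "F \<in> borel_measurable (lborel \<Otimes>\<^sub>M lborel)" using assms(1) by (simp add: lborel_prod)
  then show ?thesis
    by (subst lborel_eq_distr_lebesgue_pair)
      (intro has_bochner_integral_distr measurable_lebesgue_pair_lborel assms(2))
qed

lemma borel_measurable_lebesgue_pair:
  fixes F :: "'a::euclidean_space \<times> 'a \<Rightarrow> real"
  assumes "F \<in> borel_measurable borel"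
  shows "F \<in> borel_measurable (lebesgue \<Otimes>\<^sub>M lebesgue)"
proof -
  have "F \<in> borel_measurable (lborel \<Otimes>\<^sub>M lborel)" using assms by (simp add: lborel_prod)
  from measurable_compose[OF measurable_lebesgue_pair_lborel this] show ?thesis by simp
qed

section \<open>Borel representatives of weak solutions\<close>

lemma test_function_measurable:
  assumes "test_function \<Omega> \<phi>" shows "\<phi> \<in> borel_measurable borel"
  using assms unfolding test_function_def smooth_def
  by (metis Ck_imp_continuous borel_measurable_continuous_onI)

lemma weak_solution_imp_borel_solution:
  fixes u f :: "'a::euclidean_space \<Rightarrow> real"
  assumes \<Omega>: "open \<Omega>" and f: "set_integrable lebesgue \<Omega> f"
    and u: "weak_solution s p \<gamma> f \<Omega> u"
  obtains u' where "borel_solution s p \<gamma> f \<Omega> u'" "AE x in lebesgue. u x = u' x"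
proof -
  have \<Omega>_leb [measurable]: "\<Omega> \<in> sets lebesgue" using \<Omega> by simp
  have [measurable]: "\<Omega> \<in> sets borel" using \<Omega> by simp
  have u_meas [measurable]: "(\<lambda>x. indicator \<Omega> x *\<^sub>R u x) \<in> borel_measurable lebesgue"
    using u by (simp add: weak_solution_def in_Lp_def set_borel_measurable_def)
  then obtain u0 :: "'a \<Rightarrow> real" where u0 [measurable]: "u0 \<in> borel_measurable borel"
    and eq0: "AE x in lborel. indicator \<Omega> x *\<^sub>R u x = u0 x"
    using completion_ex_borel_measurable_real[of "\<lambda>x. indicator \<Omega> x *\<^sub>R u x" lborel] by auto
  \<comment> \<open>The value 1 is a filler on the null set of points of \<Omega> where the Borel
    version \<open>u0\<close> fails to be positive.\<close>
  define u' where "u' x = (if x \<in> \<Omega> then if 0 < u0 x then u0 x else 1 else 0)" for x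
  have [measurable]: "u' \<in> borel_measurable borel" unfolding u'_def[abs_def] by measurable
  have [measurable]: "u' \<in> borel_measurable lebesgue" by (intro measurable_completion) simp
  have u'_pos: "0 < u' x" if "x \<in> \<Omega>" for x using that by (simp add: u'_def)
  have u'_out: "u' x = 0" if "x \<notin> \<Omega>" for x using that by (simp add: u'_def)
  have "AE x in lebesgue. x \<in> \<Omega> \<longrightarrow> 0 < u x" "AE x in lebesgue. x \<notin> \<Omega> \<longrightarrow> u x = 0"
    using u by (simp_all add: weak_solution_def zero_outside_def)
  with eq0[THEN AE_completion] have eq: "AE x in lebesgue. u x = u' x"
    by eventually_elim (auto simp: u'_def indicator_def)
  have eq_pair: "AE z in lebesgue \<Otimes>\<^sub>M lebesgue. u (fst z) = u' (fst z) \<and> u (snd z) = u' (snd z)"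
    by (intro AE_conjI AE_pair_fst AE_pair_snd sigma_finite_lebesgue eq)
  have f_meas [measurable]: "(\<lambda>x. indicator \<Omega> x *\<^sub>R f x) \<in> borel_measurable lebesgue"
    using f unfolding set_integrable_def by (rule borel_measurable_integrable)
  \<comment> \<open>Phrased for functions that agree wherever \<open>u\<close> and \<open>u'\<close>
    do, so that it serves \<open>u\<close> as well as its power.\<close>
  have gag: "(\<integral>\<^sup>+z. ennreal (\<bar>w' (fst z) - w' (snd z)\<bar> powr p / norm (fst z - snd z) powr (real DIM('a) + s * p))
      * indicator (K \<times> K) z \<partial>lborel) = gagliardo_pow s p K w"
    if w': "w' \<in> borel_measurable borel" and K: "K \<in> sets borel"
      and w: "\<And>x. u x = u' x \<Longrightarrow> w x = w' x" for w w' K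
  proof -
    note [measurable] = w'
    have [measurable]: "K \<times> K \<in> sets borel" using K by (simp add: borel_prod[symmetric])
    have "(\<integral>\<^sup>+z. ennreal (\<bar>w' (fst z) - w' (snd z)\<bar> powr p / norm (fst z - snd z) powr (real DIM('a) + s * p))
        * indicator (K \<times> K) z \<partial>lborel)
      = (\<integral>\<^sup>+z. ennreal (\<bar>w' (fst z) - w' (snd z)\<bar> powr p / norm (fst z - snd z) powr (real DIM('a) + s * p))
        * indicator (K \<times> K) z \<partial>(lebesgue \<Otimes>\<^sub>M lebesgue))"
      by (rule nn_integral_lebesgue_pair[symmetric]) measurable
    also have "\<dots> = gagliardo_pow s p K w"
      unfolding gagliardo_pow_def
      by (intro nn_integral_cong_AE) (use eq_pair in \<open>eventually_elim, simp add: w\<close>)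
    finally show ?thesis .
  qed
  have weight_eq: "AE x in lebesgue. f x / u x powr \<gamma> = f x / u' x powr \<gamma>"
    using eq by eventually_elim simp
  have sol: "borel_solution s p \<gamma> f \<Omega> u'"
    unfolding borel_solution_def
  proof (intro conjI allI impI ballI)
    show "u' \<in> borel_measurable borel" by measurable
    show "0 < u' x" if "x \<in> \<Omega>" for x using that by (rule u'_pos)
    show "u' x = 0" if "x \<notin> \<Omega>" for x using that by (rule u'_out)
    have inside: "compactly_inside K \<Omega>" if "compact K" "K \<subseteq> \<Omega>" for K
      using that by (simp add: compactly_inside_def compact_imp_closed closure_closed borel_compact)
    show "(\<integral>\<^sup>+z. ennreal (\<bar>u' (fst z) - u' (snd z)\<bar> powr p / norm (fst z - snd z) powr (real DIM('a) + s * p))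
        * indicator (K \<times> K) z \<partial>lborel) < \<infinity>" if K: "compact K" "K \<subseteq> \<Omega>" for K
    proof -
      have "gagliardo_pow s p K u < \<infinity>"
        using u inside[OF K] by (simp add: weak_solution_def in_Wsp_loc_def)
      then show ?thesis by (subst gag[of u' K u]) (simp_all add: borel_compact K)
    qed
    show "(\<integral>\<^sup>+x. ennreal (\<bar>u' x\<bar> powr (p - 1)) \<partial>lborel) < \<infinity>"
    proof -
      have "(\<integral>\<^sup>+x. ennreal (\<bar>u' x\<bar> powr (p - 1)) \<partial>lborel) = (\<integral>\<^sup>+x. ennreal (\<bar>u' x\<bar> powr (p - 1)) \<partial>lebesgue)"
        by (simp add: nn_integral_completion)
      also have "\<dots> = (\<integral>\<^sup>+x\<in>\<Omega>. ennreal (\<bar>u x\<bar> powr (p - 1)) \<partial>lebesgue)"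
      proof (rule nn_integral_cong_AE)
        show "AE x in lebesgue. ennreal (\<bar>u' x\<bar> powr (p - 1)) = ennreal (\<bar>u x\<bar> powr (p - 1)) * indicator \<Omega> x"
          using eq by eventually_elim (auto simp: indicator_def u'_out)
      qed
      also have "\<dots> < \<infinity>" using u by (simp add: weak_solution_def in_Lp_def)
      finally show ?thesis .
    qed
    show "set_integrable lebesgue K (\<lambda>x. f x / u' x powr \<gamma>)" if K: "compact K" "K \<subseteq> \<Omega>" for K
    proof -
      have "set_integrable lebesgue K (\<lambda>x. f x / u x powr \<gamma>)"
        using u inside[OF K] by (simp add: weak_solution_def)
      moreover
      have [measurable]: "K \<in> sets lebesgue" using K by (simp add: borel_compact)
      \<comment> \<open>\<open>f\<close> is known to be measurable only on \<Omega>, so the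
        indicator of \<Omega> is attached to it before measurability is claimed.\<close>
      have restrict: "(\<lambda>x. indicator K x *\<^sub>R (f x / u' x powr \<gamma>))
          = (\<lambda>x. indicator K x *\<^sub>R ((indicator \<Omega> x *\<^sub>R f x) / u' x powr \<gamma>))"
        using K(2) by (auto simp: indicator_def fun_eq_iff)
      have "(\<lambda>x. indicator K x *\<^sub>R (f x / u' x powr \<gamma>)) \<in> borel_measurable lebesgue"
        unfolding restrict by measurable
      ultimately show ?thesis
        unfolding set_integrable_def
        by (rule integrable_cong_AE_imp) (use weight_eq in \<open>eventually_elim, simp\<close>)
    qed
    show "has_bochner_integral lborel (form_density s p u' \<phi>) (LINT x:\<Omega>|lebesgue. f x / u' x powr \<gamma> * \<phi> x)"
      if \<phi>: "test_function \<Omega> \<phi>" for \<phi>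
    proof -
      have [measurable]: "\<phi> \<in> borel_measurable borel" using \<phi> by (rule test_function_measurable)
      have [measurable]: "\<phi> \<in> borel_measurable lebesgue" by (intro measurable_completion) simp
      let ?F = "\<lambda>(x, y). \<bar>u x - u y\<bar> powr (p - 2) * (u x - u y) * (\<phi> x - \<phi> y)
          / norm (x - y) powr (real DIM('a) + s * p)"
      have F: "has_bochner_integral (lebesgue \<Otimes>\<^sub>M lebesgue) ?F (LINT x:\<Omega>|lebesgue. f x / u x powr \<gamma> * \<phi> x)"
        using u \<phi> by (simp add: weak_solution_def)
      have F' [measurable]: "form_density s p u' \<phi> \<in> borel_measurable borel"
        unfolding form_density_def[abs_def] by measurable
      have "AE z in lebesgue \<Otimes>\<^sub>M lebesgue. ?F z = form_density s p u' \<phi> z"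
        using eq_pair by eventually_elim (auto simp: form_density_def pflux_def)
      then have "has_bochner_integral (lebesgue \<Otimes>\<^sub>M lebesgue) (form_density s p u' \<phi>)
          (LINT x:\<Omega>|lebesgue. f x / u x powr \<gamma> * \<phi> x)"
        using F has_bochner_integral_cong_AE[of ?F "lebesgue \<Otimes>\<^sub>M lebesgue" "form_density s p u' \<phi>"]
          borel_measurable_has_bochner_integral[OF F] borel_measurable_lebesgue_pair[OF F'] by simp
      then have "has_bochner_integral lborel (form_density s p u' \<phi>) (LINT x:\<Omega>|lebesgue. f x / u x powr \<gamma> * \<phi> x)"
        by (rule has_bochner_integral_lebesgue_pair[OF F'])
      moreover have "(LINT x:\<Omega>|lebesgue. f x / u x powr \<gamma> * \<phi> x) = (LINT x:\<Omega>|lebesgue. f x / u' x powr \<gamma> * \<phi> x)"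
        unfolding set_lebesgue_integral_def
      proof (rule integral_cong_AE)
        have eq_u: "(\<lambda>x. indicator \<Omega> x *\<^sub>R (f x / u x powr \<gamma> * \<phi> x))
            = (\<lambda>x. (indicator \<Omega> x *\<^sub>R f x) / (indicator \<Omega> x *\<^sub>R u x) powr \<gamma> * \<phi> x)"
          by (auto simp: indicator_def fun_eq_iff)
        show "(\<lambda>x. indicator \<Omega> x *\<^sub>R (f x / u x powr \<gamma> * \<phi> x)) \<in> borel_measurable lebesgue"
          unfolding eq_u by measurable
        have eq_u': "(\<lambda>x. indicator \<Omega> x *\<^sub>R (f x / u' x powr \<gamma> * \<phi> x))
            = (\<lambda>x. (indicator \<Omega> x *\<^sub>R f x) / u' x powr \<gamma> * \<phi> x)"
          by (auto simp: indicator_def fun_eq_iff)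
        show "(\<lambda>x. indicator \<Omega> x *\<^sub>R (f x / u' x powr \<gamma> * \<phi> x)) \<in> borel_measurable lebesgue"
          unfolding eq_u' by measurable
        show "AE x in lebesgue. indicator \<Omega> x *\<^sub>R (f x / u x powr \<gamma> * \<phi> x) = indicator \<Omega> x *\<^sub>R (f x / u' x powr \<gamma> * \<phi> x)"
          using weight_eq by eventually_elim auto
      qed
      ultimately show ?thesis by simp
    qed
    show "gagliardo_energy s p (\<lambda>x. u' x powr max ((\<gamma> + p - 1) / p) 1) < \<infinity>"
    proof -
      have "gagliardo_pow s p UNIV (\<lambda>x. u x powr max ((\<gamma> + p - 1) / p) 1) < \<infinity>"
        using u by (simp add: weak_solution_def in_Wsp0_def in_Wsp_def)
      then show ?thesis
        using gag[of "\<lambda>x. u' x powr max ((\<gamma> + p - 1) / p) 1" UNIV "\<lambda>x. u x powr max ((\<gamma> + p - 1) / p) 1"]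
        by (simp add: gagliardo_energy_def)
    qed
  qed
  show ?thesis using sol eq by (rule that)
qed

theorem theorem1p4:
  fixes p s \<gamma> :: real
    and \<Omega> :: "'a::euclidean_space set"
    and f u v :: "'a \<Rightarrow> real"
  assumes "1 < p"
    and "0 < s" and "s < 1"
    and "smooth_bounded_domain \<Omega>"
    and "s * p < real DIM('a)"
    and "0 < \<gamma>"
    and "set_integrable lebesgue \<Omega> f"
    and "AE x in lebesgue. x \<in> \<Omega> \<longrightarrow> 0 \<le> f x"
    and "weak_solution s p \<gamma> f \<Omega> u" and "zero_on_boundary s p \<Omega> u"
    and "weak_solution s p \<gamma> f \<Omega> v" and "zero_on_boundary s p \<Omega> v"
  shows "AE x in lebesgue. x \<in> \<Omega> \<longrightarrow> u x = v x"
proof -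
  have \<Omega>: "open \<Omega>" "bounded \<Omega>" "smooth_boundary \<Omega>"
    using assms(4) by (auto simp: smooth_bounded_domain_def)
  obtain u' where u': "borel_solution s p \<gamma> f \<Omega> u'" "AE x in lebesgue. u x = u' x"
    by (rule weak_solution_imp_borel_solution[OF \<Omega>(1) assms(7,9)])
  obtain v' where v': "borel_solution s p \<gamma> f \<Omega> v'" "AE x in lebesgue. v x = v' x"
    by (rule weak_solution_imp_borel_solution[OF \<Omega>(1) assms(7,11)])
  note le = borel_solution_le[OF assms(2,3,1,6) \<Omega> assms(8)]
  from u'(2) v'(2) le[OF u'(1) v'(1), THEN AE_completion] le[OF v'(1) u'(1), THEN AE_completion]
  show ?thesis by eventually_elim auto
qed

end
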